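(* Let $P$ be a polynomial endofunctor represented by a diagram of groupoids $I\leftarrow E\to B\to I$, where $s:=|\pi_0 I|$ is finite and all $P$-trees have finite automorphism groups. The following Faà di Bruno formula holds for the Green function $G$ in (the completion of) the bialgebra of $P$-trees: $$\Delta(G)=\sum_{\mathbf n\in\mathbb N^s}G^{\mathbf n}\otimes g_{\mathbf n},\qquad\text{where } G^{\mathbf n}=\prod_{v\in\pi_0 I}G_v^{\,n_v}.$$
   Context: Trees. A tree is a diagram of finite sets $A\xleftarrow{s}M\xrightarrow{p}N\xrightarrow{t}A$ such that $t$ is injective; $s$ is injective with singleton complement $\{1\}$ (the root); and, with $\sigma:A\to A$ given by $\sigma(1)=1$ and $\sigma(s(e))=t(p(e))$, for every $x\in A$ there is $k\in\mathbb N$ with $\sigma^k(x)=1$. Elements of $A$ are edges, elements of $N$ are nodes, $t(n)$ is the output edge of the node $n$, $p^{-1}(n)$ its set of input edges, and the leaves are the elements of $A\setminus t(N)$. A tree embedding is a triple of (necessarily injective) maps $A'\to A$, $M'\to M$, $N'\to N$ commuting with the structure maps and such that the square over $p$ is a pullback; it is root-preserving if it sends root to root. $P$-trees. A $P$-tree is a tree together with functors $\alpha:A\to I$, $M\to E$, $N\to B$ and specified natural isomorphisms making the three squares to $I\leftarrow E\to B\to I$ commute (the same $\alpha$ at both ends), with the middle square a homotopy pullback. An embedding of $P$-trees is a tree embedding together with natural isomorphisms between the decorating functors compatible with all specified isomorphisms; $\mathbf T$ is the groupoid of $P$-trees and their isomorphisms. Assuming $P$-trees have finite automorphism groups includes that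 $\operatorname{Aut}(v)$ is finite for every $v\in I$ (trivial trees). The groupoid of $P$-forests $\mathbf F$ is the groupoid of finite families of $P$-trees. $\widetilde I$ is the groupoid whose objects are functors $N:X\to I$ with $X$ a finite set, and whose arrows are bijections of the indexing sets together with a natural isomorphism of the maps to $I$. Isomorphism classes of $\widetilde I$ correspond to multi-indices $\mathbf n=(n_v)_{v\in\pi_0 I}\in\mathbb N^s$, where $n_v$ counts the elements of $X$ with colour isomorphic to $v$. The leaf functor $L:\mathbf T\to\widetilde I$ sends a $P$-tree to its set of leaves coloured by $\alpha$; the root functor $R:\mathbf T\to I$ sends a $P$-tree to $\alpha(1)$. For $v\in I$, $\mathbf T_v$ is the homotopy fibre of $R$ over $v$: objects are pairs $(T,\varphi:R(T)\xrightarrow{\sim}v)$, arrows are isomorphisms of $P$-trees compatible with the $\varphi$'s. Cuts. A cut $c$ of a $P$-tree $T$ is a subtree $S\subset T$ containing the root, i.e. an isomorphism class (over $T$) of root-preserving embeddings $S\rightarrowtail T$; $\operatorname{cut}(T)$ is the set of cuts. Put $S_c:=S$ and let $P_c$ be the forest, indexed by the leaves $\ell$ of $S$, of the ideal subtrees $T_\ell\subset T$, where $T_\ell$ has root $\ell$ and consists of all edges $x$ of $T$ with $\sigma^k(x)=\ell$ for some $k\ge0$ and all nodes whose output edge is such an edge. Bialgebra. $\mathcal B=\mathbb Q[\delta_T]_{T\in\pi_0\mathbf T}$ is the polynomial algebra on isomorphism classes of $P$-trees; a $P$-forest $Q$ determines the monomial $\delta_Q$, the product of the $\delta$'s of its trees.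 The comultiplication is the algebra map with $\Delta(\delta_T)=\sum_{c\in\operatorname{cut}(T)}\delta_{P_c}\otimes\delta_{S_c}$, extended to the completion $\mathbb Q[[\delta_T]]_{T\in\pi_0\mathbf T}$ (with values in the correspondingly completed tensor product). Green functions, in $\mathbb Q[[\delta_T]]$: $$G=\sum_{T\in\pi_0\mathbf T}\frac{\delta_T}{|\operatorname{Aut}(T)|},\qquad G_v=\sum_{T\in\pi_0(\mathbf T_v)}\frac{\delta_T}{|\operatorname{Aut}_v(T)|},\qquad g_{\mathbf n}=\sum_{T\in\pi_0\mathbf T,\ LT\cong N}\frac{\delta_T}{|\operatorname{Aut}(T)|},$$ where $\operatorname{Aut}_v(T)$ is the automorphism group in $\mathbf T_v$ (automorphisms fixing the root colour) and $N\in\widetilde I$ is an object of class $\mathbf n$. *)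

theory Defs
  imports Complex_Main "HOL-Library.FuncSet" "HOL-Library.Multiset" "HOL-Library.Poly_Mapping"
    "HOL-Library.Product_Plus"
begin

section \<open>Groupoids\<close>

text \<open>Hom-sets of distinct pairs of objects are allowed to overlap; \<open>cmp G g f\<close> is
  \<open>g\<close> after \<open>f\<close>.\<close>

record ('o, 'a) groupoid =
  obs :: "'o set"
  hom :: "'o \<Rightarrow> 'o \<Rightarrow> 'a set"
  idn :: "'o \<Rightarrow> 'a"
  cmp :: "'a \<Rightarrow> 'a \<Rightarrow> 'a"

definition is_groupoid :: "('o, 'a) groupoid \<Rightarrow> bool" where
  "is_groupoid G \<longleftrightarrow>
     (\<forall>x\<in>obs G. idn G x \<in> hom G x x) \<and>
     (\<forall>x\<in>obs G. \<forall>y\<in>obs G. \<forall>z\<in>obs G. \<forall>f\<in>hom G x y. \<forall>g\<in>hom G y z. cmp G g f \<in> hom G x z) \<and>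
     (\<forall>x\<in>obs G. \<forall>y\<in>obs G. \<forall>f\<in>hom G x y. cmp G f (idn G x) = f \<and> cmp G (idn G y) f = f) \<and>
     (\<forall>w\<in>obs G. \<forall>x\<in>obs G. \<forall>y\<in>obs G. \<forall>z\<in>obs G.
        \<forall>f\<in>hom G w x. \<forall>g\<in>hom G x y. \<forall>h\<in>hom G y z.
          cmp G h (cmp G g f) = cmp G (cmp G h g) f) \<and>
     (\<forall>x\<in>obs G. \<forall>y\<in>obs G. \<forall>f\<in>hom G x y.
        \<exists>g\<in>hom G y x. cmp G g f = idn G x \<and> cmp G f g = idn G y)"

definition iso_class :: "('o, 'a) groupoid \<Rightarrow> 'o \<Rightarrow> 'o set" where
  "iso_class G x = {y \<in> obs G. hom G x y \<noteq> {}}"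

definition pi0 :: "('o, 'a) groupoid \<Rightarrow> 'o set set" where
  "pi0 G = iso_class G ` obs G"

definition rep :: "'o set \<Rightarrow> 'o" where
  "rep c = (SOME x. x \<in> c)"

definition aut :: "('o, 'a) groupoid \<Rightarrow> 'o \<Rightarrow> 'a set" where
  "aut G x = hom G x x"

record ('o, 'a, 'p, 'b) funct =
  on_ob :: "'o \<Rightarrow> 'p"
  on_arr :: "'a \<Rightarrow> 'b"

definition is_functor ::
    "('o, 'a) groupoid \<Rightarrow> ('p, 'b) groupoid \<Rightarrow> ('o, 'a, 'p, 'b) funct \<Rightarrow> bool" where
  "is_functor G H F \<longleftrightarrow>
     (\<forall>x\<in>obs G. on_ob F x \<in> obs H \<and> on_arr F (idn G x) = idn H (on_ob F x)) \<and>
     (\<forall>x\<in>obs G. \<forall>y\<in>obs G. \<forall>f\<in>hom G x y. on_arr F f \<in> hom H (on_ob F x) (on_ob F y)) \<and>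
     (\<forall>x\<in>obs G. \<forall>y\<in>obs G. \<forall>z\<in>obs G. \<forall>f\<in>hom G x y. \<forall>g\<in>hom G y z.
        on_arr F (cmp G g f) = cmp H (on_arr F g) (on_arr F f))"

definition is_equivalence ::
    "('o, 'a) groupoid \<Rightarrow> ('p, 'b) groupoid \<Rightarrow> ('o, 'a, 'p, 'b) funct \<Rightarrow> bool" where
  "is_equivalence G H F \<longleftrightarrow> is_functor G H F \<and>
     (\<forall>x\<in>obs G. \<forall>y\<in>obs G. bij_betw (on_arr F) (hom G x y) (hom H (on_ob F x) (on_ob F y))) \<and>
     (\<forall>z\<in>obs H. \<exists>x\<in>obs G. hom H (on_ob F x) z \<noteq> {})"

definition discrete :: "'o set \<Rightarrow> ('o, 'o) groupoid" where
  "discrete X = \<lparr>obs = X, hom = (\<lambda>x y. if x = y then {x} else {}), idn = (\<lambda>x. x), cmp = (\<lambda>g f. f)\<rparr>"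

definition homotopy_pullback ::
    "('o, 'a) groupoid \<Rightarrow> ('p, 'b) groupoid \<Rightarrow> ('q, 'c) groupoid \<Rightarrow>
     ('o, 'a, 'q, 'c) funct \<Rightarrow> ('p, 'b, 'q, 'c) funct \<Rightarrow> ('o \<times> 'p \<times> 'c, 'a \<times> 'b) groupoid" where
  "homotopy_pullback X Y Z F G =
     \<lparr>obs = {(x, y, \<theta>). x \<in> obs X \<and> y \<in> obs Y \<and> \<theta> \<in> hom Z (on_ob F x) (on_ob G y)},
      hom = (\<lambda>(x, y, \<theta>) (x', y', \<theta>').
        {(u, w). u \<in> hom X x x' \<and> w \<in> hom Y y y' \<and>
           cmp Z \<theta>' (on_arr F u) = cmp Z (on_arr G w) \<theta>}),
      idn = (\<lambda>(x, y, \<theta>). (idn X x, idn Y y)),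
      cmp = (\<lambda>(u', w') (u, w). (cmp X u' u, cmp Y w' w))\<rparr>"

definition homotopy_fibre ::
    "('o, 'a) groupoid \<Rightarrow> ('p, 'b) groupoid \<Rightarrow> ('o, 'a, 'p, 'b) funct \<Rightarrow> 'p \<Rightarrow>
     ('o \<times> 'b, 'a) groupoid" where
  "homotopy_fibre G H F v =
     \<lparr>obs = {(x, \<phi>). x \<in> obs G \<and> \<phi> \<in> hom H (on_ob F x) v},
      hom = (\<lambda>(x, \<phi>) (x', \<phi>'). {f \<in> hom G x x'. cmp H \<phi>' (on_arr F f) = \<phi>}),
      idn = (\<lambda>(x, \<phi>). idn G x),
      cmp = cmp G\<rparr>"

section \<open>Polynomial diagrams and trees\<close>

text \<open>A diagram \<open>I \<leftarrow> E \<rightarrow> B \<rightarrow> I\<close> of groupoids, with functors \<open>src_f\<close>, \<open>mid_f\<close>, \<open>tgt_f\<close>.\<close>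

record ('i, 'ia, 'e, 'ea, 'b, 'ba) poly_diagram =
  gI :: "('i, 'ia) groupoid"
  gE :: "('e, 'ea) groupoid"
  gB :: "('b, 'ba) groupoid"
  src_f :: "('e, 'ea, 'i, 'ia) funct"
  mid_f :: "('e, 'ea, 'b, 'ba) funct"
  tgt_f :: "('b, 'ba, 'i, 'ia) funct"

definition is_poly_diagram :: "('i, 'ia, 'e, 'ea, 'b, 'ba) poly_diagram \<Rightarrow> bool" where
  "is_poly_diagram P \<longleftrightarrow> is_groupoid (gI P) \<and> is_groupoid (gE P) \<and> is_groupoid (gB P) \<and>
     is_functor (gE P) (gI P) (src_f P) \<and> is_functor (gE P) (gB P) (mid_f P) \<and>
     is_functor (gB P) (gI P) (tgt_f P)"

text \<open>The finite sets \<open>A\<close> (edges), \<open>M\<close> (node-input incidences) and \<open>N\<close> (nodes) are taken to be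
  sets of natural numbers, which represents every finite tree up to isomorphism. Values of the
  structure maps outside the carriers are irrelevant.\<close>

record tree =
  edges :: "nat set"
  marks :: "nat set"
  nodes :: "nat set"
  ts :: "nat \<Rightarrow> nat"
  tp :: "nat \<Rightarrow> nat"
  tt :: "nat \<Rightarrow> nat"

definition root :: "('z) tree_scheme \<Rightarrow> nat" where
  "root T = the_elem (edges T - ts T ` marks T)"

definition walk :: "('z) tree_scheme \<Rightarrow> nat \<Rightarrow> nat" where
  "walk T x = (if x = root T then root T else tt T (tp T (inv_into (marks T) (ts T) x)))"

definition leaves :: "('z) tree_scheme \<Rightarrow> nat set" where
  "leaves T = edges T - tt T ` nodes T"

definition is_tree :: "('z) tree_scheme \<Rightarrow> bool" where
  "is_tree T \<longleftrightarrow> finite (edges T) \<and> finite (marks T) \<and> finite (nodes T) \<and>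
     ts T \<in> marks T \<rightarrow> edges T \<and> tp T \<in> marks T \<rightarrow> nodes T \<and> tt T \<in> nodes T \<rightarrow> edges T \<and>
     inj_on (tt T) (nodes T) \<and> inj_on (ts T) (marks T) \<and>
     (\<exists>r. edges T - ts T ` marks T = {r}) \<and>
     (\<forall>x\<in>edges T. \<exists>k. (walk T ^^ k) x = root T)"

definition is_tree_embedding ::
    "('z) tree_scheme \<Rightarrow> ('z) tree_scheme \<Rightarrow> (nat \<Rightarrow> nat) \<Rightarrow> (nat \<Rightarrow> nat) \<Rightarrow> (nat \<Rightarrow> nat) \<Rightarrow> bool" where
  "is_tree_embedding S T f g k \<longleftrightarrow>
     f \<in> edges S \<rightarrow> edges T \<and> g \<in> marks S \<rightarrow> marks T \<and> k \<in> nodes S \<rightarrow> nodes T \<and>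
     (\<forall>m\<in>marks S. f (ts S m) = ts T (g m) \<and> k (tp S m) = tp T (g m)) \<and>
     (\<forall>n\<in>nodes S. f (tt S n) = tt T (k n)) \<and>
     (\<forall>n\<in>nodes S. \<forall>m'\<in>marks T. tp T m' = k n \<longrightarrow> (\<exists>!m. m \<in> marks S \<and> g m = m' \<and> tp S m = n))"

section \<open>\<open>P\<close>-trees\<close>

record ('i, 'ia, 'e, 'b, 'ba) ptree = tree +
  colA :: "nat \<Rightarrow> 'i"
  colM :: "nat \<Rightarrow> 'e"
  colN :: "nat \<Rightarrow> 'b"
  isoS :: "nat \<Rightarrow> 'ia"
  isoP :: "nat \<Rightarrow> 'ba"
  isoT :: "nat \<Rightarrow> 'ia"

definition node_colouring ::
    "('i, 'ia, 'e, 'ea, 'b, 'ba) poly_diagram \<Rightarrow> ('i, 'ia, 'e, 'b, 'ba) ptree \<Rightarrow>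
     (nat, nat, 'b, 'ba) funct" where
  "node_colouring P T = \<lparr>on_ob = colN T, on_arr = (\<lambda>n. idn (gB P) (colN T n))\<rparr>"

text \<open>The functor from the discrete groupoid \<open>M\<close> to the homotopy pullback of \<open>E \<rightarrow> B \<leftarrow> N\<close>
  induced by the middle square.\<close>

definition middle_comparison ::
    "('i, 'ia, 'e, 'ea, 'b, 'ba) poly_diagram \<Rightarrow> ('i, 'ia, 'e, 'b, 'ba) ptree \<Rightarrow>
     (nat, nat, 'e \<times> nat \<times> 'ba, 'ea \<times> nat) funct" where
  "middle_comparison P T =
     \<lparr>on_ob = (\<lambda>m. (colM T m, tp T m, isoP T m)),
      on_arr = (\<lambda>m. (idn (gE P) (colM T m), tp T m))\<rparr>"

definition is_ptree ::
    "('i, 'ia, 'e, 'ea, 'b, 'ba) poly_diagram \<Rightarrow> ('i, 'ia, 'e, 'b, 'ba) ptree \<Rightarrow> bool" where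
  "is_ptree P T \<longleftrightarrow> is_tree T \<and>
     colA T \<in> edges T \<rightarrow> obs (gI P) \<and> colM T \<in> marks T \<rightarrow> obs (gE P) \<and>
     colN T \<in> nodes T \<rightarrow> obs (gB P) \<and>
     (\<forall>m\<in>marks T. isoS T m \<in> hom (gI P) (on_ob (src_f P) (colM T m)) (colA T (ts T m))) \<and>
     (\<forall>m\<in>marks T. isoP T m \<in> hom (gB P) (on_ob (mid_f P) (colM T m)) (colN T (tp T m))) \<and>
     (\<forall>n\<in>nodes T. isoT T n \<in> hom (gI P) (on_ob (tgt_f P) (colN T n)) (colA T (tt T n))) \<and>
     is_equivalence (discrete (marks T))
       (homotopy_pullback (gE P) (discrete (nodes T)) (gB P) (mid_f P) (node_colouring P T))
       (middle_comparison P T)"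

text \<open>A map of \<open>P\<close>-trees records its source, so that composition can restrict to the carriers;
  all components are \<open>undefined\<close> outside the carriers, so that equality of maps is equality on
  the carriers.\<close>

record ('i, 'ia, 'e, 'ea, 'b, 'ba) ptree_map =
  dm :: "('i, 'ia, 'e, 'b, 'ba) ptree"
  mapA :: "nat \<Rightarrow> nat"
  mapM :: "nat \<Rightarrow> nat"
  mapN :: "nat \<Rightarrow> nat"
  natA :: "nat \<Rightarrow> 'ia"
  natM :: "nat \<Rightarrow> 'ea"
  natN :: "nat \<Rightarrow> 'ba"

definition ptree_embeddings ::
    "('i, 'ia, 'e, 'ea, 'b, 'ba) poly_diagram \<Rightarrow> ('i, 'ia, 'e, 'b, 'ba) ptree \<Rightarrow>
     ('i, 'ia, 'e, 'b, 'ba) ptree \<Rightarrow> ('i, 'ia, 'e, 'ea, 'b, 'ba) ptree_map set" where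
  "ptree_embeddings P S T = {h. dm h = S \<and>
     is_tree_embedding S T (mapA h) (mapM h) (mapN h) \<and>
     mapA h \<in> extensional (edges S) \<and> mapM h \<in> extensional (marks S) \<and>
     mapN h \<in> extensional (nodes S) \<and>
     natA h \<in> (\<Pi>\<^sub>E a\<in>edges S. hom (gI P) (colA S a) (colA T (mapA h a))) \<and>
     natM h \<in> (\<Pi>\<^sub>E m\<in>marks S. hom (gE P) (colM S m) (colM T (mapM h m))) \<and>
     natN h \<in> (\<Pi>\<^sub>E n\<in>nodes S. hom (gB P) (colN S n) (colN T (mapN h n))) \<and>
     (\<forall>m\<in>marks S. cmp (gI P) (isoS T (mapM h m)) (on_arr (src_f P) (natM h m)) =
        cmp (gI P) (natA h (ts S m)) (isoS S m)) \<and>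
     (\<forall>m\<in>marks S. cmp (gB P) (isoP T (mapM h m)) (on_arr (mid_f P) (natM h m)) =
        cmp (gB P) (natN h (tp S m)) (isoP S m)) \<and>
     (\<forall>n\<in>nodes S. cmp (gI P) (isoT T (mapN h n)) (on_arr (tgt_f P) (natN h n)) =
        cmp (gI P) (natA h (tt S n)) (isoT S n))}"

definition ptree_isos ::
    "('i, 'ia, 'e, 'ea, 'b, 'ba) poly_diagram \<Rightarrow> ('i, 'ia, 'e, 'b, 'ba) ptree \<Rightarrow>
     ('i, 'ia, 'e, 'b, 'ba) ptree \<Rightarrow> ('i, 'ia, 'e, 'ea, 'b, 'ba) ptree_map set" where
  "ptree_isos P S T = {h \<in> ptree_embeddings P S T.
     bij_betw (mapA h) (edges S) (edges T) \<and> bij_betw (mapM h) (marks S) (marks T) \<and>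
     bij_betw (mapN h) (nodes S) (nodes T)}"

definition ptrees ::
    "('i, 'ia, 'e, 'ea, 'b, 'ba) poly_diagram \<Rightarrow>
     (('i, 'ia, 'e, 'b, 'ba) ptree, ('i, 'ia, 'e, 'ea, 'b, 'ba) ptree_map) groupoid" where
  "ptrees P =
     \<lparr>obs = {T. is_ptree P T},
      hom = ptree_isos P,
      idn = (\<lambda>T. \<lparr>dm = T,
        mapA = restrict id (edges T), mapM = restrict id (marks T), mapN = restrict id (nodes T),
        natA = restrict (\<lambda>a. idn (gI P) (colA T a)) (edges T),
        natM = restrict (\<lambda>m. idn (gE P) (colM T m)) (marks T),
        natN = restrict (\<lambda>n. idn (gB P) (colN T n)) (nodes T)\<rparr>),
      cmp = (\<lambda>h' h. \<lparr>dm = dm h,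
        mapA = compose (edges (dm h)) (mapA h') (mapA h),
        mapM = compose (marks (dm h)) (mapM h') (mapM h),
        mapN = compose (nodes (dm h)) (mapN h') (mapN h),
        natA = restrict (\<lambda>a. cmp (gI P) (natA h' (mapA h a)) (natA h a)) (edges (dm h)),
        natM = restrict (\<lambda>m. cmp (gE P) (natM h' (mapM h m)) (natM h m)) (marks (dm h)),
        natN = restrict (\<lambda>n. cmp (gB P) (natN h' (mapN h n)) (natN h n)) (nodes (dm h))\<rparr>)\<rparr>"

abbreviation ptree_class ::
    "('i, 'ia, 'e, 'ea, 'b, 'ba) poly_diagram \<Rightarrow> ('i, 'ia, 'e, 'b, 'ba) ptree \<Rightarrow>
     ('i, 'ia, 'e, 'b, 'ba) ptree set" where
  "ptree_class P T \<equiv> iso_class (ptrees P) T"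

definition root_functor ::
    "('i, 'ia, 'e, 'ea, 'b, 'ba) poly_diagram \<Rightarrow>
     (('i, 'ia, 'e, 'b, 'ba) ptree, ('i, 'ia, 'e, 'ea, 'b, 'ba) ptree_map, 'i, 'ia) funct" where
  "root_functor P = \<lparr>on_ob = (\<lambda>T. colA T (root T)), on_arr = (\<lambda>h. natA h (root (dm h)))\<rparr>"

definition ptrees_rooted ::
    "('i, 'ia, 'e, 'ea, 'b, 'ba) poly_diagram \<Rightarrow> 'i \<Rightarrow>
     (('i, 'ia, 'e, 'b, 'ba) ptree \<times> 'ia, ('i, 'ia, 'e, 'ea, 'b, 'ba) ptree_map) groupoid" where
  "ptrees_rooted P v = homotopy_fibre (ptrees P) (gI P) (root_functor P) v"

section \<open>Finite families of colours\<close>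

record ('i, 'ia) family_map =
  fam_dm :: "nat set"
  fam_map :: "nat \<Rightarrow> nat"
  fam_nat :: "nat \<Rightarrow> 'ia"

text \<open>The groupoid \<open>\<widetilde>I\<close>; as for trees, indexing sets are finite sets of naturals.\<close>

definition families ::
    "('i, 'ia) groupoid \<Rightarrow> (nat set \<times> (nat \<Rightarrow> 'i), ('i, 'ia) family_map) groupoid" where
  "families I =
     \<lparr>obs = {(X, N). finite X \<and> N \<in> X \<rightarrow> obs I},
      hom = (\<lambda>(X, N) (X', N'). {h. fam_dm h = X \<and> bij_betw (fam_map h) X X' \<and>
        fam_map h \<in> extensional X \<and>
        fam_nat h \<in> (\<Pi>\<^sub>E x\<in>X. hom I (N x) (N' (fam_map h x)))}),
      idn = (\<lambda>(X, N). \<lparr>fam_dm = X, fam_map = restrict id X,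
        fam_nat = restrict (\<lambda>x. idn I (N x)) X\<rparr>),
      cmp = (\<lambda>h' h. \<lparr>fam_dm = fam_dm h,
        fam_map = compose (fam_dm h) (fam_map h') (fam_map h),
        fam_nat = restrict (\<lambda>x. cmp I (fam_nat h' (fam_map h x)) (fam_nat h x)) (fam_dm h)\<rparr>)\<rparr>"

definition multi_indices :: "('i, 'ia) groupoid \<Rightarrow> ('i set \<Rightarrow> nat) set" where
  "multi_indices I = {n. \<forall>c. c \<notin> pi0 I \<longrightarrow> n c = 0}"

definition family_class :: "('i, 'ia) groupoid \<Rightarrow> nat set \<times> (nat \<Rightarrow> 'i) \<Rightarrow> 'i set \<Rightarrow> nat" where
  "family_class I F = (\<lambda>c. card {x \<in> fst F. iso_class I (snd F x) = c})"

definition leaf_functor ::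
    "('i, 'ia, 'e, 'ea, 'b, 'ba) poly_diagram \<Rightarrow>
     (('i, 'ia, 'e, 'b, 'ba) ptree, ('i, 'ia, 'e, 'ea, 'b, 'ba) ptree_map,
      nat set \<times> (nat \<Rightarrow> 'i), ('i, 'ia) family_map) funct" where
  "leaf_functor P =
     \<lparr>on_ob = (\<lambda>T. (leaves T, colA T)),
      on_arr = (\<lambda>h. \<lparr>fam_dm = leaves (dm h), fam_map = restrict (mapA h) (leaves (dm h)),
        fam_nat = restrict (natA h) (leaves (dm h))\<rparr>)\<rparr>"

section \<open>Cuts\<close>

text \<open>A subtree keeps the structure maps and decorations of \<open>T\<close> and shrinks the carriers. Every
  isomorphism class over \<open>T\<close> of root-preserving embeddings into \<open>T\<close> contains exactly one such
  inclusion.\<close>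

definition cuts :: "('i, 'ia, 'e, 'b, 'ba) ptree \<Rightarrow> ('i, 'ia, 'e, 'b, 'ba) ptree set" where
  "cuts T = {S. \<exists>A M N. S = T\<lparr>edges := A, marks := M, nodes := N\<rparr> \<and>
     is_tree S \<and> is_tree_embedding S T id id id \<and> root S = root T}"

definition ideal_subtree ::
    "('i, 'ia, 'e, 'b, 'ba) ptree \<Rightarrow> nat \<Rightarrow> ('i, 'ia, 'e, 'b, 'ba) ptree" where
  "ideal_subtree T l =
     (let A = {x \<in> edges T. \<exists>k. (walk T ^^ k) x = l};
          N = {n \<in> nodes T. tt T n \<in> A};
          M = {m \<in> marks T. tp T m \<in> N}
      in T\<lparr>edges := A, marks := M, nodes := N\<rparr>)"

section \<open>The bialgebra\<close>

text \<open>The monomials of \<open>\<rat>[\<delta>\<^sub>T]\<close> are the finite multisets of isomorphism classes of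
  \<open>P\<close>-trees, so the polynomial algebra is \<open>_ multiset \<Rightarrow>\<^sub>0 rat\<close> with its convolution product, and
  its tensor square is \<open>_ multiset \<times> _ multiset \<Rightarrow>\<^sub>0 rat\<close>.\<close>

definition monomials :: "'t set \<Rightarrow> 't multiset set" where
  "monomials X = {Q. set_mset Q \<subseteq> X}"

definition forest_monomial ::
    "('i, 'ia, 'e, 'ea, 'b, 'ba) poly_diagram \<Rightarrow> nat set \<times> (nat \<Rightarrow> ('i, 'ia, 'e, 'b, 'ba) ptree) \<Rightarrow>
     ('i, 'ia, 'e, 'b, 'ba) ptree set multiset" where
  "forest_monomial P Q = image_mset (\<lambda>l. ptree_class P (snd Q l)) (mset_set (fst Q))"

definition crown ::
    "('i, 'ia, 'e, 'b, 'ba) ptree \<Rightarrow> ('i, 'ia, 'e, 'b, 'ba) ptree \<Rightarrow>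
     nat set \<times> (nat \<Rightarrow> ('i, 'ia, 'e, 'b, 'ba) ptree)" where
  "crown T S = (leaves S, ideal_subtree T)"

definition comult_tree ::
    "('i, 'ia, 'e, 'ea, 'b, 'ba) poly_diagram \<Rightarrow> ('i, 'ia, 'e, 'b, 'ba) ptree \<Rightarrow>
     (('i, 'ia, 'e, 'b, 'ba) ptree set multiset \<times> ('i, 'ia, 'e, 'b, 'ba) ptree set multiset) \<Rightarrow>\<^sub>0 rat" where
  "comult_tree P T =
     (\<Sum>S\<in>cuts T. Poly_Mapping.single (forest_monomial P (crown T S), {#ptree_class P S#}) 1)"

definition comult ::
    "('i, 'ia, 'e, 'ea, 'b, 'ba) poly_diagram \<Rightarrow>
     (('i, 'ia, 'e, 'b, 'ba) ptree set multiset \<Rightarrow>\<^sub>0 rat) \<Rightarrow>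
     (('i, 'ia, 'e, 'b, 'ba) ptree set multiset \<times> ('i, 'ia, 'e, 'b, 'ba) ptree set multiset) \<Rightarrow>\<^sub>0 rat" where
  "comult P f = (\<Sum>Q\<in>Poly_Mapping.keys f.
     Poly_Mapping.single 0 (Poly_Mapping.lookup f Q) * (\<Prod>c\<in>#Q. comult_tree P (rep c)))"

section \<open>Completions\<close>

text \<open>Formal series over a monoid \<open>'m\<close> of monomials in which every element has finitely many
  decompositions. The completions of \<open>\<rat>[\<delta>\<^sub>T]\<close> and of its tensor square are the
  instances at multisets and at pairs of multisets.\<close>

class finite_splitting = comm_monoid_add +
  assumes finite_splits: "finite {(a, b). a + b = m}"

instance multiset :: (type) finite_splitting
proof
  fix m :: "'a multiset"
  have "finite (\<Union>n\<le>size m. multisets_of_size (set_mset m) n)"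
    by auto
  then have fin: "finite {a. a \<subseteq># m}"
    by (rule rev_finite_subset) (auto simp: multisets_of_size_def dest: mset_subset_eqD size_mset_mono)
  have "{(a, b). a + b = m} \<subseteq> {a. a \<subseteq># m} \<times> {b. b \<subseteq># m}"
    by auto
  then show "finite {(a, b). a + b = m}"
    by (rule finite_subset) (intro finite_cartesian_product fin)
qed

instance prod :: (finite_splitting, finite_splitting) finite_splitting
proof
  fix m :: "'a \<times> 'b"
  let ?f = "\<lambda>((a, a'), (b, b')). ((a, b), (a', b'))"
  have "{(a, b). a + b = m} \<subseteq>
      ?f ` ({(a, b). a + b = fst m} \<times> {(a, b). a + b = snd m})"
    by (force simp: image_iff)
  then show "finite {(a, b). a + b = m}"
    by (rule finite_subset) (intro finite_imageI finite_cartesian_product finite_splits)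
qed

typedef 'm series = "UNIV :: ('m \<Rightarrow> rat) set"
  morphisms coeff Series ..

lemma coeff_Series [simp]: "coeff (Series f) = f"
  by (simp add: Series_inverse)

lemma series_eqI: "(\<And>m. coeff f m = coeff g m) \<Longrightarrow> f = g"
  by (metis coeff_inject ext)

instantiation series :: (finite_splitting) comm_ring_1
begin

definition "0 = Series (\<lambda>m. 0)"
definition "1 = Series (\<lambda>m. if m = 0 then 1 else 0)"
definition "f + g = Series (\<lambda>m. coeff f m + coeff g m)" for f g :: "'a series"
definition "f - g = Series (\<lambda>m. coeff f m - coeff g m)" for f g :: "'a series"
definition "- f = Series (\<lambda>m. - coeff f m)" for f :: "'a series"
definition "f * g = Series (\<lambda>m. \<Sum>(a, b) | a + b = m. coeff f a * coeff g b)" for f g :: "'a series"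

instance
proof
  fix f g h :: "'a series"
  show "f * g * h = f * (g * h)"
  proof (rule series_eqI)
    fix m
    let ?T = "\<lambda>(a, b, c). coeff f a * coeff g b * coeff h c"
    have "coeff (f * g * h) m =
        (\<Sum>(x, c) | x + c = m. \<Sum>(a, b) | a + b = x. ?T (a, b, c))"
      by (simp add: times_series_def sum_distrib_right split_beta)
    also have "\<dots> = (\<Sum>((x, c), (a, b)) \<in> Sigma {(x, c). x + c = m} (\<lambda>(x, c). {(a, b). a + b = x}).
        ?T (a, b, c))"
      using finite_splits by (subst sum.Sigma [symmetric]) (auto simp: split_beta)
    also have "\<dots> = (\<Sum>((a, y), (b, c)) \<in> Sigma {(a, y). a + y = m} (\<lambda>(a, y). {(b, c). b + c = y}).
        ?T (a, b, c))"
      by (rule sum.reindex_bij_witness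
          [of _ "\<lambda>((a, y), (b, c)). ((a + b, c), (a, b))" "\<lambda>((x, c), (a, b)). ((a, b + c), (b, c))"])
        (auto simp: add.assoc)
    also have "\<dots> = (\<Sum>(a, y) | a + y = m. \<Sum>(b, c) | b + c = y. ?T (a, b, c))"
      using finite_splits by (subst sum.Sigma [symmetric]) (auto simp: split_beta)
    also have "\<dots> = coeff (f * (g * h)) m"
      by (simp add: times_series_def sum_distrib_left split_beta mult.assoc)
    finally show "coeff (f * g * h) m = coeff (f * (g * h)) m" .
  qed
  show "f * g = g * f"
    by (rule series_eqI, simp add: times_series_def,
        rule sum.reindex_bij_witness [of _ prod.swap prod.swap]) (auto simp: add.commute)
  show "1 * f = f"
  proof (rule series_eqI)
    fix m
    have "coeff (1 * f) m = (\<Sum>(a, b) | a + b = m. (if a = 0 then 1 else 0) * coeff f b)"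
      by (simp add: times_series_def one_series_def)
    also have "\<dots> = (\<Sum>(a, b) \<in> {(0 :: 'a, m)}. (if a = 0 then 1 else 0) * coeff f b)"
      using finite_splits[of m]
      by (intro sum.mono_neutral_right) (auto split: if_splits)
    finally show "coeff (1 * f) m = coeff f m"
      by simp
  qed
  show "(f + g) * h = f * h + g * h"
    by (rule series_eqI)
      (simp add: times_series_def plus_series_def split_beta distrib_right sum.distrib)
  show "(0 :: 'a series) \<noteq> 1"
  proof
    assume "(0 :: 'a series) = 1"
    then have "coeff (0 :: 'a series) 0 = coeff 1 0"
      by (rule arg_cong)
    then show False
      by (simp add: zero_series_def one_series_def)
  qed
qed (rule series_eqI, simp add: zero_series_def plus_series_def minus_series_def uminus_series_def)+

end

definition series_of_poly :: "('m \<Rightarrow>\<^sub>0 rat) \<Rightarrow> 'm series" where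
  "series_of_poly p = Series (Poly_Mapping.lookup p)"

definition series_scale :: "rat \<Rightarrow> 'm series \<Rightarrow> 'm series" where
  "series_scale r f = Series (\<lambda>m. r * coeff f m)"

definition series_tensor :: "'m series \<Rightarrow> 'n series \<Rightarrow> ('m \<times> 'n) series" where
  "series_tensor f g = Series (\<lambda>(a, b). coeff f a * coeff g b)"

text \<open>A family can be summed in the completion iff each monomial occurs in only finitely many
  members; \<open>formal_sum\<close> is meaningful for such families.\<close>

definition formally_summable :: "('k \<Rightarrow> 'm series) \<Rightarrow> 'k set \<Rightarrow> bool" where
  "formally_summable F K \<longleftrightarrow> (\<forall>m. finite {k \<in> K. coeff (F k) m \<noteq> 0})"

definition formal_sum :: "('k \<Rightarrow> 'm series) \<Rightarrow> 'k set \<Rightarrow> 'm series" where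
  "formal_sum F K = Series (\<lambda>m. \<Sum>k | k \<in> K \<and> coeff (F k) m \<noteq> 0. coeff (F k) m)"

definition delta :: "'t \<Rightarrow> 't multiset series" where
  "delta c = series_of_poly (Poly_Mapping.single {#c#} 1)"

text \<open>The comultiplication on the basis monomial \<open>\<delta>\<^sub>Q\<close>, and its extension to the
  completion by continuity.\<close>

definition comult_monomial ::
    "('i, 'ia, 'e, 'ea, 'b, 'ba) poly_diagram \<Rightarrow> ('i, 'ia, 'e, 'b, 'ba) ptree set multiset \<Rightarrow>
     (('i, 'ia, 'e, 'b, 'ba) ptree set multiset \<times> ('i, 'ia, 'e, 'b, 'ba) ptree set multiset) series" where
  "comult_monomial P Q = series_of_poly (comult P (Poly_Mapping.single Q 1))"

definition comult_series ::
    "('i, 'ia, 'e, 'ea, 'b, 'ba) poly_diagram \<Rightarrow> ('i, 'ia, 'e, 'b, 'ba) ptree set multiset series \<Rightarrow>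
     (('i, 'ia, 'e, 'b, 'ba) ptree set multiset \<times> ('i, 'ia, 'e, 'b, 'ba) ptree set multiset) series" where
  "comult_series P f =
     formal_sum (\<lambda>Q. series_scale (coeff f Q) (comult_monomial P Q)) (monomials (pi0 (ptrees P)))"

section \<open>Green functions\<close>

definition green ::
    "('i, 'ia, 'e, 'ea, 'b, 'ba) poly_diagram \<Rightarrow> ('i, 'ia, 'e, 'b, 'ba) ptree set multiset series" where
  "green P = formal_sum
     (\<lambda>c. series_scale (1 / of_nat (card (aut (ptrees P) (rep c)))) (delta c))
     (pi0 (ptrees P))"

text \<open>Non-isomorphic objects of \<open>T\<^sub>v\<close> may have isomorphic underlying \<open>P\<close>-trees; since
  \<open>Aut v\<close> is finite this happens finitely often for each \<open>P\<close>-tree, so the sum makes sense.\<close>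

definition green_rooted ::
    "('i, 'ia, 'e, 'ea, 'b, 'ba) poly_diagram \<Rightarrow> 'i \<Rightarrow> ('i, 'ia, 'e, 'b, 'ba) ptree set multiset series" where
  "green_rooted P v = formal_sum
     (\<lambda>c. series_scale (1 / of_nat (card (aut (ptrees_rooted P v) (rep c))))
            (delta (ptree_class P (fst (rep c)))))
     (pi0 (ptrees_rooted P v))"

definition green_power ::
    "('i, 'ia, 'e, 'ea, 'b, 'ba) poly_diagram \<Rightarrow> ('i set \<Rightarrow> nat) \<Rightarrow>
     ('i, 'ia, 'e, 'b, 'ba) ptree set multiset series" where
  "green_power P n = (\<Prod>v\<in>pi0 (gI P). green_rooted P (rep v) ^ n v)"

definition green_leaves ::
    "('i, 'ia, 'e, 'ea, 'b, 'ba) poly_diagram \<Rightarrow> ('i set \<Rightarrow> nat) \<Rightarrow>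
     ('i, 'ia, 'e, 'b, 'ba) ptree set multiset series" where
  "green_leaves P n =
     (let N = (SOME N. N \<in> obs (families (gI P)) \<and> family_class (gI P) N = n)
      in formal_sum
        (\<lambda>c. series_scale (1 / of_nat (card (aut (ptrees P) (rep c)))) (delta c))
        {c \<in> pi0 (ptrees P). hom (families (gI P)) (on_ob (leaf_functor P) (rep c)) N \<noteq> {}})"

end

(* Double counting of trees with a chosen cut. Fix a tree S and, for every leaf l of S, a tree D l.
   A grafting on T consists of a cut of T, an isomorphism of S with that cut, and isomorphisms of the
   D l with the ideal subtrees over the corresponding leaves. Comparing root colours, a grafting
   determines a family of isomorphisms phi l from the root colour of D l to the colour of l, and T is
   recovered from (S, D, phi) by gluing, uniquely up to a unique isomorphism. Hence the graftings on T
   inducing a given phi form either the empty set or a torsor under Aut(T), and the sum over all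
   isomorphism classes of T of (number of graftings)/|Aut(T)| is the number of all phi, that is the
   product of the |hom(R(D l), colour of l)|. This matches the coefficients of the two sides, because
   G_v is the sum of |hom(R(T), v)|/|Aut(T)| delta_T, by orbit counting in the homotopy fibre. *)

theory Submission
  imports Defs "HOL-Library.Nat_Bijection"
begin

section \<open>Groupoids\<close>

text \<open>The coefficient at \<open>(a, {#s#})\<close> is treated with S the representative of s
  and with D ranging over all labellings of the leaves of S by isomorphism classes whose multiset is
  a. Labellings of leaves, rather than forests, serve both sides: the product of the G_v is expanded
  leaf by leaf, and the symmetries of a crown never have to be divided out. For a fixed cut and a
  fixed isomorphism of S with it, exactly one labelling fits; this cancels the product of the |Aut(D
  l)|, and the isomorphisms themselves account for |Aut(S)|. The obstacle is that colours form a
  groupoid: the root colour of D l is merely isomorphic to the colour of l, so gluing requires the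
  choice of \<open>\<phi>\<close>. The torsor property rests on the shape of the pieces: the cut and
  the ideal subtrees cover T, share no nodes or marks, and share no edges but the leaves of the cut.
  Maps defined piecewise from the same \<open>\<phi>\<close> agree there. The set of all
  \<open>\<phi>\<close> is finite because trivial trees have finitely many automorphisms; this
  bounds the classes of T that occur and makes the comultiplication extend to series.\<close>

lemma groupoid_idn: "is_groupoid G \<Longrightarrow> x \<in> obs G \<Longrightarrow> idn G x \<in> hom G x x"
  by (simp add: is_groupoid_def)

lemma groupoid_cmp:
  "is_groupoid G \<Longrightarrow> x \<in> obs G \<Longrightarrow> y \<in> obs G \<Longrightarrow> z \<in> obs G \<Longrightarrow>
    f \<in> hom G x y \<Longrightarrow> g \<in> hom G y z \<Longrightarrow> cmp G g f \<in> hom G x z"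
  unfolding is_groupoid_def by blast

lemma groupoid_idr:
  "is_groupoid G \<Longrightarrow> x \<in> obs G \<Longrightarrow> y \<in> obs G \<Longrightarrow> f \<in> hom G x y \<Longrightarrow> cmp G f (idn G x) = f"
  unfolding is_groupoid_def by blast

lemma groupoid_idl:
  "is_groupoid G \<Longrightarrow> x \<in> obs G \<Longrightarrow> y \<in> obs G \<Longrightarrow> f \<in> hom G x y \<Longrightarrow> cmp G (idn G y) f = f"
  unfolding is_groupoid_def by blast

lemma groupoid_assoc:
  "is_groupoid G \<Longrightarrow> w \<in> obs G \<Longrightarrow> x \<in> obs G \<Longrightarrow> y \<in> obs G \<Longrightarrow> z \<in> obs G \<Longrightarrow>
    f \<in> hom G w x \<Longrightarrow> g \<in> hom G x y \<Longrightarrow> h \<in> hom G y z \<Longrightarrow>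
    cmp G h (cmp G g f) = cmp G (cmp G h g) f"
  unfolding is_groupoid_def by blast

text \<open>Both endpoints are arguments because hom-sets of different pairs of objects may overlap,
  so that an arrow alone does not determine its inverse.\<close>

definition ginv :: "('o, 'a) groupoid \<Rightarrow> 'o \<Rightarrow> 'o \<Rightarrow> 'a \<Rightarrow> 'a" where
  "ginv G x y f = (SOME g. g \<in> hom G y x \<and> cmp G g f = idn G x \<and> cmp G f g = idn G y)"

lemma ginv:
  assumes "is_groupoid G" "x \<in> obs G" "y \<in> obs G" "f \<in> hom G x y"
  shows "ginv G x y f \<in> hom G y x" "cmp G (ginv G x y f) f = idn G x"
    "cmp G f (ginv G x y f) = idn G y"
proof -
  have "\<exists>g. g \<in> hom G y x \<and> cmp G g f = idn G x \<and> cmp G f g = idn G y"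
    using assms unfolding is_groupoid_def by blast
  from someI_ex[OF this] show "ginv G x y f \<in> hom G y x" "cmp G (ginv G x y f) f = idn G x"
    "cmp G f (ginv G x y f) = idn G y"
    unfolding ginv_def by auto
qed

lemma groupoid_cmp_ginv_cmp:
  assumes "is_groupoid G" "x \<in> obs G" "y \<in> obs G" "w \<in> obs G" "f \<in> hom G x y"
  shows "g \<in> hom G w x \<Longrightarrow> cmp G (ginv G x y f) (cmp G f g) = g"
    and "k \<in> hom G w y \<Longrightarrow> cmp G f (cmp G (ginv G x y f) k) = k"
    and "l \<in> hom G y w \<Longrightarrow> cmp G (cmp G l f) (ginv G x y f) = l"
    and "j \<in> hom G x w \<Longrightarrow> cmp G (cmp G j (ginv G x y f)) f = j"
proof -
  note [simp] = ginv[OF assms(1,2,3,5)]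
  show "g \<in> hom G w x \<Longrightarrow> cmp G (ginv G x y f) (cmp G f g) = g"
    using assms by (subst groupoid_assoc[where w = w and x = x and y = y and z = x]) (auto simp: groupoid_idl[of G w x])
  show "k \<in> hom G w y \<Longrightarrow> cmp G f (cmp G (ginv G x y f) k) = k"
    using assms by (subst groupoid_assoc[where w = w and x = y and y = x and z = y]) (auto simp: groupoid_idl[of G w y])
  show "l \<in> hom G y w \<Longrightarrow> cmp G (cmp G l f) (ginv G x y f) = l"
    using assms by (subst groupoid_assoc[symmetric, where w = y and x = x and y = y and z = w]) (auto simp: groupoid_idr[of G y w])
  show "j \<in> hom G x w \<Longrightarrow> cmp G (cmp G j (ginv G x y f)) f = j"
    using assms by (subst groupoid_assoc[symmetric, where w = x and x = y and y = x and z = w]) (auto simp: groupoid_idr[of G x w])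
qed

lemma groupoid_bij_post:
  assumes "is_groupoid G" "x \<in> obs G" "y \<in> obs G" "z \<in> obs G" "w \<in> hom G y z"
  shows "bij_betw (cmp G w) (hom G x y) (hom G x z)"
  by (rule bij_betw_byWitness[where f' = "cmp G (ginv G y z w)"])
    (use assms ginv[OF assms(1,3,4,5)] in
      \<open>auto simp: groupoid_cmp_ginv_cmp[OF assms(1,3,4,2,5)] intro: groupoid_cmp\<close>)

lemma groupoid_bij_pre:
  assumes "is_groupoid G" "x \<in> obs G" "y \<in> obs G" "z \<in> obs G" "u \<in> hom G x y"
  shows "bij_betw (\<lambda>f. cmp G f u) (hom G y z) (hom G x z)"
  by (rule bij_betw_byWitness[where f' = "\<lambda>f. cmp G f (ginv G x y u)"])
    (use assms ginv[OF assms(1,2,3,5)] in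
      \<open>auto simp: groupoid_cmp_ginv_cmp[OF assms(1,2,3,4,5)] intro: groupoid_cmp\<close>)

lemma iso_class_self: "is_groupoid G \<Longrightarrow> x \<in> obs G \<Longrightarrow> x \<in> iso_class G x"
  using groupoid_idn by (fastforce simp: iso_class_def)

lemma iso_class_eq_iff:
  assumes "is_groupoid G" "x \<in> obs G" "y \<in> obs G"
  shows "iso_class G x = iso_class G y \<longleftrightarrow> hom G x y \<noteq> {}"
proof
  assume "iso_class G x = iso_class G y"
  then show "hom G x y \<noteq> {}"
    using iso_class_self[OF assms(1,3)] by (auto simp: iso_class_def)
next
  assume "hom G x y \<noteq> {}"
  then obtain f where f: "f \<in> hom G x y" by blast
  show "iso_class G x = iso_class G y"
    using groupoid_bij_pre[OF assms _ f]
    by (auto simp: iso_class_def bij_betw_def)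
qed

lemma iso_class_in_pi0: "x \<in> obs G \<Longrightarrow> iso_class G x \<in> pi0 G"
  by (simp add: pi0_def)

lemma rep_pi0:
  assumes "is_groupoid G" "c \<in> pi0 G"
  shows "rep c \<in> obs G" "iso_class G (rep c) = c"
proof -
  obtain x where x: "x \<in> obs G" "c = iso_class G x"
    using assms by (auto simp: pi0_def)
  then have "x \<in> c" using iso_class_self[OF assms(1)] by auto
  then have "rep c \<in> c" unfolding rep_def by (rule someI)
  then have *: "rep c \<in> obs G" "hom G x (rep c) \<noteq> {}" using x by (auto simp: iso_class_def)
  then show "rep c \<in> obs G" "iso_class G (rep c) = c"
    using iso_class_eq_iff[OF assms(1) x(1)] x by auto
qed

text \<open>A nonempty hom-set is a torsor under the automorphisms of its source.\<close>

lemma card_hom_eq_card_aut: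
  assumes "is_groupoid G" "x \<in> obs G" "y \<in> obs G" "hom G x y \<noteq> {}"
  shows "card (hom G x y) = card (aut G x)"
  using assms groupoid_bij_post[OF assms(1,2,2,3)] unfolding aut_def
  by (metis bij_betw_same_card ex_in_conv)

lemma finite_hom:
  assumes "is_groupoid G" "x \<in> obs G" "y \<in> obs G" "finite (aut G x)"
  shows "finite (hom G x y)"
  using assms groupoid_bij_post[OF assms(1,2,2,3)] unfolding aut_def
  by (metis bij_betw_finite ex_in_conv finite.emptyI)

lemma card_aut_pos:
  assumes "is_groupoid G" "x \<in> obs G" "finite (aut G x)"
  shows "card (aut G x) > 0"
  using assms groupoid_idn unfolding aut_def by (metis card_gt_0_iff empty_iff)

section \<open>Trees\<close>

text \<open>The edges from which iterating \<open>walk\<close> leads to \<open>l\<close>. The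
  function \<open>walk\<close> refers to the root and to an inverse of \<open>ts T\<close> on all of
  \<open>marks T\<close>, both of which depend on the carriers as a whole. A derivation of
  membership here mentions single marks only, so it can be replayed in a subtree or transported
  along a map, and it gives induction along the path that starts at \<open>l\<close>.\<close>

inductive_set above :: "'z tree_scheme \<Rightarrow> nat \<Rightarrow> nat set" for T l where
  base: "l \<in> above T l"
| step: "m \<in> marks T \<Longrightarrow> tt T (tp T m) \<in> above T l \<Longrightarrow> ts T m \<in> above T l"

text \<open>Everything in \<open>is_tree\<close> except that all edges reach the root; that
  condition is handled separately through \<open>above\<close>.\<close>

definition pretree :: "'z tree_scheme \<Rightarrow> bool" where
  "pretree T \<longleftrightarrow> finite (edges T) \<and> finite (marks T) \<and> finite (nodes T) \<and>
     ts T \<in> marks T \<rightarrow> edges T \<and> tp T \<in> marks T \<rightarrow> nodes T \<and> tt T \<in> nodes T \<rightarrow> edges T \<and>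
     inj_on (tt T) (nodes T) \<and> inj_on (ts T) (marks T) \<and>
     edges T - ts T ` marks T = {root T}"

lemma pretreeI:
  assumes "finite (edges T)" "finite (marks T)" "finite (nodes T)"
     "ts T \<in> marks T \<rightarrow> edges T" "tp T \<in> marks T \<rightarrow> nodes T" "tt T \<in> nodes T \<rightarrow> edges T"
     "inj_on (tt T) (nodes T)" "inj_on (ts T) (marks T)"
     "edges T - ts T ` marks T = {r}"
  shows "pretree T" "root T = r"
proof -
  show "root T = r" using assms(9) by (simp add: root_def)
  with assms show "pretree T" by (auto simp: pretree_def)
qed

lemma walk_ts:
  assumes "pretree T" "m \<in> marks T"
  shows "walk T (ts T m) = tt T (tp T m)"
proof -
  have "ts T m \<noteq> root T" using assms unfolding pretree_def by blast
  then show ?thesis using assms by (simp add: walk_def pretree_def)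
qed

lemma walk_edge:
  assumes "pretree T" "x \<in> edges T"
  shows "walk T x \<in> edges T"
proof (cases "x = root T")
  case True then show ?thesis using assms by (simp add: walk_def)
next
  case False
  then obtain m where "m \<in> marks T" "x = ts T m" using assms unfolding pretree_def by blast
  then show ?thesis using assms walk_ts[OF assms(1)] by (auto simp: pretree_def Pi_iff)
qed

lemma above_iff_walk:
  assumes "pretree T" "l \<in> edges T"
  shows "x \<in> above T l \<longleftrightarrow> x \<in> edges T \<and> (\<exists>k. (walk T ^^ k) x = l)"
proof
  assume "x \<in> above T l"
  then show "x \<in> edges T \<and> (\<exists>k. (walk T ^^ k) x = l)"
  proof induction
    case base then show ?case using assms by (auto intro: exI[of _ 0])
  next
    case (step m)
    then obtain k where "(walk T ^^ k) (tt T (tp T m)) = l" by blast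
    then have "(walk T ^^ Suc k) (ts T m) = l"
      by (simp add: funpow_swap1 walk_ts[OF assms(1) step(1)])
    moreover have "ts T m \<in> edges T" using step(1) assms by (auto simp: pretree_def)
    ultimately show ?case by blast
  qed
next
  assume "x \<in> edges T \<and> (\<exists>k. (walk T ^^ k) x = l)"
  then obtain k where "x \<in> edges T" "(walk T ^^ k) x = l" by blast
  then show "x \<in> above T l"
  proof (induction k arbitrary: x)
    case 0 then show ?case by (simp add: above.base)
  next
    case (Suc k)
    then have w: "walk T x \<in> above T l" using walk_edge[OF assms(1)] by (simp add: funpow_swap1)
    show ?case
    proof (cases "x = root T")
      \<comment> \<open>\<open>walk\<close> is stationary at the root, so the fact about
        \<open>walk T x\<close> is already the one about \<open>x\<close>.\<close>
      case True then show ?thesis using w by (simp add: walk_def)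
    next
      case False
      then obtain m where "m \<in> marks T" "x = ts T m" using assms Suc(2) unfolding pretree_def by blast
      then show ?thesis using w above.step walk_ts[OF assms(1)] by metis
    qed
  qed
qed

lemma is_tree_iff: "is_tree T \<longleftrightarrow> pretree T \<and> edges T \<subseteq> above T (root T)"
proof
  assume t: "is_tree T"
  then have p: "pretree T" unfolding is_tree_def using pretreeI(1) by blast
  then have "root T \<in> edges T" unfolding pretree_def by blast
  then show "pretree T \<and> edges T \<subseteq> above T (root T)"
    using t p above_iff_walk[OF p] by (auto simp: is_tree_def)
next
  assume t: "pretree T \<and> edges T \<subseteq> above T (root T)"
  then have "root T \<in> edges T" unfolding pretree_def by blast
  then show "is_tree T" using t above_iff_walk[of T] by (fastforce simp: pretree_def is_tree_def)
qed

lemma above_trans: "x \<in> above T y \<Longrightarrow> y \<in> above T z \<Longrightarrow> x \<in> above T z"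
  by (induction rule: above.induct) (auto intro: above.step)

lemma pretreeD:
  assumes "pretree T"
  shows "finite (edges T)" "finite (marks T)" "finite (nodes T)"
     "m \<in> marks T \<Longrightarrow> ts T m \<in> edges T" "m \<in> marks T \<Longrightarrow> tp T m \<in> nodes T"
     "n \<in> nodes T \<Longrightarrow> tt T n \<in> edges T"
     "inj_on (tt T) (nodes T)" "inj_on (ts T) (marks T)" "root T \<in> edges T"
     "m \<in> marks T \<Longrightarrow> ts T m \<noteq> root T"
     "x \<in> edges T \<Longrightarrow> x \<noteq> root T \<Longrightarrow> \<exists>m\<in>marks T. x = ts T m"
  using assms unfolding pretree_def by (auto simp: Pi_iff)

lemma is_treeD: "is_tree T \<Longrightarrow> pretree T" "is_tree T \<Longrightarrow> x \<in> edges T \<Longrightarrow> x \<in> above T (root T)"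
  by (auto simp: is_tree_iff)

lemma above_edges: "pretree T \<Longrightarrow> l \<in> edges T \<Longrightarrow> above T l \<subseteq> edges T"
  using above_iff_walk by blast

lemma ideal_subtree_eq:
  assumes "is_tree T" "l \<in> edges T"
  shows "ideal_subtree T l = T\<lparr>edges := above T l,
    marks := {m \<in> marks T. tt T (tp T m) \<in> above T l}, nodes := {n \<in> nodes T. tt T n \<in> above T l}\<rparr>"
proof -
  have "{x \<in> edges T. \<exists>k. (walk T ^^ k) x = l} = above T l"
    using above_iff_walk[OF is_treeD(1)[OF assms(1)] assms(2)] by blast
  moreover have "{m \<in> marks T. tp T m \<in> {n \<in> nodes T. tt T n \<in> above T l}} =
      {m \<in> marks T. tt T (tp T m) \<in> above T l}"
    using pretreeD(5)[OF is_treeD(1)[OF assms(1)]] by blast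
  ultimately show ?thesis by (simp add: ideal_subtree_def Let_def)
qed

text \<open>A tree has no cycles; this is what makes \<open>l\<close> the root of its ideal subtree.
  If the output edge of a node lay above one of the node's input edges, it would itself be an input
  edge of some node, and the output edge of that node would lie above it. The induction along the
  path from the root excludes this one level earlier.\<close>

lemma not_above_self:
  assumes "is_tree T" "m \<in> marks T"
  shows "tt T (tp T m) \<notin> above T (ts T m)"
proof -
  note p = is_treeD(1)[OF assms(1)]
  have "x \<in> above T (root T) \<Longrightarrow> \<forall>m\<in>marks T. x = ts T m \<longrightarrow> tt T (tp T m) \<notin> above T (ts T m)" for x
  proof (induction rule: above.induct)
    case base then show ?case using pretreeD(10)[OF p] by metis
  next
    case (step m)
    have "tt T (tp T m) \<notin> above T (ts T m)"
    proof
      assume a: "tt T (tp T m) \<in> above T (ts T m)"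
      have b: "ts T m \<in> above T (tt T (tp T m))"
        by (intro above.step step above.base)
      from a show False
      proof cases
        case base then show False using step by (metis above.base)
      next
        case (step m')
        with b have "tt T (tp T m') \<in> above T (tt T (tp T m))" by (metis above_trans)
        with step \<open>\<forall>_\<in>_. _\<close> show False by metis
      qed
    qed
    with step(1) pretreeD(8)[OF p] show ?case by (metis inj_onD)
  qed
  then show ?thesis using assms pretreeD(4)[OF p] is_treeD(2)[OF assms(1)] by blast
qed

lemma ideal_subtree_tree:
  assumes "is_tree T" "l \<in> edges T"
  shows "is_tree (ideal_subtree T l)" "root (ideal_subtree T l) = l"
proof -
  note p = is_treeD(1)[OF assms(1)]
  let ?S = "ideal_subtree T l"
  note e = ideal_subtree_eq[OF assms]
  have f: "above T l \<subseteq> edges T" by (rule above_edges[OF p assms(2)])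
  have 1: "edges ?S - ts ?S ` marks ?S = {l}"
  proof -
    have "l \<notin> ts ?S ` marks ?S" using not_above_self[OF assms(1)] by (auto simp: e)
    moreover have "x \<in> ts ?S ` marks ?S" if "x \<in> above T l" "x \<noteq> l" for x
      using that by (cases rule: above.cases) (auto simp: e)
    ultimately show ?thesis by (auto simp: e above.base)
  qed
  have 2: "pretree ?S \<and> root ?S = l"
    using pretreeI[OF _ _ _ _ _ _ _ _ 1] pretreeD[OF p] finite_subset[OF f]
    by (force simp: e intro: above.step inj_on_subset)
  then show "root ?S = l" by simp
  \<comment> \<open>The marks in a derivation over \<open>T\<close> all have the output edge of
    their node above \<open>l\<close>, hence belong to the subtree, where the derivation can be
    repeated.\<close>
  have "x \<in> above T l \<Longrightarrow> x \<in> above ?S l" for x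
    by (induction rule: above.induct)
      (auto simp: e intro: above.base above.step[of _ ?S, unfolded e, simplified])
  then show "is_tree ?S" using 2 by (auto simp: is_tree_iff e)
qed

text \<open>The pullback condition on an inclusion means that a node of the cut brings all its input
  marks along, so \<open>marks S\<close> is determined by \<open>nodes S\<close>.\<close>

lemma cutsD:
  assumes "is_tree T" "S \<in> cuts T"
  shows "is_tree S" "root S = root T" "edges S \<subseteq> edges T" "nodes S \<subseteq> nodes T"
    "marks S = {m \<in> marks T. tp T m \<in> nodes S}"
    "S = T\<lparr>edges := edges S, marks := marks S, nodes := nodes S\<rparr>"
    "ts S = ts T" "tp S = tp T" "tt S = tt T"
proof -
  obtain A M N where S: "S = T\<lparr>edges := A, marks := M, nodes := N\<rparr>"
    and t: "is_tree S" and e: "is_tree_embedding S T id id id" and r: "root S = root T"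
    using assms(2) by (auto simp: cuts_def)
  show "is_tree S" "root S = root T" using t r by auto
  show "edges S \<subseteq> edges T" "nodes S \<subseteq> nodes T" using e by (auto simp: is_tree_embedding_def)
  have "marks S \<subseteq> marks T" using e by (auto simp: is_tree_embedding_def)
  then show "marks S = {m \<in> marks T. tp T m \<in> nodes S}"
    using e pretreeD(5)[OF is_treeD(1)[OF t]]
    by (auto simp: is_tree_embedding_def S)
  show "S = T\<lparr>edges := edges S, marks := marks S, nodes := nodes S\<rparr>"
    "ts S = ts T" "tp S = tp T" "tt S = tt T" by (simp_all add: S)
qed

lemma cutsI:
  assumes "S = T\<lparr>edges := A, marks := M, nodes := N\<rparr>" "is_tree S" "root S = root T"
    "A \<subseteq> edges T" "N \<subseteq> nodes T" "M = {m \<in> marks T. tp T m \<in> N}"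
  shows "S \<in> cuts T"
  using assms by (auto simp: cuts_def is_tree_embedding_def)

lemma finite_cuts:
  assumes "is_tree T"
  shows "finite (cuts T)"
proof -
  note p = pretreeD[OF is_treeD(1)[OF assms]]
  have "cuts T \<subseteq> (\<lambda>(A, M, N). T\<lparr>edges := A, marks := M, nodes := N\<rparr>) `
      (Pow (edges T) \<times> Pow (marks T) \<times> Pow (nodes T))"
    using cutsD(3-6)[OF assms] by (fastforce simp: image_iff)
  then show ?thesis by (rule finite_subset) (intro finite_imageI finite_cartesian_product, auto simp: p)
qed

section \<open>Decomposition of a tree along a cut\<close>

locale tree_cut =
  fixes T S :: "('i, 'ia, 'e, 'b, 'ba) ptree"
  assumes T: "is_tree T" and S: "S \<in> cuts T"
begin

lemmas c = cutsD[OF T S]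
lemmas p = pretreeD[OF is_treeD(1)[OF T]]
lemmas q = pretreeD[OF is_treeD(1)[OF c(1)], unfolded c(7-9)]

lemma leaf_edge: "l \<in> leaves S \<Longrightarrow> l \<in> edges T"
  using c(3) by (auto simp: leaves_def)

text \<open>Induction along the path from the root. When the output edge of the node below is in
  \<open>S\<close> and is no leaf of \<open>S\<close>, injectivity of \<open>tt T\<close> puts that
  node into \<open>S\<close>, and with it all its input edges.\<close>

lemma edge_cover:
  assumes "x \<in> edges T" shows "x \<in> edges S \<or> (\<exists>l\<in>leaves S. x \<in> above T l)"
proof -
  have "x \<in> above T (root T)" using assms T is_treeD by blast
  then show ?thesis
  proof induction
    case base then show ?case using q(9) c(2) by simp
  next
    case (step m)
    show ?case
    proof (cases "\<exists>l\<in>leaves S. tt T (tp T m) \<in> above T l")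
      case True then show ?thesis using step(1) above.step by blast
    next
      case False
      then have e: "tt T (tp T m) \<in> edges S" using step by blast
      have "tt T (tp T m) \<notin> leaves S" using False above.base by blast
      with e obtain n where "n \<in> nodes S" "tt T (tp T m) = tt T n"
        using c(9) by (auto simp: leaves_def)
      then have "tp T m \<in> nodes S" using p(7) p(5)[OF step(1)] c(4) by (metis inj_onD subsetD)
      then show ?thesis using c(5) step(1) q(4) by auto
    qed
  qed
qed

text \<open>An edge of \<open>S\<close> other than the root is the input of a node of
  \<open>S\<close>, so the path down from it stays in \<open>S\<close>. By induction the output edge
  of that node would be \<open>l\<close>, but a leaf of \<open>S\<close> is no output edge of a node
  of \<open>S\<close>.\<close>

lemma edge_above_leaf:
  assumes "x \<in> above T l" "l \<in> leaves S" "x \<in> edges S" shows "x = l"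
  using assms(1,3)
proof induction
  case base then show ?case by simp
next
  case (step m)
  have "ts T m \<noteq> root S" using p(10)[OF step(1)] c(2) by simp
  then obtain m' where "m' \<in> marks S" "ts T m = ts T m'" using q(11) step by blast
  then have "m \<in> marks S" using p(8) step(1) c(5) by (metis (no_types, lifting) inj_onD mem_Collect_eq)
  then have "tp T m \<in> nodes S" "tt T (tp T m) \<in> edges S" using q(5,6) by auto
  with step have "tt T (tp T m) = l" by blast
  then show ?case using assms(2) \<open>tp T m \<in> nodes S\<close> c(9) by (auto simp: leaves_def)
qed

text \<open>The paths from \<open>x\<close> down to \<open>l\<close> and to \<open>l'\<close> take
  the same steps because \<open>ts T\<close> is injective; when one of them stops, it stops at an
  edge of \<open>S\<close>, and \<open>edge_above_leaf\<close> applies.\<close>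

lemma above_leaf_unique:
  assumes "x \<in> above T l" "x \<in> above T l'" "l \<in> leaves S" "l' \<in> leaves S" shows "l = l'"
  using assms(1,2)
proof induction
  case base then show ?case using edge_above_leaf[OF base assms(4)] assms(3) by (auto simp: leaves_def)
next
  case (step m)
  from \<open>ts T m \<in> above T l'\<close> show ?case
  proof cases
    case base
    then show ?thesis using edge_above_leaf[of "ts T m" l] assms(3,4) above.step[OF step(1,2)]
      by (auto simp: leaves_def)
  next
    case (step m')
    then show ?thesis using \<open>m \<in> marks T\<close> \<open>_ \<Longrightarrow> _ = _\<close> p(8) by (metis inj_onD)
  qed
qed

text \<open>Reduction to the output edge: by injectivity of \<open>tt T\<close>, a node outside
  \<open>S\<close> whose output edge is in \<open>S\<close> sits on a leaf of
  \<open>S\<close>.\<close>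

lemma node_cover:
  assumes "n \<in> nodes T" shows "n \<in> nodes S \<or> (\<exists>l\<in>leaves S. tt T n \<in> above T l)"
proof (cases "n \<in> nodes S")
  case False
  then have "tt T n \<notin> tt T ` nodes S" using inj_on_image_mem_iff[OF p(7) assms c(4)] by simp
  then have "tt T n \<in> edges S \<Longrightarrow> tt T n \<in> leaves S" using c(9) by (auto simp: leaves_def)
  then show ?thesis using edge_cover[OF p(6)[OF assms]] above.base by blast
qed auto

lemma node_above_leaf: "n \<in> nodes S \<Longrightarrow> l \<in> leaves S \<Longrightarrow> tt T n \<notin> above T l"
  using edge_above_leaf q(6) c(9) by (fastforce simp: leaves_def)

end

section \<open>Isomorphisms of undecorated trees\<close>

abbreviation restr :: "'z tree_scheme \<Rightarrow> nat set \<Rightarrow> nat set \<Rightarrow> nat set \<Rightarrow> 'z tree_scheme" where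
  "restr T A M N \<equiv> T\<lparr>edges := A, marks := M, nodes := N\<rparr>"

text \<open>The pullback condition of \<open>is_tree_embedding\<close> is absent because it follows
  from bijectivity; \<open>ptree_isos_iff\<close> restores it. The two sides may carry different
  decorations.\<close>

definition tree_iso ::
    "'z tree_scheme \<Rightarrow> 'y tree_scheme \<Rightarrow> (nat \<Rightarrow> nat) \<Rightarrow> (nat \<Rightarrow> nat) \<Rightarrow> (nat \<Rightarrow> nat) \<Rightarrow> bool" where
  "tree_iso S T f g k \<longleftrightarrow> bij_betw f (edges S) (edges T) \<and> bij_betw g (marks S) (marks T) \<and>
     bij_betw k (nodes S) (nodes T) \<and>
     (\<forall>m\<in>marks S. f (ts S m) = ts T (g m) \<and> k (tp S m) = tp T (g m)) \<and>
     (\<forall>n\<in>nodes S. f (tt S n) = tt T (k n))"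

text \<open>The target is typically given by images of carriers inside another tree. That it is a
  tree again, with the expected root and leaves, is a result of this locale.\<close>

locale tree_isomorphism =
  fixes S :: "'z tree_scheme" and T :: "'y tree_scheme" and f g k
  assumes S: "is_tree S" and iso: "tree_iso S T f g k"
begin

lemmas p = pretreeD[OF is_treeD(1)[OF S]]

lemma bij: "bij_betw f (edges S) (edges T)" "bij_betw g (marks S) (marks T)" "bij_betw k (nodes S) (nodes T)"
  using iso by (auto simp: tree_iso_def)

lemma img: "f ` edges S = edges T" "g ` marks S = marks T" "k ` nodes S = nodes T"
  using bij by (auto simp: bij_betw_def)

lemma inj: "inj_on f (edges S)" "inj_on g (marks S)" "inj_on k (nodes S)"
  using bij by (auto simp: bij_betw_def)

lemma comm: "m \<in> marks S \<Longrightarrow> ts T (g m) = f (ts S m)" "m \<in> marks S \<Longrightarrow> tp T (g m) = k (tp S m)"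
   "n \<in> nodes S \<Longrightarrow> tt T (k n) = f (tt S n)"
  using iso by (auto simp: tree_iso_def)

lemma pretree: "pretree T" and root: "root T = f (root S)"
proof -
  have 1: "edges T - ts T ` marks T = {f (root S)}"
  proof -
    have "ts T ` marks T = f ` (ts S ` marks S)"
      unfolding img(2)[symmetric] image_image using comm(1) by (intro image_cong) auto
    then have "edges T - ts T ` marks T = f ` (edges S - ts S ` marks S)"
      unfolding img(1)[symmetric] using p(4) by (subst inj_on_image_set_diff[OF inj(1)]) auto
    then show ?thesis using is_treeD(1)[OF S] by (simp add: pretree_def)
  qed
  have "inj_on (f \<circ> tt S) (nodes S)" "inj_on (f \<circ> ts S) (marks S)"
    using p(4,6) by (auto intro!: comp_inj_on p(7,8) inj_on_subset[OF inj(1)])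
  then have "inj_on (tt T \<circ> k) (nodes S)" "inj_on (ts T \<circ> g) (marks S)"
    using comm(1,3) by (simp_all cong: inj_on_cong)
  then have "inj_on (tt T) (k ` nodes S)" "inj_on (ts T) (g ` marks S)"
    by (auto intro: inj_on_imageI)
  then have i: "inj_on (tt T) (nodes T)" "inj_on (ts T) (marks T)" by (simp_all only: img)
  have "finite (edges T)" "finite (marks T)" "finite (nodes T)"
    using p(1-3) bij bij_betw_finite by blast+
  moreover have "ts T \<in> marks T \<rightarrow> edges T" "tp T \<in> marks T \<rightarrow> nodes T"
    using comm(1,2) p(4,5) by (auto simp flip: img)
  moreover have "tt T \<in> nodes T \<rightarrow> edges T"
    using comm(3) p(6) by (auto simp flip: img)
  ultimately show "pretree T" "root T = f (root S)"
    using pretreeI[OF _ _ _ _ _ _ i 1] by blast+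
qed

lemma above:
  assumes "l \<in> edges S" shows "above T (f l) = f ` above S l"
proof
  note sub = above_edges[OF is_treeD(1)[OF S] assms]
  show "f ` above S l \<subseteq> above T (f l)"
  proof safe
    fix x assume "x \<in> above S l"
    then show "f x \<in> above T (f l)"
    proof induction
      case base show ?case by (rule above.base)
    next
      case (step m)
      have "ts T (g m) \<in> above T (f l)"
        by (rule above.step) (use step img p comm in auto)
      then show ?case using comm step by simp
    qed
  qed
  show "above T (f l) \<subseteq> f ` above S l"
  proof
    fix x assume "x \<in> above T (f l)"
    then show "x \<in> f ` above S l"
    proof induction
      case base show ?case by (simp add: above.base)
    next
      case (step m)
      then obtain m0 where m0: "m0 \<in> marks S" "m = g m0" using img by blast
      then have "f (tt S (tp S m0)) \<in> f ` above S l" using step comm p by simp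
      then have "tt S (tp S m0) \<in> above S l"
        using inj_on_image_mem_iff[OF inj(1) _ sub] p(5,6) m0 by blast
      then show ?case using above.step m0 comm(1) by (metis imageI)
    qed
  qed
qed

lemma is_tree: "is_tree T"
proof -
  have "edges S \<subseteq> above S (root S)" using is_treeD(2)[OF S] by blast
  then show ?thesis using pretree above[OF p(9)] img(1) image_mono by (metis is_tree_iff root)
qed

lemma leaves: "leaves T = f ` leaves S"
proof -
  have "tt T ` nodes T = f ` (tt S ` nodes S)"
    unfolding img(3)[symmetric] image_image using comm(3) by (intro image_cong) auto
  then show ?thesis unfolding leaves_def img(1)[symmetric] using p(6)
    by (subst inj_on_image_set_diff[OF inj(1)]) auto
qed

lemma restr:
  assumes "A \<subseteq> edges S" "M \<subseteq> marks S" "N \<subseteq> nodes S"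
  shows "tree_iso (restr S A M N) (restr T (f ` A) (g ` M) (k ` N)) f g k"
  using assms comm inj unfolding tree_iso_def
  by (auto simp: bij_betw_def intro: inj_on_subset)

end

text \<open>Cuts are literal restrictions of carriers, so an isomorphism moves them by taking
  images, with no choice of representatives. The closure under input marks is carried over because
  \<open>k\<close> is injective and commutes with \<open>tp\<close>.\<close>

lemma tree_iso_cut:
  fixes T T' :: "('i, 'ia, 'e, 'b, 'ba) ptree"
  assumes "is_tree T" "tree_iso T T' f g k" "S \<in> cuts T"
  shows "restr T' (f ` edges S) (g ` marks S) (k ` nodes S) \<in> cuts T'"
proof -
  interpret tree_isomorphism T T' f g k using assms by unfold_locales
  note c = cutsD[OF assms(1,3)]
  let ?R = "restr T' (f ` edges S) (g ` marks S) (k ` nodes S)"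
  have "tree_iso S ?R f g k"
    using restr[of "edges S" "marks S" "nodes S"] c(3-5) by (subst c(6)) auto
  then interpret R: tree_isomorphism S ?R f g k using c(1) by unfold_locales
  have "tp T' (g m) \<in> k ` nodes S \<longleftrightarrow> tp T m \<in> nodes S" if "m \<in> marks T" for m
    using that comm(2) p(5) inj_on_image_mem_iff[OF inj(3) _ c(4)] by simp
  then have "g ` marks S = {m \<in> marks T'. tp T' m \<in> k ` nodes S}"
    unfolding img(2)[symmetric] c(5) by blast
  moreover have "f ` edges S \<subseteq> edges T'" "k ` nodes S \<subseteq> nodes T'"
    using c(3,4) img(1,3) by blast+
  ultimately show ?thesis using R.is_tree R.root root c(2) by (intro cutsI[OF refl]) auto
qed

lemma tree_iso_ideal:
  fixes T T' :: "('i, 'ia, 'e, 'b, 'ba) ptree"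
  assumes "is_tree T" "tree_iso T T' f g k" "l \<in> edges T"
  shows "ideal_subtree T' (f l) = restr T' (f ` edges (ideal_subtree T l))
     (g ` marks (ideal_subtree T l)) (k ` nodes (ideal_subtree T l))"
proof -
  interpret tree_isomorphism T T' f g k using assms by unfold_locales
  have l: "f l \<in> edges T'" using img assms by auto
  note sub = above_edges[OF is_treeD(1)[OF assms(1)] assms(3)]
  note mem = inj_on_image_mem_iff[OF inj(1) _ sub]
  show ?thesis unfolding ideal_subtree_eq[OF assms(1,3)] ideal_subtree_eq[OF is_tree l]
     above[OF assms(3)]
  proof (simp, intro arg_cong3[where f = "\<lambda>A M N. restr T' A M N"] refl)
    show "{m \<in> marks T'. tt T' (tp T' m) \<in> f ` above T l} = g ` {m \<in> marks T. tt T (tp T m) \<in> above T l}"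
    proof -
      have "tt T' (tp T' (g m)) \<in> f ` above T l \<longleftrightarrow> tt T (tp T m) \<in> above T l" if "m \<in> marks T" for m
        using that comm p(5,6) mem by simp
      then show ?thesis unfolding img(2)[symmetric] by blast
    qed
    show "{n \<in> nodes T'. tt T' n \<in> f ` above T l} = k ` {n \<in> nodes T. tt T n \<in> above T l}"
    proof -
      have "tt T' (k n) \<in> f ` above T l \<longleftrightarrow> tt T n \<in> above T l" if "n \<in> nodes T" for n
        using that comm p(5,6) mem by simp
      then show ?thesis unfolding img(3)[symmetric] by blast
    qed
  qed
qed

section \<open>P-trees\<close>

locale polynomial_diagram =
  fixes P :: "('i, 'ia, 'e, 'ea, 'b, 'ba) poly_diagram"
  assumes P: "is_poly_diagram P"
begin

lemma gpd: "is_groupoid (gI P)" "is_groupoid (gE P)" "is_groupoid (gB P)"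
  using P by (auto simp: is_poly_diagram_def)

lemma fct: "is_functor (gE P) (gI P) (src_f P)" "is_functor (gE P) (gB P) (mid_f P)"
     "is_functor (gB P) (gI P) (tgt_f P)"
  using P by (auto simp: is_poly_diagram_def)

end

lemma is_functorD:
  assumes "is_functor G H F"
  shows "x \<in> obs G \<Longrightarrow> on_ob F x \<in> obs H" "x \<in> obs G \<Longrightarrow> on_arr F (idn G x) = idn H (on_ob F x)"
   "x \<in> obs G \<Longrightarrow> y \<in> obs G \<Longrightarrow> f \<in> hom G x y \<Longrightarrow> on_arr F f \<in> hom H (on_ob F x) (on_ob F y)"
   "x \<in> obs G \<Longrightarrow> y \<in> obs G \<Longrightarrow> z \<in> obs G \<Longrightarrow> f \<in> hom G x y \<Longrightarrow> g \<in> hom G y z \<Longrightarrow>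
        on_arr F (cmp G g f) = cmp H (on_arr F g) (on_arr F f)"
  using assms unfolding is_functor_def by blast+

lemma functor_ginv:
  assumes "is_groupoid G" "is_groupoid H" "is_functor G H F" "x \<in> obs G" "y \<in> obs G" "f \<in> hom G x y"
  shows "on_arr F (ginv G x y f) = ginv H (on_ob F x) (on_ob F y) (on_arr F f)"
proof -
  note F = is_functorD[OF assms(3)]
  let ?i = "on_arr F (ginv G x y f)"
  note g = ginv[OF assms(1,4-6)]
  have f: "on_arr F f \<in> hom H (on_ob F x) (on_ob F y)" using F assms by blast
  have i: "?i \<in> hom H (on_ob F y) (on_ob F x)" using F(3) assms g by blast
  have o: "on_ob F x \<in> obs H" "on_ob F y \<in> obs H" using F(1) assms by auto
  have "cmp H (on_arr F f) ?i = idn H (on_ob F y)"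
    using F(4)[of y x y "ginv G x y f" f] F(2) assms(4-6) g by simp
  moreover have "cmp H (ginv H (on_ob F x) (on_ob F y) (on_arr F f)) (cmp H (on_arr F f) ?i) = ?i"
    by (rule groupoid_cmp_ginv_cmp(1)[OF assms(2) o o(2) f i])
  moreover note ginv(1)[OF assms(2) o f]
  ultimately show ?thesis using groupoid_idr[OF assms(2) o(2,1)] by metis
qed

text \<open>In applications \<open>s\<close>, \<open>s'\<close>, \<open>s''\<close> are the
  structure isomorphisms of three trees at corresponding marks or nodes, and the conclusion is the
  compatibility of a composite map with them.\<close>

lemma square_paste:
  assumes "is_groupoid G" "x \<in> obs G" "x' \<in> obs G" "x'' \<in> obs G" "y \<in> obs G" "y' \<in> obs G" "y'' \<in> obs G"
    "s \<in> hom G y x" "s' \<in> hom G y' x'" "s'' \<in> hom G y'' x''"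
    "f \<in> hom G y y'" "f' \<in> hom G y' y''" "a \<in> hom G x x'" "a' \<in> hom G x' x''"
    "cmp G s' f = cmp G a s" "cmp G s'' f' = cmp G a' s'"
  shows "cmp G s'' (cmp G f' f) = cmp G (cmp G a' a) s"
proof -
  have "cmp G s'' (cmp G f' f) = cmp G (cmp G s'' f') f"
    by (rule groupoid_assoc[OF assms(1,5,6,7,4,11,12,10)])
  also have "\<dots> = cmp G a' (cmp G s' f)" unfolding assms(16)
    by (rule groupoid_assoc[OF assms(1,5,6,3,4,11,9,14), symmetric])
  also have "\<dots> = cmp G (cmp G a' a) s" unfolding assms(15)
    by (rule groupoid_assoc[OF assms(1,5,2,3,4,8,13,14)])
  finally show ?thesis .
qed

lemma functor_square_paste:
  assumes G: "is_groupoid G" and H: "is_groupoid H" and F: "is_functor G H F"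
    and e: "e \<in> obs G" "e' \<in> obs G" "e'' \<in> obs G" and f: "f \<in> hom G e e'" "f' \<in> hom G e' e''"
    and x: "x \<in> obs H" "x' \<in> obs H" "x'' \<in> obs H" and a: "a \<in> hom H x x'" "a' \<in> hom H x' x''"
    and s: "s \<in> hom H (on_ob F e) x" "s' \<in> hom H (on_ob F e') x'" "s'' \<in> hom H (on_ob F e'') x''"
    and sq: "cmp H s' (on_arr F f) = cmp H a s" "cmp H s'' (on_arr F f') = cmp H a' s'"
  shows "cmp H s'' (on_arr F (cmp G f' f)) = cmp H (cmp H a' a) s"
  unfolding is_functorD(4)[OF F e f]
  using is_functorD(1,3)[OF F] by (intro square_paste[OF H x _ _ _ s _ _ a sq]) (use e f in auto)

lemma square_inv:
  assumes "is_groupoid G" "x \<in> obs G" "x' \<in> obs G" "y \<in> obs G" "y' \<in> obs G"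
    "s \<in> hom G y x" "s' \<in> hom G y' x'" "f \<in> hom G y y'" "a \<in> hom G x x'"
    "cmp G s' f = cmp G a s"
  shows "cmp G s (ginv G y y' f) = cmp G (ginv G x x' a) s'"
proof -
  note f = ginv[OF assms(1,4,5,8)] and a = ginv[OF assms(1,2,3,9)]
  have "cmp G (ginv G x x' a) s' = cmp G (ginv G x x' a) (cmp G (cmp G s' f) (ginv G y y' f))"
    using groupoid_cmp_ginv_cmp(3)[OF assms(1,4,5,3,8,7)] by simp
  also have "\<dots> = cmp G (ginv G x x' a) (cmp G a (cmp G s (ginv G y y' f)))"
    unfolding assms(10) using groupoid_assoc[OF assms(1,5,4,2,3) f(1) assms(6,9)] by simp
  also have "\<dots> = cmp G s (ginv G y y' f)"
    by (rule groupoid_cmp_ginv_cmp(1)[OF assms(1,2,3,5,9)]) (rule groupoid_cmp[OF assms(1,5,4,2) f(1) assms(6)])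
  finally show ?thesis by simp
qed

lemma functor_square_inv:
  assumes G: "is_groupoid G" and H: "is_groupoid H" and F: "is_functor G H F"
    and e: "e \<in> obs G" "e' \<in> obs G" "f \<in> hom G e e'" and x: "x \<in> obs H" "x' \<in> obs H" "a \<in> hom H x x'"
    and s: "s \<in> hom H (on_ob F e) x" "s' \<in> hom H (on_ob F e') x'" "cmp H s' (on_arr F f) = cmp H a s"
  shows "cmp H s (on_arr F (ginv G e e' f)) = cmp H (ginv H x x' a) s'"
  unfolding functor_ginv[OF G H F e]
  using is_functorD(1,3)[OF F] by (intro square_inv[OF H x(1,2) _ _ s(1,2) _ x(3) s(3)]) (use e in auto)

context polynomial_diagram begin

text \<open>Replaces the equivalence with the homotopy pullback by two elementary conditions: full
  faithfulness of the comparison functor and essential surjectivity. Each of them concerns one node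
  together with its input marks, so it can be checked node by node in subtrees and in glued
  trees.\<close>

lemma is_ptree_iff: "is_ptree P T \<longleftrightarrow> is_tree T \<and>
     colA T \<in> edges T \<rightarrow> obs (gI P) \<and> colM T \<in> marks T \<rightarrow> obs (gE P) \<and>
     colN T \<in> nodes T \<rightarrow> obs (gB P) \<and>
     (\<forall>m\<in>marks T. isoS T m \<in> hom (gI P) (on_ob (src_f P) (colM T m)) (colA T (ts T m))) \<and>
     (\<forall>m\<in>marks T. isoP T m \<in> hom (gB P) (on_ob (mid_f P) (colM T m)) (colN T (tp T m))) \<and>
     (\<forall>n\<in>nodes T. isoT T n \<in> hom (gI P) (on_ob (tgt_f P) (colN T n)) (colA T (tt T n))) \<and>
     (\<forall>m\<in>marks T. \<forall>m'\<in>marks T. \<forall>u\<in>hom (gE P) (colM T m) (colM T m'). tp T m = tp T m' \<longrightarrow>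
        cmp (gB P) (isoP T m') (on_arr (mid_f P) u) = isoP T m \<longrightarrow>
        m = m' \<and> u = idn (gE P) (colM T m)) \<and>
     (\<forall>e\<in>obs (gE P). \<forall>n\<in>nodes T. \<forall>\<theta>\<in>hom (gB P) (on_ob (mid_f P) e) (colN T n).
        \<exists>m\<in>marks T. tp T m = n \<and> (\<exists>u\<in>hom (gE P) (colM T m) e.
          cmp (gB P) \<theta> (on_arr (mid_f P) u) = isoP T m))"
  (is "_ \<longleftrightarrow> is_tree T \<and> ?A \<and> ?M \<and> ?N \<and> ?S \<and> ?P \<and> ?T \<and> ?full \<and> ?surj")
proof (cases "is_tree T \<and> ?A \<and> ?M \<and> ?N \<and> ?S \<and> ?P \<and> ?T")
  case True
  let ?D = "discrete (marks T)"
  let ?H = "homotopy_pullback (gE P) (discrete (nodes T)) (gB P) (mid_f P) (node_colouring P T)"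
  let ?F = "middle_comparison P T"
  note p = pretreeD[OF is_treeD(1)[OF conjunct1[OF True]]]
  note mF = is_functorD[OF fct(2)]
  have M: "colM T m \<in> obs (gE P)" "isoP T m \<in> hom (gB P) (on_ob (mid_f P) (colM T m)) (colN T (tp T m))"
     "colN T (tp T m) \<in> obs (gB P)"
     if "m \<in> marks T" for m using True that p(5) by auto
  \<comment> \<open>The node component of an arrow is an identity of a discrete groupoid, and
    \<open>node_colouring\<close> sends it to an identity; only a triangle with
    \<open>isoP T m\<close> remains.\<close>
  have hom: "hom ?H (on_ob ?F m) (e, n, \<theta>) =
      (if tp T m = n then {(u, n) | u. u \<in> hom (gE P) (colM T m) e \<and>
          cmp (gB P) \<theta> (on_arr (mid_f P) u) = isoP T m} else {})" if "m \<in> marks T" for m e n \<theta>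
    using groupoid_idl[OF gpd(3) _ _ M(2)[OF that]] M[OF that] mF(1)
    by (auto simp: homotopy_pullback_def middle_comparison_def discrete_def node_colouring_def)
  have obs: "(e, n, \<theta>) \<in> obs ?H \<longleftrightarrow> e \<in> obs (gE P) \<and> n \<in> nodes T \<and>
      \<theta> \<in> hom (gB P) (on_ob (mid_f P) e) (colN T n)" for e n \<theta>
    by (auto simp: homotopy_pullback_def discrete_def node_colouring_def)
  have obF: "on_ob ?F m = (colM T m, tp T m, isoP T m)" for m by (simp add: middle_comparison_def)
  have arrF: "on_arr ?F m = (idn (gE P) (colM T m), tp T m)" for m by (simp add: middle_comparison_def)
  have homD: "hom ?D m m' = (if m = m' then {m} else {})" for m m' by (simp add: discrete_def)
  have idin: "(idn (gE P) (colM T m), tp T m) \<in> hom ?H (on_ob ?F m) (on_ob ?F m)" if "m \<in> marks T" for m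
    unfolding obF[of m] hom[OF that, unfolded obF[of m]]
    using groupoid_idn[OF gpd(2) M(1)[OF that]] mF(1,2) groupoid_idr[OF gpd(3) _ _ M(2)] M that
    by auto
  have "is_functor ?D ?H ?F"
    unfolding is_functor_def
  proof (intro conjI ballI)
    fix x assume x: "x \<in> obs ?D"
    then have m: "x \<in> marks T" by (simp add: discrete_def)
    then show "on_ob ?F x \<in> obs ?H" using M p(5) by (simp add: obF obs)
    show "on_arr ?F (idn ?D x) = idn ?H (on_ob ?F x)"
      by (simp add: arrF obF discrete_def homotopy_pullback_def)
    fix y f assume "y \<in> obs ?D" and f: "f \<in> hom ?D x y"
    then have f': "f = x" "y = x" by (auto simp: homD split: if_splits)
    then show "on_arr ?F f \<in> hom ?H (on_ob ?F x) (on_ob ?F y)" using idin[OF m] by (simp add: arrF)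
    fix z g assume "g \<in> hom ?D y z"
    then have g: "g = x" "z = x" using f' by (auto simp: homD split: if_splits)
    show "on_arr ?F (cmp ?D g f) = cmp ?H (on_arr ?F g) (on_arr ?F f)"
      using groupoid_idl[OF gpd(2) _ _ groupoid_idn[OF gpd(2)]] M[OF m]
      by (simp add: f' g arrF discrete_def homotopy_pullback_def)
  qed
  moreover have "(\<forall>z\<in>obs ?H. \<exists>x\<in>obs ?D. hom ?H (on_ob ?F x) z \<noteq> {}) \<longleftrightarrow> ?surj"
  proof -
    have "(\<exists>x\<in>obs ?D. hom ?H (on_ob ?F x) (e, n, \<theta>) \<noteq> {}) \<longleftrightarrow>
       (\<exists>m\<in>marks T. tp T m = n \<and> (\<exists>u\<in>hom (gE P) (colM T m) e.
          cmp (gB P) \<theta> (on_arr (mid_f P) u) = isoP T m))" for e n \<theta>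
      using hom by (auto simp: discrete_def split: if_splits)
    moreover have "(\<forall>z\<in>obs ?H. Q z) \<longleftrightarrow> (\<forall>e n \<theta>. (e, n, \<theta>) \<in> obs ?H \<longrightarrow> Q (e, n, \<theta>))" for Q
      by (simp add: Ball_def split_paired_All)
    ultimately show ?thesis by (simp only: obs) blast
  qed
  moreover have "(\<forall>x\<in>obs ?D. \<forall>y\<in>obs ?D.
      bij_betw (on_arr ?F) (hom ?D x y) (hom ?H (on_ob ?F x) (on_ob ?F y))) \<longleftrightarrow> ?full"
  proof -
    have "bij_betw (on_arr ?F) (hom ?D m m') (hom ?H (on_ob ?F m) (on_ob ?F m')) \<longleftrightarrow>
       (\<forall>u\<in>hom (gE P) (colM T m) (colM T m'). tp T m = tp T m' \<longrightarrow>
        cmp (gB P) (isoP T m') (on_arr (mid_f P) u) = isoP T m \<longrightarrow>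
        m = m' \<and> u = idn (gE P) (colM T m))" if m: "m \<in> marks T" "m' \<in> marks T" for m m'
    proof (cases "m = m'")
      case True
      have "bij_betw (on_arr ?F) (hom ?D m m') (hom ?H (on_ob ?F m) (on_ob ?F m')) \<longleftrightarrow>
          {(idn (gE P) (colM T m), tp T m)} = hom ?H (on_ob ?F m) (on_ob ?F m)"
        using True by (simp add: homD bij_betw_def arrF)
      also have "\<dots> \<longleftrightarrow> (\<forall>u\<in>hom (gE P) (colM T m) (colM T m'). 
        cmp (gB P) (isoP T m') (on_arr (mid_f P) u) = isoP T m \<longrightarrow> u = idn (gE P) (colM T m))"
        using idin[OF m(1)] hom[OF m(1), of "colM T m" "tp T m" "isoP T m", folded obF[of m]] True by auto
      finally show ?thesis using True by simp
    next
      \<comment> \<open>Distinct marks have no arrow between them in the discrete groupoid, so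
        bijectivity demands that the pullback has none either.\<close>
      case False
      then show ?thesis using hom[OF m(1), of "colM T m'" "tp T m'" "isoP T m'", folded obF[of m']]
        by (auto simp: homD bij_betw_def)
    qed
    then show ?thesis by (simp add: discrete_def[of "marks T"])
  qed
  ultimately show ?thesis using True unfolding is_ptree_def is_equivalence_def by blast
next
  case False then show ?thesis unfolding is_ptree_def by blast
qed

lemma ptreeD:
  assumes "is_ptree P T"
  shows "is_tree T" "a \<in> edges T \<Longrightarrow> colA T a \<in> obs (gI P)" "m \<in> marks T \<Longrightarrow> colM T m \<in> obs (gE P)"
     "n \<in> nodes T \<Longrightarrow> colN T n \<in> obs (gB P)"
     "m \<in> marks T \<Longrightarrow> isoS T m \<in> hom (gI P) (on_ob (src_f P) (colM T m)) (colA T (ts T m))"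
     "m \<in> marks T \<Longrightarrow> isoP T m \<in> hom (gB P) (on_ob (mid_f P) (colM T m)) (colN T (tp T m))"
     "n \<in> nodes T \<Longrightarrow> isoT T n \<in> hom (gI P) (on_ob (tgt_f P) (colN T n)) (colA T (tt T n))"
  using assms by (auto simp: is_ptree_def)

lemma root_edge: "is_ptree P T \<Longrightarrow> root T \<in> edges T"
  using pretreeD(9)[OF is_treeD(1)[OF ptreeD(1)]] .

lemma finite_leaves: "is_ptree P T \<Longrightarrow> finite (leaves T)"
  using pretreeD(1)[OF is_treeD(1)[OF ptreeD(1)]] by (simp add: leaves_def)

lemma ptree_full:
  assumes "is_ptree P T" "m \<in> marks T" "m' \<in> marks T" "u \<in> hom (gE P) (colM T m) (colM T m')"
    "tp T m = tp T m'" "cmp (gB P) (isoP T m') (on_arr (mid_f P) u) = isoP T m"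
  shows "m = m'" "u = idn (gE P) (colM T m)"
  using assms unfolding is_ptree_iff by blast+

lemma ptree_surj:
  assumes "is_ptree P T" "e \<in> obs (gE P)" "n \<in> nodes T" "\<theta> \<in> hom (gB P) (on_ob (mid_f P) e) (colN T n)"
  shows "\<exists>m\<in>marks T. tp T m = n \<and> (\<exists>u\<in>hom (gE P) (colM T m) e.
          cmp (gB P) \<theta> (on_arr (mid_f P) u) = isoP T m)"
  using assms unfolding is_ptree_iff by blast

text \<open>The homotopy pullback condition survives because \<open>M\<close> is the full preimage
  of \<open>N\<close>: every node kept retains exactly its old inputs.\<close>

lemma ptree_restr:
  assumes "is_ptree P T" "is_tree (restr T A M N)" "A \<subseteq> edges T" "N \<subseteq> nodes T"
    "M = {m \<in> marks T. tp T m \<in> N}"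
  shows "is_ptree P (restr T A M N)" (is "is_ptree P ?R")
proof -
  have sel: "edges ?R = A" "marks ?R = M" "nodes ?R = N" "ts ?R = ts T" "tp ?R = tp T" "tt ?R = tt T"
     "colA ?R = colA T" "colM ?R = colM T" "colN ?R = colN T" "isoS ?R = isoS T" "isoP ?R = isoP T"
     "isoT ?R = isoT T"
    by simp_all
  have M: "M \<subseteq> marks T" using assms(5) by blast
  show ?thesis
    unfolding is_ptree_iff sel
    using assms(3,4) M ptreeD(2-4)[OF assms(1)] ptreeD(5-7)[OF assms(1)]
  proof (intro conjI)
    show "\<forall>m\<in>M. \<forall>m'\<in>M. \<forall>u\<in>hom (gE P) (colM T m) (colM T m'). tp T m = tp T m' \<longrightarrow>
        cmp (gB P) (isoP T m') (on_arr (mid_f P) u) = isoP T m \<longrightarrow> m = m' \<and> u = idn (gE P) (colM T m)"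
      using ptree_full[OF assms(1)] M by blast
    show "\<forall>e\<in>obs (gE P). \<forall>n\<in>N. \<forall>\<theta>\<in>hom (gB P) (on_ob (mid_f P) e) (colN T n).
       \<exists>m\<in>M. tp T m = n \<and> (\<exists>u\<in>hom (gE P) (colM T m) e. cmp (gB P) \<theta> (on_arr (mid_f P) u) = isoP T m)"
    proof (intro ballI)
      fix e n \<theta> assume a: "e \<in> obs (gE P)" "n \<in> N" "\<theta> \<in> hom (gB P) (on_ob (mid_f P) e) (colN T n)"
      from ptree_surj[OF assms(1) a(1) _ a(3)] a(2) assms(4)
      show "\<exists>m\<in>M. tp T m = n \<and> (\<exists>u\<in>hom (gE P) (colM T m) e. cmp (gB P) \<theta> (on_arr (mid_f P) u) = isoP T m)"
        unfolding assms(5) by blast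
    qed
  qed (use assms(2) in blast)+
qed

lemma cut_ptree:
  assumes "is_ptree P T" "S \<in> cuts T"
  shows "is_ptree P S"
proof -
  note c = cutsD[OF ptreeD(1)[OF assms(1)] assms(2)]
  have "is_ptree P (restr T (edges S) (marks S) (nodes S))"
    by (rule ptree_restr[OF assms(1) _ c(3,4,5)]) (simp only: c(1) c(6)[symmetric])
  then show ?thesis by (simp only: c(6)[symmetric])
qed

lemma ideal_ptree:
  assumes "is_ptree P T" "l \<in> edges T"
  shows "is_ptree P (ideal_subtree T l)"
proof -
  note t = ptreeD(1)[OF assms(1)]
  note e = ideal_subtree_eq[OF t assms(2)]
  note p = is_treeD(1)[OF t]
  show ?thesis unfolding e
    by (rule ptree_restr[OF assms(1) ideal_subtree_tree(1)[OF t assms(2), unfolded e] above_edges[OF p assms(2)]])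
      (use pretreeD(5)[OF p] in auto)
qed

end

section \<open>Isomorphisms of P-trees and the groupoid they form\<close>

lemma ptrees_simps [simp]:
  "obs (ptrees P) = {T. is_ptree P T}" "hom (ptrees P) = ptree_isos P"
  "dm (cmp (ptrees P) u h) = dm h"
  "mapA (cmp (ptrees P) u h) = compose (edges (dm h)) (mapA u) (mapA h)"
  "mapM (cmp (ptrees P) u h) = compose (marks (dm h)) (mapM u) (mapM h)"
  "mapN (cmp (ptrees P) u h) = compose (nodes (dm h)) (mapN u) (mapN h)"
  "natA (cmp (ptrees P) u h) = restrict (\<lambda>a. cmp (gI P) (natA u (mapA h a)) (natA h a)) (edges (dm h))"
  "natM (cmp (ptrees P) u h) = restrict (\<lambda>m. cmp (gE P) (natM u (mapM h m)) (natM h m)) (marks (dm h))"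
  "natN (cmp (ptrees P) u h) = restrict (\<lambda>n. cmp (gB P) (natN u (mapN h n)) (natN h n)) (nodes (dm h))"
  "dm (idn (ptrees P) T) = T"
  "mapA (idn (ptrees P) T) = restrict id (edges T)"
  "mapM (idn (ptrees P) T) = restrict id (marks T)"
  "mapN (idn (ptrees P) T) = restrict id (nodes T)"
  "natA (idn (ptrees P) T) = restrict (\<lambda>a. idn (gI P) (colA T a)) (edges T)"
  "natM (idn (ptrees P) T) = restrict (\<lambda>m. idn (gE P) (colM T m)) (marks T)"
  "natN (idn (ptrees P) T) = restrict (\<lambda>n. idn (gB P) (colN T n)) (nodes T)"
  by (simp_all add: ptrees_def)

definition extensional_map :: "('i, 'ia, 'e, 'ea, 'b, 'ba) ptree_map \<Rightarrow> bool" where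
  "extensional_map h \<longleftrightarrow> mapA h \<in> extensional (edges (dm h)) \<and> mapM h \<in> extensional (marks (dm h)) \<and>
     mapN h \<in> extensional (nodes (dm h)) \<and> natA h \<in> extensional (edges (dm h)) \<and>
     natM h \<in> extensional (marks (dm h)) \<and> natN h \<in> extensional (nodes (dm h))"

text \<open>The mathematical content of an isomorphism; the normalisation outside the carriers is
  separated off as \<open>extensional_map\<close>.\<close>

definition iso_data ::
    "('i, 'ia, 'e, 'ea, 'b, 'ba) poly_diagram \<Rightarrow> ('i, 'ia, 'e, 'b, 'ba) ptree \<Rightarrow>
     ('i, 'ia, 'e, 'b, 'ba) ptree \<Rightarrow> ('i, 'ia, 'e, 'ea, 'b, 'ba) ptree_map \<Rightarrow> bool" where
  "iso_data P S T h \<longleftrightarrow> tree_iso S T (mapA h) (mapM h) (mapN h) \<and>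
     (\<forall>a\<in>edges S. natA h a \<in> hom (gI P) (colA S a) (colA T (mapA h a))) \<and>
     (\<forall>m\<in>marks S. natM h m \<in> hom (gE P) (colM S m) (colM T (mapM h m))) \<and>
     (\<forall>n\<in>nodes S. natN h n \<in> hom (gB P) (colN S n) (colN T (mapN h n))) \<and>
     (\<forall>m\<in>marks S. cmp (gI P) (isoS T (mapM h m)) (on_arr (src_f P) (natM h m)) =
        cmp (gI P) (natA h (ts S m)) (isoS S m)) \<and>
     (\<forall>m\<in>marks S. cmp (gB P) (isoP T (mapM h m)) (on_arr (mid_f P) (natM h m)) =
        cmp (gB P) (natN h (tp S m)) (isoP S m)) \<and>
     (\<forall>n\<in>nodes S. cmp (gI P) (isoT T (mapN h n)) (on_arr (tgt_f P) (natN h n)) =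
        cmp (gI P) (natA h (tt S n)) (isoT S n))"

text \<open>The pullback condition is automatic: the preimage of \<open>m'\<close> under
  \<open>g\<close> lies over a node with the same image under \<open>k\<close> as \<open>n\<close>,
  and \<open>k\<close> is injective.\<close>

lemma ptree_isos_iff:
  assumes "is_tree S"
  shows "h \<in> ptree_isos P S T \<longleftrightarrow> dm h = S \<and> extensional_map h \<and> iso_data P S T h"
proof -
  note p = pretreeD[OF is_treeD(1)[OF assms]]
  have 1: "is_tree_embedding S T f g k" if i: "tree_iso S T f g k" for f g k
  proof -
    have b: "f ` edges S = edges T" "g ` marks S = marks T" "k ` nodes S = nodes T"
        "inj_on g (marks S)" "inj_on k (nodes S)"
      and c: "\<forall>m\<in>marks S. f (ts S m) = ts T (g m) \<and> k (tp S m) = tp T (g m)"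
        "\<forall>n\<in>nodes S. f (tt S n) = tt T (k n)"
      using i by (auto simp: tree_iso_def bij_betw_def)
    have "\<exists>!m. m \<in> marks S \<and> g m = m' \<and> tp S m = n" if n: "n \<in> nodes S" "m' \<in> marks T" "tp T m' = k n" for n m'
    proof -
      from n(2)[folded b(2)] obtain m where m: "m \<in> marks S" "g m = m'" by (elim imageE) simp
      then have "k (tp S m) = k n" using bspec[OF c(1) m(1)] n(3) by simp
      then have "tp S m = n" using b(5) p(5)[OF m(1)] n(1) by (metis inj_onD)
      show ?thesis
      proof (rule ex1I)
        show "m \<in> marks S \<and> g m = m' \<and> tp S m = n" using m \<open>tp S m = n\<close> by blast
        show "x = m" if "x \<in> marks S \<and> g x = m' \<and> tp S x = n" for x
          using that m b(4) by (metis inj_onD)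
      qed
    qed
    then show ?thesis using b(1-3) c unfolding is_tree_embedding_def by blast
  qed
  have 2: "tree_iso S T f g k" if "is_tree_embedding S T f g k" "bij_betw f (edges S) (edges T)"
     "bij_betw g (marks S) (marks T)" "bij_betw k (nodes S) (nodes T)" for f g k
    using that unfolding tree_iso_def is_tree_embedding_def by blast
  have 3: "bij_betw f (edges S) (edges T)"
     "bij_betw g (marks S) (marks T)" "bij_betw k (nodes S) (nodes T)" if "tree_iso S T f g k" for f g k
    using that unfolding tree_iso_def by blast+
  show ?thesis
  proof (cases "dm h = S")
    case True
    show ?thesis
      unfolding ptree_isos_def ptree_embeddings_def extensional_map_def iso_data_def PiE_iff mem_Collect_eq True
      by (rule iffI; elim conjE; intro conjI; (assumption | rule refl | erule 1 | erule 3 | (rule 2; assumption)))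
  qed (auto simp: ptree_isos_def ptree_embeddings_def)
qed

lemma ptree_map_eqI:
  assumes "extensional_map h" "extensional_map h'" "dm h = dm h'"
   "\<And>a. a \<in> edges (dm h) \<Longrightarrow> mapA h a = mapA h' a \<and> natA h a = natA h' a"
   "\<And>a. a \<in> marks (dm h) \<Longrightarrow> mapM h a = mapM h' a \<and> natM h a = natM h' a"
   "\<And>a. a \<in> nodes (dm h) \<Longrightarrow> mapN h a = mapN h' a \<and> natN h a = natN h' a"
  shows "h = h'"
proof (rule ptree_map.equality)
  show "mapA h = mapA h'" "mapM h = mapM h'" "mapN h = mapN h'"
     "natA h = natA h'" "natM h = natM h'" "natN h = natN h'"
    using assms unfolding extensional_map_def by (auto intro: extensionalityI)
qed (use assms in auto)

lemma extensional_map_cmp [simp]: "extensional_map (cmp (ptrees P) u h)"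
  and extensional_map_idn [simp]: "extensional_map (idn (ptrees P) T)"
  by (simp_all add: extensional_map_def compose_def)

definition pinv ::
    "('i, 'ia, 'e, 'ea, 'b, 'ba) poly_diagram \<Rightarrow> ('i, 'ia, 'e, 'b, 'ba) ptree \<Rightarrow>
     ('i, 'ia, 'e, 'b, 'ba) ptree \<Rightarrow> ('i, 'ia, 'e, 'ea, 'b, 'ba) ptree_map \<Rightarrow>
     ('i, 'ia, 'e, 'ea, 'b, 'ba) ptree_map" where
  "pinv P S T h = \<lparr>dm = T,
     mapA = restrict (inv_into (edges S) (mapA h)) (edges T),
     mapM = restrict (inv_into (marks S) (mapM h)) (marks T),
     mapN = restrict (inv_into (nodes S) (mapN h)) (nodes T),
     natA = restrict (\<lambda>b. let a = inv_into (edges S) (mapA h) b in ginv (gI P) (colA S a) (colA T b) (natA h a)) (edges T),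
     natM = restrict (\<lambda>b. let a = inv_into (marks S) (mapM h) b in ginv (gE P) (colM S a) (colM T b) (natM h a)) (marks T),
     natN = restrict (\<lambda>b. let a = inv_into (nodes S) (mapN h) b in ginv (gB P) (colN S a) (colN T b) (natN h a)) (nodes T)\<rparr>"

lemma extensional_map_pinv [simp]: "extensional_map (pinv P S T h)"
  by (simp add: extensional_map_def pinv_def)

context polynomial_diagram begin

lemma isoD:
  assumes "is_tree S" "h \<in> ptree_isos P S T"
  shows "dm h = S" "extensional_map h" "iso_data P S T h" "tree_iso S T (mapA h) (mapM h) (mapN h)"
     "a \<in> edges S \<Longrightarrow> natA h a \<in> hom (gI P) (colA S a) (colA T (mapA h a))"
     "m \<in> marks S \<Longrightarrow> natM h m \<in> hom (gE P) (colM S m) (colM T (mapM h m))"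
     "n \<in> nodes S \<Longrightarrow> natN h n \<in> hom (gB P) (colN S n) (colN T (mapN h n))"
     "m \<in> marks S \<Longrightarrow> cmp (gI P) (isoS T (mapM h m)) (on_arr (src_f P) (natM h m)) =
        cmp (gI P) (natA h (ts S m)) (isoS S m)"
     "m \<in> marks S \<Longrightarrow> cmp (gB P) (isoP T (mapM h m)) (on_arr (mid_f P) (natM h m)) =
        cmp (gB P) (natN h (tp S m)) (isoP S m)"
     "n \<in> nodes S \<Longrightarrow> cmp (gI P) (isoT T (mapN h n)) (on_arr (tgt_f P) (natN h n)) =
        cmp (gI P) (natA h (tt S n)) (isoT S n)"
     "a \<in> edges S \<Longrightarrow> mapA h a \<in> edges T" "m \<in> marks S \<Longrightarrow> mapM h m \<in> marks T" "n \<in> nodes S \<Longrightarrow> mapN h n \<in> nodes T"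
proof -
  have *: "dm h = S" "extensional_map h" "iso_data P S T h" using assms(2) ptree_isos_iff[OF assms(1)] by auto
  then show "dm h = S" "extensional_map h" "iso_data P S T h" by auto
  show t: "tree_iso S T (mapA h) (mapM h) (mapN h)" using *(3) by (simp add: iso_data_def)
  show "a \<in> edges S \<Longrightarrow> mapA h a \<in> edges T" "m \<in> marks S \<Longrightarrow> mapM h m \<in> marks T" "n \<in> nodes S \<Longrightarrow> mapN h n \<in> nodes T"
    using t by (auto simp: tree_iso_def bij_betw_def)
qed (use assms(2)[unfolded ptree_isos_iff[OF assms(1)] iso_data_def] in blast)+

lemma functor_square:
  assumes "is_ptree P S"
  shows "m \<in> marks S \<Longrightarrow> on_ob (src_f P) (colM S m) \<in> obs (gI P)"
    "m \<in> marks S \<Longrightarrow> on_ob (mid_f P) (colM S m) \<in> obs (gB P)"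
    "n \<in> nodes S \<Longrightarrow> on_ob (tgt_f P) (colN S n) \<in> obs (gI P)"
  using ptreeD[OF assms] is_functorD(1)[OF fct(1)] is_functorD(1)[OF fct(2)] is_functorD(1)[OF fct(3)] by auto

text \<open>The first map ends in a subtree of the domain of \<open>u\<close>, and the composite
  ends in the image of that subtree. In this form an isomorphism of \<open>T\<close> can be composed
  with isomorphisms onto cuts and ideal subtrees without being restricted first; with the full
  carriers it is ordinary composition.\<close>

lemma iso_cmp:
  assumes S: "is_ptree P S" and T: "is_ptree P T" and T': "is_ptree P T'"
    and h: "h \<in> ptree_isos P S (restr T A M N)" and sub: "A \<subseteq> edges T" "M \<subseteq> marks T" "N \<subseteq> nodes T"
    and u: "u \<in> ptree_isos P T T'"
  shows "cmp (ptrees P) u h \<in> ptree_isos P S (restr T' (mapA u ` A) (mapM u ` M) (mapN u ` N))"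
proof -
  note tS = ptreeD(1)[OF S] and tT = ptreeD(1)[OF T]
  note p = pretreeD[OF is_treeD(1)[OF tS]] and q = pretreeD[OF is_treeD(1)[OF tT]]
  note h = isoD[OF tS h, simplified]
  note u = isoD[OF tT u]
  note s = ptreeD[OF S] note t = ptreeD[OF T] note t' = ptreeD[OF T']
  let ?c = "cmp (ptrees P) u h"
  let ?R = "restr T' (mapA u ` A) (mapM u ` M) (mapN u ` N)"
  have b: "bij_betw (mapA h) (edges S) A" "bij_betw (mapM h) (marks S) M" "bij_betw (mapN h) (nodes S) N"
    using h(4) by (auto simp: tree_iso_def)
  have b': "inj_on (mapA u) (edges T)" "inj_on (mapM u) (marks T)" "inj_on (mapN u) (nodes T)"
    using u(4) by (auto simp: tree_iso_def bij_betw_def)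
  have hA: "a \<in> edges S \<Longrightarrow> mapA h a \<in> edges T" and hM: "m \<in> marks S \<Longrightarrow> mapM h m \<in> marks T"
    and hN: "n \<in> nodes S \<Longrightarrow> mapN h n \<in> nodes T" for a m n
    using h(11-13) sub by blast+
  have comm: "m \<in> marks S \<Longrightarrow> mapA h (ts S m) = ts T (mapM h m)"
     "m \<in> marks S \<Longrightarrow> mapN h (tp S m) = tp T (mapM h m)"
     "n \<in> nodes S \<Longrightarrow> mapA h (tt S n) = tt T (mapN h n)" for m n
    using h(4) by (auto simp: tree_iso_def)
  have comm': "m \<in> marks T \<Longrightarrow> mapA u (ts T m) = ts T' (mapM u m)"
     "m \<in> marks T \<Longrightarrow> mapN u (tp T m) = tp T' (mapM u m)"
     "n \<in> nodes T \<Longrightarrow> mapA u (tt T n) = tt T' (mapN u n)" for m n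
    using u(4) by (auto simp: tree_iso_def)
  have "bij_betw (mapA ?c) (edges S) (mapA u ` A)" "bij_betw (mapM ?c) (marks S) (mapM u ` M)"
    "bij_betw (mapN ?c) (nodes S) (mapN u ` N)"
    unfolding ptrees_simps h(1) using sub b b'
    by (blast intro: bij_betw_compose inj_on_imp_bij_betw inj_on_subset)+
  then have "tree_iso S ?R (mapA ?c) (mapM ?c) (mapN ?c)"
    by (simp add: tree_iso_def h(1) compose_eq p comm comm' hM hN)
  moreover have "a \<in> edges S \<Longrightarrow> natA ?c a \<in> hom (gI P) (colA S a) (colA ?R (mapA ?c a))" for a
    using groupoid_cmp[OF gpd(1) s(2) t(2) t'(2) h(5) u(5)] hA u(11) by (simp add: h(1) compose_eq)
  moreover have "m \<in> marks S \<Longrightarrow> natM ?c m \<in> hom (gE P) (colM S m) (colM ?R (mapM ?c m))" for m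
    using groupoid_cmp[OF gpd(2) s(3) t(3) t'(3) h(6) u(6)] hM u(12) by (simp add: h(1) compose_eq)
  moreover have "n \<in> nodes S \<Longrightarrow> natN ?c n \<in> hom (gB P) (colN S n) (colN ?R (mapN ?c n))" for n
    using groupoid_cmp[OF gpd(3) s(4) t(4) t'(4) h(7) u(7)] hN u(13) by (simp add: h(1) compose_eq)
  moreover have "cmp (gI P) (isoS ?R (mapM ?c m)) (on_arr (src_f P) (natM ?c m)) =
        cmp (gI P) (natA ?c (ts S m)) (isoS S m) \<and>
      cmp (gB P) (isoP ?R (mapM ?c m)) (on_arr (mid_f P) (natM ?c m)) =
        cmp (gB P) (natN ?c (tp S m)) (isoP S m)" if m: "m \<in> marks S" for m
  proof -
    let ?m = "mapM h m"
    note k = hM[OF m] u(12)[OF hM[OF m]] p(4,5)[OF m] q(4,5)[OF hM[OF m]]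
    note nat = h(5)[OF k(3)] h(7)[OF k(4)] u(5)[OF k(5)] u(7)[OF k(6)]
    note o = s(3)[OF m] t(3)[OF k(1)] t'(3)[OF k(2)] h(6)[OF m] u(6)[OF k(1)]
    have "cmp (gI P) (isoS T' (mapM u ?m)) (on_arr (src_f P) (cmp (gE P) (natM u ?m) (natM h m))) =
        cmp (gI P) (cmp (gI P) (natA u (ts T ?m)) (natA h (ts S m))) (isoS S m)"
      by (rule functor_square_paste[OF gpd(2,1) fct(1) o s(2)[OF k(3)] t(2)[OF k(5)] t'(2)[OF u(11)[OF k(5)]]
          _ nat(3) s(5)[OF m] t(5)[OF k(1)]])
        (use nat t'(5)[OF k(2)] h(8)[OF m] u(8)[OF k(1)] comm(1)[OF m] comm'(1)[OF k(1)] in simp_all)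
    moreover have "cmp (gB P) (isoP T' (mapM u ?m)) (on_arr (mid_f P) (cmp (gE P) (natM u ?m) (natM h m))) =
        cmp (gB P) (cmp (gB P) (natN u (tp T ?m)) (natN h (tp S m))) (isoP S m)"
      by (rule functor_square_paste[OF gpd(2,3) fct(2) o s(4)[OF k(4)] t(4)[OF k(6)] t'(4)[OF u(13)[OF k(6)]]
          _ nat(4) s(6)[OF m] t(6)[OF k(1)]])
        (use nat t'(6)[OF k(2)] h(9)[OF m] u(9)[OF k(1)] comm(2)[OF m] comm'(2)[OF k(1)] in simp_all)
    ultimately show ?thesis using m k by (simp add: h(1) compose_eq comm)
  qed
  moreover have "cmp (gI P) (isoT ?R (mapN ?c n)) (on_arr (tgt_f P) (natN ?c n)) =
        cmp (gI P) (natA ?c (tt S n)) (isoT S n)" if n: "n \<in> nodes S" for n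
  proof -
    let ?n = "mapN h n"
    note k = hN[OF n] u(13)[OF hN[OF n]] p(6)[OF n] q(6)[OF hN[OF n]]
    note nat = h(5)[OF k(3)] u(5)[OF k(4)]
    note o = s(4)[OF n] t(4)[OF k(1)] t'(4)[OF k(2)] h(7)[OF n] u(7)[OF k(1)]
    have "cmp (gI P) (isoT T' (mapN u ?n)) (on_arr (tgt_f P) (cmp (gB P) (natN u ?n) (natN h n))) =
        cmp (gI P) (cmp (gI P) (natA u (tt T ?n)) (natA h (tt S n))) (isoT S n)"
      by (rule functor_square_paste[OF gpd(3,1) fct(3) o s(2)[OF k(3)] t(2)[OF k(4)] t'(2)[OF u(11)[OF k(4)]]
          _ nat(2) s(7)[OF n] t(7)[OF k(1)]])
        (use nat t'(7)[OF k(2)] h(10)[OF n] u(10)[OF k(1)] comm(3)[OF n] comm'(3)[OF k(1)] in simp_all)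
    then show ?thesis using n k by (simp add: h(1) compose_eq comm)
  qed
  ultimately show ?thesis unfolding ptree_isos_iff[OF tS] iso_data_def by (simp add: h(1) del: ptrees_simps(4-))
qed

end

context polynomial_diagram begin

lemma iso_cmp_full:
  assumes "is_ptree P S" "is_ptree P T" "is_ptree P T'" "h \<in> ptree_isos P S T" "u \<in> ptree_isos P T T'"
  shows "cmp (ptrees P) u h \<in> ptree_isos P S T'"
proof -
  have b: "mapA u ` edges T = edges T'" "mapM u ` marks T = marks T'" "mapN u ` nodes T = nodes T'"
    using isoD(4)[OF ptreeD(1)[OF assms(2)] assms(5)] by (auto simp: tree_iso_def bij_betw_def)
  have "h \<in> ptree_isos P S (restr T (edges T) (marks T) (nodes T))" using assms(4) by simp
  from iso_cmp[OF assms(1-3) this _ _ _ assms(5)] show ?thesis by (simp add: b)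
qed

lemma pinv_inverse:
  assumes S: "is_ptree P S" and T: "is_ptree P T" and h: "h \<in> ptree_isos P S T"
  shows "pinv P S T h \<in> ptree_isos P T S"
    "cmp (ptrees P) (pinv P S T h) h = idn (ptrees P) S"
    "cmp (ptrees P) h (pinv P S T h) = idn (ptrees P) T"
proof -
  note tS = ptreeD(1)[OF S] and tT = ptreeD(1)[OF T]
  note p = pretreeD[OF is_treeD(1)[OF tS]] and q = pretreeD[OF is_treeD(1)[OF tT]]
  note h = isoD[OF tS h]
  note s = ptreeD[OF S] note t = ptreeD[OF T]
  let ?j = "pinv P S T h"
  have b: "bij_betw (mapA h) (edges S) (edges T)" "bij_betw (mapM h) (marks S) (marks T)"
    "bij_betw (mapN h) (nodes S) (nodes T)"
    and comm: "\<And>m. m \<in> marks S \<Longrightarrow> ts T (mapM h m) = mapA h (ts S m)"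
     "\<And>m. m \<in> marks S \<Longrightarrow> tp T (mapM h m) = mapN h (tp S m)"
     "\<And>n. n \<in> nodes S \<Longrightarrow> tt T (mapN h n) = mapA h (tt S n)"
    using h(4) by (auto simp: tree_iso_def)
  have jA: "a \<in> edges S \<Longrightarrow> mapA ?j (mapA h a) = a \<and> natA ?j (mapA h a) = ginv (gI P) (colA S a) (colA T (mapA h a)) (natA h a)"
    and jM: "m \<in> marks S \<Longrightarrow> mapM ?j (mapM h m) = m \<and> natM ?j (mapM h m) = ginv (gE P) (colM S m) (colM T (mapM h m)) (natM h m)"
    and jN: "n \<in> nodes S \<Longrightarrow> mapN ?j (mapN h n) = n \<and> natN ?j (mapN h n) = ginv (gB P) (colN S n) (colN T (mapN h n)) (natN h n)"
    for a m n
    using h(11-13) bij_betw_inv_into_left[OF b(1)] bij_betw_inv_into_left[OF b(2)] bij_betw_inv_into_left[OF b(3)]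
    by (auto simp: pinv_def Let_def)
  have cov: "a' \<in> edges T \<Longrightarrow> \<exists>a\<in>edges S. a' = mapA h a" "m' \<in> marks T \<Longrightarrow> \<exists>m\<in>marks S. m' = mapM h m"
     "n' \<in> nodes T \<Longrightarrow> \<exists>n\<in>nodes S. n' = mapN h n" for a' m' n'
    using b unfolding bij_betw_def by blast+
  have gA: "a \<in> edges S \<Longrightarrow> ginv (gI P) (colA S a) (colA T (mapA h a)) (natA h a) \<in> hom (gI P) (colA T (mapA h a)) (colA S a)"
       "a \<in> edges S \<Longrightarrow> cmp (gI P) (ginv (gI P) (colA S a) (colA T (mapA h a)) (natA h a)) (natA h a) = idn (gI P) (colA S a)"
       "a \<in> edges S \<Longrightarrow> cmp (gI P) (natA h a) (ginv (gI P) (colA S a) (colA T (mapA h a)) (natA h a)) = idn (gI P) (colA T (mapA h a))" for a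
    using ginv[OF gpd(1) s(2) t(2)[OF h(11)] h(5)] by blast+
  have gM: "m \<in> marks S \<Longrightarrow> ginv (gE P) (colM S m) (colM T (mapM h m)) (natM h m) \<in> hom (gE P) (colM T (mapM h m)) (colM S m)"
       "m \<in> marks S \<Longrightarrow> cmp (gE P) (ginv (gE P) (colM S m) (colM T (mapM h m)) (natM h m)) (natM h m) = idn (gE P) (colM S m)"
       "m \<in> marks S \<Longrightarrow> cmp (gE P) (natM h m) (ginv (gE P) (colM S m) (colM T (mapM h m)) (natM h m)) = idn (gE P) (colM T (mapM h m))" for m
    using ginv[OF gpd(2) s(3) t(3)[OF h(12)] h(6)] by blast+
  have gN: "n \<in> nodes S \<Longrightarrow> ginv (gB P) (colN S n) (colN T (mapN h n)) (natN h n) \<in> hom (gB P) (colN T (mapN h n)) (colN S n)"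
       "n \<in> nodes S \<Longrightarrow> cmp (gB P) (ginv (gB P) (colN S n) (colN T (mapN h n)) (natN h n)) (natN h n) = idn (gB P) (colN S n)"
       "n \<in> nodes S \<Longrightarrow> cmp (gB P) (natN h n) (ginv (gB P) (colN S n) (colN T (mapN h n)) (natN h n)) = idn (gB P) (colN T (mapN h n))" for n
    using ginv[OF gpd(3) s(4) t(4)[OF h(13)] h(7)] by blast+
  have "bij_betw (mapA ?j) (edges T) (edges S)" "bij_betw (mapM ?j) (marks T) (marks S)"
    "bij_betw (mapN ?j) (nodes T) (nodes S)"
    using bij_betw_inv_into[OF b(1)] bij_betw_inv_into[OF b(2)] bij_betw_inv_into[OF b(3)]
    by (simp_all add: pinv_def cong: bij_betw_cong)
  moreover have "\<forall>m\<in>marks T. mapA ?j (ts T m) = ts S (mapM ?j m) \<and> mapN ?j (tp T m) = tp S (mapM ?j m)"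
    using cov(2) jA jM jN comm p(4,5) by metis
  moreover have "\<forall>n\<in>nodes T. mapA ?j (tt T n) = tt S (mapN ?j n)"
    using cov(3) jA jN comm p(6) by metis
  ultimately have "tree_iso T S (mapA ?j) (mapM ?j) (mapN ?j)" by (simp add: tree_iso_def)
  moreover have "natA ?j a \<in> hom (gI P) (colA T a) (colA S (mapA ?j a))" if "a \<in> edges T" for a
    using cov(1)[OF that] jA gA(1) by auto
  moreover have "natM ?j m \<in> hom (gE P) (colM T m) (colM S (mapM ?j m))" if "m \<in> marks T" for m
    using cov(2)[OF that] jM gM(1) by auto
  moreover have "natN ?j n \<in> hom (gB P) (colN T n) (colN S (mapN ?j n))" if "n \<in> nodes T" for n
    using cov(3)[OF that] jN gN(1) by auto
  moreover have "cmp (gI P) (isoS S (mapM ?j m')) (on_arr (src_f P) (natM ?j m')) =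
        cmp (gI P) (natA ?j (ts T m')) (isoS T m') \<and>
      cmp (gB P) (isoP S (mapM ?j m')) (on_arr (mid_f P) (natM ?j m')) =
        cmp (gB P) (natN ?j (tp T m')) (isoP T m')" if a: "m' \<in> marks T" for m'
  proof -
    obtain m where m: "m \<in> marks S" "m' = mapM h m" using cov(2)[OF a] by blast
    note k = p(4,5)[OF m(1)] h(12)[OF m(1)]
    note o = s(3)[OF m(1)] t(3)[OF k(3)] h(6)[OF m(1)]
    show ?thesis
      using functor_square_inv[OF gpd(2,1) fct(1) o s(2)[OF k(1)] t(2)[OF h(11)[OF k(1)]] h(5)[OF k(1)]
          s(5)[OF m(1)] t(5)[OF k(3), unfolded comm(1)[OF m(1)]] h(8)[OF m(1)]]
        functor_square_inv[OF gpd(2,3) fct(2) o s(4)[OF k(2)] t(4)[OF h(13)[OF k(2)]] h(7)[OF k(2)]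
          s(6)[OF m(1)] t(6)[OF k(3), unfolded comm(2)[OF m(1)]] h(9)[OF m(1)]]
        jA[OF k(1)] jN[OF k(2)] jM[OF m(1)] m(2) comm(1,2)[OF m(1)] by simp
  qed
  moreover have "cmp (gI P) (isoT S (mapN ?j n')) (on_arr (tgt_f P) (natN ?j n')) =
        cmp (gI P) (natA ?j (tt T n')) (isoT T n')" if a: "n' \<in> nodes T" for n'
  proof -
    obtain n where n: "n \<in> nodes S" "n' = mapN h n" using cov(3)[OF a] by blast
    note k = p(6)[OF n(1)] h(13)[OF n(1)]
    show ?thesis
      using functor_square_inv[OF gpd(3,1) fct(3) s(4)[OF n(1)] t(4)[OF k(2)] h(7)[OF n(1)]
          s(2)[OF k(1)] t(2)[OF h(11)[OF k(1)]] h(5)[OF k(1)]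
          s(7)[OF n(1)] t(7)[OF k(2), unfolded comm(3)[OF n(1)]] h(10)[OF n(1)]]
        jA[OF k(1)] jN[OF n(1)] n(2) comm(3)[OF n(1)] by simp
  qed
  moreover have dm: "dm ?j = T" by (simp add: pinv_def)
  ultimately show "?j \<in> ptree_isos P T S"
    unfolding ptree_isos_iff[OF tT] iso_data_def by simp
  show "cmp (ptrees P) ?j h = idn (ptrees P) S"
    by (rule ptree_map_eqI) (use jA jM jN gA gM gN h(1) in \<open>simp_all add: compose_eq\<close>)
  show "cmp (ptrees P) h ?j = idn (ptrees P) T"
  proof (rule ptree_map_eqI, simp_all only: ptrees_simps dm extensional_map_cmp extensional_map_idn)
    fix x
    show "compose (edges T) (mapA h) (mapA ?j) x = restrict id (edges T) x \<and>
       (\<lambda>a\<in>edges T. cmp (gI P) (natA h (mapA ?j a)) (natA ?j a)) x = (\<lambda>a\<in>edges T. idn (gI P) (colA T a)) x" if "x \<in> edges T"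
      using cov(1)[OF that] jA gA that by (auto simp: compose_eq)
    show "compose (marks T) (mapM h) (mapM ?j) x = restrict id (marks T) x \<and>
       (\<lambda>a\<in>marks T. cmp (gE P) (natM h (mapM ?j a)) (natM ?j a)) x = (\<lambda>a\<in>marks T. idn (gE P) (colM T a)) x" if "x \<in> marks T"
      using cov(2)[OF that] jM gM that by (auto simp: compose_eq)
    show "compose (nodes T) (mapN h) (mapN ?j) x = restrict id (nodes T) x \<and>
       (\<lambda>a\<in>nodes T. cmp (gB P) (natN h (mapN ?j a)) (natN ?j a)) x = (\<lambda>a\<in>nodes T. idn (gB P) (colN T a)) x" if "x \<in> nodes T"
      using cov(3)[OF that] jN gN that by (auto simp: compose_eq)
  qed
qed

lemma idn_iso:
  assumes T: "is_ptree P T"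
  shows "idn (ptrees P) T \<in> ptree_isos P T T"
proof -
  note tT = ptreeD(1)[OF T]
  note q = pretreeD[OF is_treeD(1)[OF tT]]
  note t = ptreeD[OF T]
  note F = is_functorD(2)[OF fct(1)] is_functorD(2)[OF fct(2)] is_functorD(2)[OF fct(3)]
  note o = functor_square[OF T]
  have "tree_iso T T (restrict id (edges T)) (restrict id (marks T)) (restrict id (nodes T))"
    by (simp add: tree_iso_def q bij_betw_def)
  moreover have "cmp (gI P) (isoS T m) (on_arr (src_f P) (idn (gE P) (colM T m))) = cmp (gI P) (idn (gI P) (colA T (ts T m))) (isoS T m)"
     "cmp (gB P) (isoP T m) (on_arr (mid_f P) (idn (gE P) (colM T m))) = cmp (gB P) (idn (gB P) (colN T (tp T m))) (isoP T m)"
     if m: "m \<in> marks T" for m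
    using m groupoid_idl[OF gpd(1) o(1)[OF m] t(2)[OF q(4)[OF m]] t(5)[OF m]] groupoid_idr[OF gpd(1) o(1)[OF m] t(2)[OF q(4)[OF m]] t(5)[OF m]]
       groupoid_idl[OF gpd(3) o(2)[OF m] t(4)[OF q(5)[OF m]] t(6)[OF m]] groupoid_idr[OF gpd(3) o(2)[OF m] t(4)[OF q(5)[OF m]] t(6)[OF m]]
    by (simp_all add: F t)
  moreover have "cmp (gI P) (isoT T m) (on_arr (tgt_f P) (idn (gB P) (colN T m))) = cmp (gI P) (idn (gI P) (colA T (tt T m))) (isoT T m)"
     if m: "m \<in> nodes T" for m
    using m groupoid_idl[OF gpd(1) o(3)[OF m] t(2)[OF q(6)[OF m]] t(7)[OF m]] groupoid_idr[OF gpd(1) o(3)[OF m] t(2)[OF q(6)[OF m]] t(7)[OF m]]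
    by (simp_all add: F t)
  ultimately show ?thesis
    using groupoid_idn[OF gpd(1)] groupoid_idn[OF gpd(2)] groupoid_idn[OF gpd(3)] t(2-4)
    unfolding ptree_isos_iff[OF tT] iso_data_def by (simp add: q)
qed

lemma cmp_assoc:
  assumes "is_ptree P W" "is_ptree P S" "is_ptree P T" "is_ptree P T'"
    "f \<in> ptree_isos P W (restr S A M N)" "A \<subseteq> edges S" "M \<subseteq> marks S" "N \<subseteq> nodes S"
    "g \<in> ptree_isos P S T" "h \<in> ptree_isos P T T'"
  shows "cmp (ptrees P) h (cmp (ptrees P) g f) = cmp (ptrees P) (cmp (ptrees P) h g) f"
proof -
  note f = isoD[OF ptreeD(1)[OF assms(1)] assms(5), simplified]
  note g = isoD[OF ptreeD(1)[OF assms(2)] assms(9)]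
  note h = isoD[OF ptreeD(1)[OF assms(3)] assms(10)]
  note w = ptreeD[OF assms(1)] note s = ptreeD[OF assms(2)]
  note t = ptreeD[OF assms(3)] note t' = ptreeD[OF assms(4)]
  have A: "a \<in> edges W \<Longrightarrow> mapA f a \<in> edges S" and M: "m \<in> marks W \<Longrightarrow> mapM f m \<in> marks S"
    and N: "n \<in> nodes W \<Longrightarrow> mapN f n \<in> nodes S" for a m n
    using f(11-13) assms(6-8) by blast+
  show ?thesis
  proof (rule ptree_map_eqI)
    fix x assume "x \<in> edges (dm (cmp (ptrees P) h (cmp (ptrees P) g f)))"
    then have x: "x \<in> edges W" by (simp add: f)
    then show "mapA (cmp (ptrees P) h (cmp (ptrees P) g f)) x = mapA (cmp (ptrees P) (cmp (ptrees P) h g) f) x \<and>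
      natA (cmp (ptrees P) h (cmp (ptrees P) g f)) x = natA (cmp (ptrees P) (cmp (ptrees P) h g) f) x"
      using groupoid_assoc[OF gpd(1) w(2) s(2) t(2) t'(2) f(5) g(5) h(5)] A g(11) h(11)
      by (simp add: f(1) g(1) compose_eq)
  next
    fix x assume "x \<in> marks (dm (cmp (ptrees P) h (cmp (ptrees P) g f)))"
    then have x: "x \<in> marks W" by (simp add: f)
    then show "mapM (cmp (ptrees P) h (cmp (ptrees P) g f)) x = mapM (cmp (ptrees P) (cmp (ptrees P) h g) f) x \<and>
      natM (cmp (ptrees P) h (cmp (ptrees P) g f)) x = natM (cmp (ptrees P) (cmp (ptrees P) h g) f) x"
      using groupoid_assoc[OF gpd(2) w(3) s(3) t(3) t'(3) f(6) g(6) h(6)] M g(12) h(12)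
      by (simp add: f(1) g(1) compose_eq)
  next
    fix x assume "x \<in> nodes (dm (cmp (ptrees P) h (cmp (ptrees P) g f)))"
    then have x: "x \<in> nodes W" by (simp add: f)
    then show "mapN (cmp (ptrees P) h (cmp (ptrees P) g f)) x = mapN (cmp (ptrees P) (cmp (ptrees P) h g) f) x \<and>
      natN (cmp (ptrees P) h (cmp (ptrees P) g f)) x = natN (cmp (ptrees P) (cmp (ptrees P) h g) f) x"
      using groupoid_assoc[OF gpd(3) w(4) s(4) t(4) t'(4) f(7) g(7) h(7)] N g(13) h(13)
      by (simp add: f(1) g(1) compose_eq)
  qed (simp_all)
qed

lemma cmp_idn:
  assumes "is_ptree P S" "is_ptree P T" "f \<in> ptree_isos P S T"
  shows "cmp (ptrees P) f (idn (ptrees P) S) = f" "cmp (ptrees P) (idn (ptrees P) T) f = f"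
proof -
  note f = isoD[OF ptreeD(1)[OF assms(1)] assms(3)]
  note s = ptreeD[OF assms(1)] note t = ptreeD[OF assms(2)]
  show "cmp (ptrees P) f (idn (ptrees P) S) = f"
    by (rule ptree_map_eqI)
      (use f(1,2) groupoid_idr[OF gpd(1) s(2) t(2) f(5)] groupoid_idr[OF gpd(2) s(3) t(3) f(6)] groupoid_idr[OF gpd(3) s(4) t(4) f(7)] f(11-13)
        in \<open>simp_all add: compose_eq\<close>)
  show "cmp (ptrees P) (idn (ptrees P) T) f = f"
    by (rule ptree_map_eqI)
      (use f(1,2) groupoid_idl[OF gpd(1) s(2) t(2) f(5)] groupoid_idl[OF gpd(2) s(3) t(3) f(6)] groupoid_idl[OF gpd(3) s(4) t(4) f(7)] f(11-13)
        in \<open>simp_all add: compose_eq\<close>)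
qed

lemma ptrees_groupoid: "is_groupoid (ptrees P)"
  unfolding is_groupoid_def
proof (intro conjI ballI)
  fix w x y z f g h
  assume "w \<in> obs (ptrees P)" "x \<in> obs (ptrees P)" "y \<in> obs (ptrees P)" "z \<in> obs (ptrees P)"
    "f \<in> hom (ptrees P) w x" "g \<in> hom (ptrees P) x y" "h \<in> hom (ptrees P) y z"
  then show "cmp (ptrees P) h (cmp (ptrees P) g f) = cmp (ptrees P) (cmp (ptrees P) h g) f"
    using cmp_assoc[where W = w and S = x and T = y and T' = z and f = f and g = g and h = h
        and A = "edges x" and M = "marks x" and N = "nodes x"] by simp
next
  fix x y f assume "x \<in> obs (ptrees P)" "y \<in> obs (ptrees P)" "f \<in> hom (ptrees P) x y"
  then show "\<exists>g\<in>hom (ptrees P) y x. cmp (ptrees P) g f = idn (ptrees P) x \<and> cmp (ptrees P) f g = idn (ptrees P) y"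
    using pinv_inverse[of x y f] by (intro bexI[of _ "pinv P x y f"]) auto
qed (use idn_iso iso_cmp_full cmp_idn in \<open>auto 0 3\<close>)

end

section \<open>Grafting\<close>

text \<open>The single equivalence \<open>compat\<close> bundles three conditions: injectivity on
  each piece, agreement of the maps where pieces overlap, and no collision between images of
  different points from different pieces.\<close>

lemma bij_betw_glue:
  assumes "\<And>i. i \<in> J \<Longrightarrow> bij_betw (f i) (A i) (A' i)"
    and compat: "\<And>i j x y. i \<in> J \<Longrightarrow> j \<in> J \<Longrightarrow> x \<in> A i \<Longrightarrow> y \<in> A j \<Longrightarrow> f i x = f j y \<longleftrightarrow> x = y"
    and F: "\<And>i x. i \<in> J \<Longrightarrow> x \<in> A i \<Longrightarrow> F x = f i x"
  shows "bij_betw F (\<Union>i\<in>J. A i) (\<Union>i\<in>J. A' i)"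
proof -
  have "F ` A i = A' i" if "i \<in> J" for i
    using assms(1)[OF that] F[OF that] unfolding bij_betw_def by (metis image_cong)
  then have "F ` (\<Union>i\<in>J. A i) = (\<Union>i\<in>J. A' i)" by (simp add: image_UN)
  moreover have "inj_on F (\<Union>i\<in>J. A i)"
    using compat F by (fastforce intro!: inj_onI)
  ultimately show ?thesis by (simp add: bij_betw_def)
qed

lemma restr_select:
  fixes Q T :: "('i, 'ia, 'e, 'b, 'ba) ptree"
  assumes "Q = restr T A M N"
  shows "ts Q = ts T" "tp Q = tp T" "tt Q = tt T" "colA Q = colA T" "colM Q = colM T" "colN Q = colN T"
    "isoS Q = isoS T" "isoP Q = isoP T" "isoT Q = isoT T"
  using assms by simp_all

context polynomial_diagram begin

text \<open>Every condition on an isomorphism involves one mark or one node together with the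
  adjacent edges. Since each piece is a tree, all of these lie in a single piece, where the
  condition is inherited from \<open>u i\<close>.\<close>

lemma glue_isos:
  assumes T: "is_ptree P T" and T': "is_ptree P T'"
    and Q: "\<And>i. i \<in> J \<Longrightarrow> is_tree (Q i) \<and> Q i = restr T (edges (Q i)) (marks (Q i)) (nodes (Q i))"
    and Q': "\<And>i. i \<in> J \<Longrightarrow> Q' i = restr T' (edges (Q' i)) (marks (Q' i)) (nodes (Q' i))"
    and u: "\<And>i. i \<in> J \<Longrightarrow> u i \<in> ptree_isos P (Q i) (Q' i)"
    and cov: "edges T = (\<Union>i\<in>J. edges (Q i))" "marks T = (\<Union>i\<in>J. marks (Q i))" "nodes T = (\<Union>i\<in>J. nodes (Q i))"
    and cov': "edges T' = (\<Union>i\<in>J. edges (Q' i))" "marks T' = (\<Union>i\<in>J. marks (Q' i))" "nodes T' = (\<Union>i\<in>J. nodes (Q' i))"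
    and A: "\<And>i j x y. i \<in> J \<Longrightarrow> j \<in> J \<Longrightarrow> x \<in> edges (Q i) \<Longrightarrow> y \<in> edges (Q j) \<Longrightarrow>
        mapA (u i) x = mapA (u j) y \<longleftrightarrow> x = y"
    and M: "\<And>i j x y. i \<in> J \<Longrightarrow> j \<in> J \<Longrightarrow> x \<in> marks (Q i) \<Longrightarrow> y \<in> marks (Q j) \<Longrightarrow>
        mapM (u i) x = mapM (u j) y \<longleftrightarrow> x = y"
    and N: "\<And>i j x y. i \<in> J \<Longrightarrow> j \<in> J \<Longrightarrow> x \<in> nodes (Q i) \<Longrightarrow> y \<in> nodes (Q j) \<Longrightarrow>
        mapN (u i) x = mapN (u j) y \<longleftrightarrow> x = y"
    and nat: "\<And>i j x. i \<in> J \<Longrightarrow> j \<in> J \<Longrightarrow> x \<in> edges (Q i) \<Longrightarrow> x \<in> edges (Q j) \<Longrightarrow> natA (u i) x = natA (u j) x"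
      "\<And>i j x. i \<in> J \<Longrightarrow> j \<in> J \<Longrightarrow> x \<in> marks (Q i) \<Longrightarrow> x \<in> marks (Q j) \<Longrightarrow> natM (u i) x = natM (u j) x"
      "\<And>i j x. i \<in> J \<Longrightarrow> j \<in> J \<Longrightarrow> x \<in> nodes (Q i) \<Longrightarrow> x \<in> nodes (Q j) \<Longrightarrow> natN (u i) x = natN (u j) x"
  shows "\<exists>w\<in>ptree_isos P T T'. \<forall>i\<in>J.
     (\<forall>x\<in>edges (Q i). mapA w x = mapA (u i) x \<and> natA w x = natA (u i) x) \<and>
     (\<forall>x\<in>marks (Q i). mapM w x = mapM (u i) x \<and> natM w x = natM (u i) x) \<and>
     (\<forall>x\<in>nodes (Q i). mapN w x = mapN (u i) x \<and> natN w x = natN (u i) x)"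
proof -
  \<comment> \<open>Any piece containing \<open>x\<close> will do, because the maps agree on
    overlaps.\<close>
  define iA iM iN where "iA = (\<lambda>x. SOME i. i \<in> J \<and> x \<in> edges (Q i))"
    and "iM = (\<lambda>x. SOME i. i \<in> J \<and> x \<in> marks (Q i))" and "iN = (\<lambda>x. SOME i. i \<in> J \<and> x \<in> nodes (Q i))"
  have iA: "iA x \<in> J \<and> x \<in> edges (Q (iA x))" if "i \<in> J" "x \<in> edges (Q i)" for x i
    unfolding iA_def by (rule someI_ex) (use that in blast)
  have iM: "iM x \<in> J \<and> x \<in> marks (Q (iM x))" if "i \<in> J" "x \<in> marks (Q i)" for x i
    unfolding iM_def by (rule someI_ex) (use that in blast)
  have iN: "iN x \<in> J \<and> x \<in> nodes (Q (iN x))" if "i \<in> J" "x \<in> nodes (Q i)" for x i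
    unfolding iN_def by (rule someI_ex) (use that in blast)
  define w where "w = \<lparr>dm = T, mapA = restrict (\<lambda>x. mapA (u (iA x)) x) (edges T),
     mapM = restrict (\<lambda>x. mapM (u (iM x)) x) (marks T), mapN = restrict (\<lambda>x. mapN (u (iN x)) x) (nodes T),
     natA = restrict (\<lambda>x. natA (u (iA x)) x) (edges T),
     natM = restrict (\<lambda>x. natM (u (iM x)) x) (marks T), natN = restrict (\<lambda>x. natN (u (iN x)) x) (nodes T)\<rparr>"
  have wA: "mapA w x = mapA (u i) x \<and> natA w x = natA (u i) x" if "i \<in> J" "x \<in> edges (Q i)" for i x
  proof -
    have "x \<in> edges T" using that cov(1) by blast
    with A[of i "iA x" x x] nat(1)[of i "iA x" x] iA[OF that] that show ?thesis by (simp add: w_def)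
  qed
  have wM: "mapM w x = mapM (u i) x \<and> natM w x = natM (u i) x" if "i \<in> J" "x \<in> marks (Q i)" for i x
  proof -
    have "x \<in> marks T" using that cov(2) by blast
    with M[of i "iM x" x x] nat(2)[of i "iM x" x] iM[OF that] that show ?thesis by (simp add: w_def)
  qed
  have wN: "mapN w x = mapN (u i) x \<and> natN w x = natN (u i) x" if "i \<in> J" "x \<in> nodes (Q i)" for i x
  proof -
    have "x \<in> nodes T" using that cov(3) by blast
    with N[of i "iN x" x x] nat(3)[of i "iN x" x] iN[OF that] that show ?thesis by (simp add: w_def)
  qed
  have sel: "ts (Q i) = ts T" "tp (Q i) = tp T" "tt (Q i) = tt T" "colA (Q i) = colA T" "colM (Q i) = colM T"
     "colN (Q i) = colN T" "isoS (Q i) = isoS T" "isoP (Q i) = isoP T" "isoT (Q i) = isoT T"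
     "ts (Q' i) = ts T'" "tp (Q' i) = tp T'" "tt (Q' i) = tt T'" "colA (Q' i) = colA T'" "colM (Q' i) = colM T'"
     "colN (Q' i) = colN T'" "isoS (Q' i) = isoS T'" "isoP (Q' i) = isoP T'" "isoT (Q' i) = isoT T'"
    if "i \<in> J" for i
    using restr_select[OF Q[OF that, THEN conjunct2]] restr_select[OF Q'[OF that]] by simp_all
  note v = isoD[OF Q[THEN conjunct1] u]
  have v4: "bij_betw (mapA (u i)) (edges (Q i)) (edges (Q' i))" "bij_betw (mapM (u i)) (marks (Q i)) (marks (Q' i))"
      "bij_betw (mapN (u i)) (nodes (Q i)) (nodes (Q' i))"
      "\<And>m. m \<in> marks (Q i) \<Longrightarrow> mapA (u i) (ts T m) = ts T' (mapM (u i) m) \<and> mapN (u i) (tp T m) = tp T' (mapM (u i) m)"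
      "\<And>n. n \<in> nodes (Q i) \<Longrightarrow> mapA (u i) (tt T n) = tt T' (mapN (u i) n)" if "i \<in> J" for i
    using v(4)[OF that that] sel[OF that] by (auto simp: tree_iso_def)
  have q: "m \<in> marks (Q i) \<Longrightarrow> ts T m \<in> edges (Q i)" "m \<in> marks (Q i) \<Longrightarrow> tp T m \<in> nodes (Q i)"
       "n \<in> nodes (Q i) \<Longrightarrow> tt T n \<in> edges (Q i)" if "i \<in> J" for i m n
    using pretreeD(4-6)[OF is_treeD(1)[OF Q[OF that, THEN conjunct1]]] by (simp_all add: sel[OF that])
  have "bij_betw (mapA w) (edges T) (edges T')" unfolding cov(1) cov'(1)
    by (rule bij_betw_glue[where f = "\<lambda>i. mapA (u i)"]) (use v4(1) A wA in auto)
  moreover have "bij_betw (mapM w) (marks T) (marks T')" unfolding cov(2) cov'(2)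
    by (rule bij_betw_glue[where f = "\<lambda>i. mapM (u i)"]) (use v4(2) M wM in auto)
  moreover have "bij_betw (mapN w) (nodes T) (nodes T')" unfolding cov(3) cov'(3)
    by (rule bij_betw_glue[where f = "\<lambda>i. mapN (u i)"]) (use v4(3) N wN in auto)
  moreover have "mapA w (ts T m) = ts T' (mapM w m) \<and> mapN w (tp T m) = tp T' (mapM w m)" if m: "m \<in> marks T" for m
  proof -
    obtain i where i: "i \<in> J" "m \<in> marks (Q i)" using m cov(2) by blast
    show ?thesis using wA[OF i(1) q(1)[OF i]] wM[OF i] wN[OF i(1) q(2)[OF i]] v4(4)[OF i] by simp
  qed
  moreover have "mapA w (tt T n) = tt T' (mapN w n)" if n: "n \<in> nodes T" for n
  proof -
    obtain i where i: "i \<in> J" "n \<in> nodes (Q i)" using n cov(3) by blast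
    show ?thesis using wA[OF i(1) q(3)[OF i]] wN[OF i] v4(5)[OF i] by simp
  qed
  ultimately have "tree_iso T T' (mapA w) (mapM w) (mapN w)" by (simp add: tree_iso_def)
  moreover have "natA w a \<in> hom (gI P) (colA T a) (colA T' (mapA w a))" if a: "a \<in> edges T" for a
  proof -
    obtain i where i: "i \<in> J" "a \<in> edges (Q i)" using a cov(1) by blast
    show ?thesis using wA[OF i] v(5)[OF i(1) i(1) i(2)] sel[OF i(1)] by simp
  qed
  moreover have "natM w m \<in> hom (gE P) (colM T m) (colM T' (mapM w m)) \<and>
      cmp (gI P) (isoS T' (mapM w m)) (on_arr (src_f P) (natM w m)) =
        cmp (gI P) (natA w (ts T m)) (isoS T m) \<and>
      cmp (gB P) (isoP T' (mapM w m)) (on_arr (mid_f P) (natM w m)) =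
        cmp (gB P) (natN w (tp T m)) (isoP T m)" if m: "m \<in> marks T" for m
  proof -
    obtain i where i: "i \<in> J" "m \<in> marks (Q i)" using m cov(2) by blast
    show ?thesis using wM[OF i] wA[OF i(1) q(1)[OF i]] wN[OF i(1) q(2)[OF i]]
        v(6,8,9)[OF i(1) i(1) i(2)] sel[OF i(1)] by simp
  qed
  moreover have "natN w n \<in> hom (gB P) (colN T n) (colN T' (mapN w n)) \<and>
      cmp (gI P) (isoT T' (mapN w n)) (on_arr (tgt_f P) (natN w n)) =
        cmp (gI P) (natA w (tt T n)) (isoT T n)" if n: "n \<in> nodes T" for n
  proof -
    obtain i where i: "i \<in> J" "n \<in> nodes (Q i)" using n cov(3) by blast
    show ?thesis using wN[OF i] wA[OF i(1) q(3)[OF i]] v(7,10)[OF i(1) i(1) i(2)] sel[OF i(1)] by simp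
  qed
  moreover have "dm w = T" "extensional_map w" by (simp_all add: w_def extensional_map_def)
  ultimately have "w \<in> ptree_isos P T T'"
    unfolding ptree_isos_iff[OF ptreeD(1)[OF T]] iso_data_def by blast
  then show ?thesis using wA wM wN by blast
qed

end

section \<open>Graftings, gluing data and the action of isomorphisms\<close>

locale grafting = polynomial_diagram P for P :: "('i, 'ia, 'e, 'ea, 'b, 'ba) poly_diagram" +
  fixes S0 :: "('i, 'ia, 'e, 'b, 'ba) ptree" and D :: "nat \<Rightarrow> ('i, 'ia, 'e, 'b, 'ba) ptree"
  assumes S0: "is_ptree P S0" and D: "\<And>l. l \<in> leaves S0 \<Longrightarrow> is_ptree P (D l)"
begin

definition graftings where
  "graftings T = {(S, h, k). S \<in> cuts T \<and> h \<in> ptree_isos P S0 S \<and>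
     k \<in> (\<Pi>\<^sub>E l\<in>leaves S0. ptree_isos P (D l) (ideal_subtree T (mapA h l)))}"

text \<open>Both \<open>h\<close> and \<open>k l\<close> carry a colour to that of the edge
  \<open>mapA h l\<close> of the big tree, one from the leaf \<open>l\<close>, the other from the
  root of \<open>D l\<close>; \<open>\<phi> l\<close> is the difference of these two
  isomorphisms.\<close>

definition glues ::
    "(nat \<Rightarrow> 'ia) \<Rightarrow> ('i, 'ia, 'e, 'b, 'ba) ptree \<times> ('i, 'ia, 'e, 'ea, 'b, 'ba) ptree_map \<times>
       (nat \<Rightarrow> ('i, 'ia, 'e, 'ea, 'b, 'ba) ptree_map) \<Rightarrow> bool" where
  "glues \<phi> = (\<lambda>(S, h, k). \<forall>l\<in>leaves S0. cmp (gI P) (natA h l) (\<phi> l) = natA (k l) (root (D l)))"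

definition gluing_data where
  "gluing_data = (\<Pi>\<^sub>E l\<in>leaves S0. hom (gI P) (colA (D l) (root (D l))) (colA S0 l))"

text \<open>The target \<open>T'\<close> is passed explicitly because a map records only its source,
  and the image of the cut has to be formed with the structure maps of \<open>T'\<close>.\<close>

definition act ::
    "('i, 'ia, 'e, 'ea, 'b, 'ba) ptree_map \<Rightarrow> ('i, 'ia, 'e, 'b, 'ba) ptree \<Rightarrow>
     ('i, 'ia, 'e, 'b, 'ba) ptree \<times> ('i, 'ia, 'e, 'ea, 'b, 'ba) ptree_map \<times>
       (nat \<Rightarrow> ('i, 'ia, 'e, 'ea, 'b, 'ba) ptree_map) \<Rightarrow>
     ('i, 'ia, 'e, 'b, 'ba) ptree \<times> ('i, 'ia, 'e, 'ea, 'b, 'ba) ptree_map \<times>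
       (nat \<Rightarrow> ('i, 'ia, 'e, 'ea, 'b, 'ba) ptree_map)" where
  "act u T' = (\<lambda>(S, h, k). (restr T' (mapA u ` edges S) (mapM u ` marks S) (mapN u ` nodes S),
     cmp (ptrees P) u h, restrict (\<lambda>l. cmp (ptrees P) u (k l)) (leaves S0)))"

lemmas tS0 = ptreeD(1)[OF S0]
lemmas p0 = pretreeD[OF is_treeD(1)[OF tS0]]

lemma leaf0: "l \<in> leaves S0 \<Longrightarrow> l \<in> edges S0" by (simp add: leaves_def)

lemmas rootD = root_edge[OF D]
lemmas finite_leaves0 = finite_leaves[OF S0]

end

locale grafted = grafting P S0 D for P :: "('i, 'ia, 'e, 'ea, 'b, 'ba) poly_diagram" and S0 D +
  fixes T S :: "('i, 'ia, 'e, 'b, 'ba) ptree" and h k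
  assumes T: "is_ptree P T" and y: "(S, h, k) \<in> graftings T"
begin

lemma cut: "S \<in> cuts T" and h: "h \<in> ptree_isos P S0 S"
  and k: "l \<in> leaves S0 \<Longrightarrow> k l \<in> ptree_isos P (D l) (ideal_subtree T (mapA h l))"
  and kext: "k \<in> extensional (leaves S0)"
  using y by (auto simp: graftings_def PiE_iff)

sublocale C: tree_cut T S using ptreeD(1)[OF T] cut by unfold_locales

lemmas tT = ptreeD(1)[OF T]
lemmas hD = isoD[OF tS0 h]
lemmas S_ptree = cut_ptree[OF T cut]

sublocale H: tree_isomorphism S0 S "mapA h" "mapM h" "mapN h"
  using tS0 hD(4) by unfold_locales

lemma leaf: "l \<in> leaves S0 \<Longrightarrow> mapA h l \<in> leaves S" using H.leaves by simp

lemma leafT: "l \<in> leaves S0 \<Longrightarrow> mapA h l \<in> edges T" using leaf C.leaf_edge by simp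

lemma colS: "colA S = colA T" "colM S = colM T" "colN S = colN T" "isoS S = isoS T" "isoP S = isoP T" "isoT S = isoT T"
  by (rule restr_select[OF C.c(6)])+

abbreviation "crown_tree l \<equiv> ideal_subtree T (mapA h l)"

lemmas ideal = ideal_subtree_eq[OF tT leafT]
lemmas ideal_pt = ideal_ptree[OF T leafT]
lemmas ideal_root = ideal_subtree_tree(2)[OF tT leafT]

lemma kD: assumes "l \<in> leaves S0"
  shows "tree_isomorphism (D l) (crown_tree l) (mapA (k l)) (mapM (k l)) (mapN (k l))"
  using isoD(4)[OF ptreeD(1)[OF D[OF assms]] k[OF assms]] ptreeD(1)[OF D[OF assms]] by unfold_locales

lemma k_root: "l \<in> leaves S0 \<Longrightarrow> mapA (k l) (root (D l)) = mapA h l"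
  using tree_isomorphism.root[OF kD] ideal_root by simp

lemma h_nat: "l \<in> leaves S0 \<Longrightarrow> natA h l \<in> hom (gI P) (colA S0 l) (colA T (mapA h l))"
  using hD(5)[OF leaf0] colS by simp

lemma k_nat: assumes "l \<in> leaves S0"
  shows "natA (k l) (root (D l)) \<in> hom (gI P) (colA (D l) (root (D l))) (colA T (mapA h l))"
  using isoD(5)[OF ptreeD(1)[OF D[OF assms]] k[OF assms] rootD[OF assms]] k_root[OF assms] ideal[OF assms] by simp

text \<open>Here and for nodes and marks below: the cut and the ideal subtrees over its leaves are a
  cover. A mark belongs to the piece that contains its node.\<close>

lemma cov_edges: "x \<in> edges T \<longleftrightarrow> x \<in> edges S \<or> (\<exists>l\<in>leaves S0. x \<in> edges (crown_tree l))"
  using C.edge_cover[of x, unfolded H.leaves] C.c(3) above_edges[OF is_treeD(1)[OF tT] leafT] by (auto simp: ideal)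

lemma cov_nodes: "x \<in> nodes T \<longleftrightarrow> x \<in> nodes S \<or> (\<exists>l\<in>leaves S0. x \<in> nodes (crown_tree l))"
  using C.node_cover[of x, unfolded H.leaves] C.c(4) by (auto simp: ideal)

lemma cov_marks: "x \<in> marks T \<longleftrightarrow> x \<in> marks S \<or> (\<exists>l\<in>leaves S0. x \<in> marks (crown_tree l))"
  using C.node_cover[of "tp T x", unfolded H.leaves] C.p(5)[of x] by (auto simp: ideal C.c(5))

text \<open>The seam: the cut meets an ideal subtree in one edge only. All further overlaps are
  excluded below, so compatibility of piecewise maps has to be tested at these edges alone.\<close>

lemma overlap_edges: "x \<in> edges S \<Longrightarrow> x \<in> edges (crown_tree l) \<Longrightarrow> l \<in> leaves S0 \<Longrightarrow> x = mapA h l"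
  using C.edge_above_leaf leaf by (simp add: ideal)

lemma ideal_leaf: "l \<in> leaves S0 \<Longrightarrow> mapA h l \<in> edges (crown_tree l)"
  by (simp add: ideal above.base)

lemma overlap_nodes: "x \<in> nodes S \<Longrightarrow> l \<in> leaves S0 \<Longrightarrow> x \<notin> nodes (crown_tree l)"
  using C.node_above_leaf leaf by (simp add: ideal)

lemma overlap_marks: "x \<in> marks S \<Longrightarrow> l \<in> leaves S0 \<Longrightarrow> x \<notin> marks (crown_tree l)"
  using C.node_above_leaf leaf by (auto simp: ideal C.c(5))

lemma disjoint_ideals:
  assumes "l \<in> leaves S0" "l' \<in> leaves S0"
  shows "x \<in> edges (crown_tree l) \<Longrightarrow> x \<in> edges (crown_tree l') \<Longrightarrow> l = l'"
    "x \<in> nodes (crown_tree l) \<Longrightarrow> x \<in> nodes (crown_tree l') \<Longrightarrow> l = l'"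
    "x \<in> marks (crown_tree l) \<Longrightarrow> x \<in> marks (crown_tree l') \<Longrightarrow> l = l'"
proof -
  have "mapA h l = mapA h l' \<Longrightarrow> l = l'" using H.inj(1) assms leaf0 by (metis inj_onD)
  then show "x \<in> edges (crown_tree l) \<Longrightarrow> x \<in> edges (crown_tree l') \<Longrightarrow> l = l'"
    "x \<in> nodes (crown_tree l) \<Longrightarrow> x \<in> nodes (crown_tree l') \<Longrightarrow> l = l'"
    "x \<in> marks (crown_tree l) \<Longrightarrow> x \<in> marks (crown_tree l') \<Longrightarrow> l = l'"
    using C.above_leaf_unique[OF _ _ leaf[OF assms(1)] leaf[OF assms(2)]] by (auto simp: ideal assms)
qed

text \<open>Composition with \<open>natA h l\<close> is a bijection of hom-sets, so the defining
  equation has exactly one solution at each leaf; extensionality fixes the values elsewhere.\<close>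

lemma ex1_glues: "\<exists>!\<phi>. \<phi> \<in> gluing_data \<and> glues \<phi> (S, h, k)"
proof -
  let ?H = "\<lambda>l. hom (gI P) (colA (D l) (root (D l))) (colA S0 l)"
  have ex1: "\<exists>!f. f \<in> ?H l \<and> cmp (gI P) (natA h l) f = natA (k l) (root (D l))" if l: "l \<in> leaves S0" for l
  proof -
    have "bij_betw (cmp (gI P) (natA h l)) (?H l) (hom (gI P) (colA (D l) (root (D l))) (colA T (mapA h l)))"
      by (rule groupoid_bij_post[OF gpd(1) ptreeD(2)[OF D[OF l] rootD[OF l]] ptreeD(2)[OF S0 leaf0[OF l]]
        ptreeD(2)[OF T leafT[OF l]] h_nat[OF l]])
    then show ?thesis using k_nat[OF l] unfolding bij_betw_iff_bijections by metis
  qed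
  then obtain f where f: "\<And>l. l \<in> leaves S0 \<Longrightarrow> f l \<in> ?H l \<and> cmp (gI P) (natA h l) (f l) = natA (k l) (root (D l))"
    by metis
  show ?thesis
  proof (rule ex1I)
    show "restrict f (leaves S0) \<in> gluing_data \<and> glues (restrict f (leaves S0)) (S, h, k)"
      using f by (simp add: gluing_data_def glues_def PiE_iff)
    fix \<phi> assume a: "\<phi> \<in> gluing_data \<and> glues \<phi> (S, h, k)"
    show "\<phi> = restrict f (leaves S0)"
    proof (rule extensionalityI[of _ "leaves S0"])
      fix l assume l: "l \<in> leaves S0"
      then show "\<phi> l = restrict f (leaves S0) l"
        using ex1[OF l] f[OF l] a by (auto simp: gluing_data_def glues_def PiE_iff)
    qed (use a in \<open>auto simp: gluing_data_def PiE_iff\<close>)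
  qed
qed

text \<open>The gluing data are invariant because \<open>u\<close> changes both sides of the
  defining equation by the same factor, its colour component at the edge
  \<open>mapA h l\<close>.\<close>

lemma act_graftings:
  assumes T': "is_ptree P T'" and u: "u \<in> ptree_isos P T T'"
  shows "act u T' (S, h, k) \<in> graftings T'"
    "\<phi> \<in> gluing_data \<Longrightarrow> glues \<phi> (S, h, k) \<Longrightarrow> glues \<phi> (act u T' (S, h, k))"
proof -
  note uD = isoD[OF tT u]
  let ?R = "restr T' (mapA u ` edges S) (mapM u ` marks S) (mapN u ` nodes S)"
  have h': "h \<in> ptree_isos P S0 (restr T (edges S) (marks S) (nodes S))" using h by (simp only: C.c(6)[symmetric])
  have "marks S \<subseteq> marks T" using C.c(5) by blast
  then have 1: "cmp (ptrees P) u h \<in> ptree_isos P S0 ?R"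
    by (rule iso_cmp[OF S0 T T' h' C.c(3) _ C.c(4) u])
  have 2: "cmp (ptrees P) u (k l) \<in> ptree_isos P (D l) (ideal_subtree T' (mapA u (mapA h l)))" if l: "l \<in> leaves S0" for l
  proof -
    let ?I = "ideal_subtree T (mapA h l)"
    have "k l \<in> ptree_isos P (D l) (restr T (edges ?I) (marks ?I) (nodes ?I))"
      using k[OF l] unfolding ideal[OF l] by simp
    moreover have "edges ?I \<subseteq> edges T" "marks ?I \<subseteq> marks T" "nodes ?I \<subseteq> nodes T"
      using cov_edges cov_marks cov_nodes l by blast+
    \<comment> \<open>The ideal subtree of \<open>T'\<close> is rewritten as the image under
      \<open>u\<close> of the one in \<open>T\<close>, which is the target that
      \<open>iso_cmp\<close> produces.\<close>
    ultimately show ?thesis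
      unfolding tree_iso_ideal[OF tT uD(4) leafT[OF l]] using iso_cmp[OF D[OF l] T T' _ _ _ _ u] by blast
  qed
  have e: "mapA (cmp (ptrees P) u h) l = mapA u (mapA h l)"
     "natA (cmp (ptrees P) u h) l = cmp (gI P) (natA u (mapA h l)) (natA h l)" if "l \<in> leaves S0" for l
    using leaf0[OF that] by (simp_all add: hD(1) compose_eq)
  show "act u T' (S, h, k) \<in> graftings T'"
    using 1 2 tree_iso_cut[OF tT uD(4) cut] e by (simp add: act_def graftings_def PiE_iff)
  assume \<phi>: "\<phi> \<in> gluing_data" "glues \<phi> (S, h, k)"
  show "glues \<phi> (act u T' (S, h, k))"
    unfolding glues_def act_def
  proof (clarsimp simp del: ptrees_simps)
    fix l assume l: "l \<in> leaves S0"
    have "\<phi> l \<in> hom (gI P) (colA (D l) (root (D l))) (colA S0 l)" using \<phi>(1) l by (auto simp: gluing_data_def)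
    then have "cmp (gI P) (cmp (gI P) (natA u (mapA h l)) (natA h l)) (\<phi> l) =
      cmp (gI P) (natA u (mapA h l)) (cmp (gI P) (natA h l) (\<phi> l))"
      using groupoid_assoc[OF gpd(1) ptreeD(2)[OF D[OF l] rootD[OF l]] ptreeD(2)[OF S0 leaf0[OF l]]
        ptreeD(2)[OF T leafT[OF l]] ptreeD(2)[OF T' uD(11)[OF leafT[OF l]]] _ h_nat[OF l] uD(5)[OF leafT[OF l]]] by simp
    also have "\<dots> = cmp (gI P) (natA u (mapA h l)) (natA (k l) (root (D l)))" using \<phi>(2) l by (simp add: glues_def)
    finally show "cmp (gI P) (natA (cmp (ptrees P) u h) l) (\<phi> l) = natA (cmp (ptrees P) u (k l)) (root (D l))"
      using e(2)[OF l] rootD[OF l] k_root[OF l] isoD(1)[OF ptreeD(1)[OF D[OF l]] k[OF l]] by simp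
  qed
qed

end

lemma groupoid_cancel_right:
  assumes "is_groupoid G" "x \<in> obs G" "y \<in> obs G" "z \<in> obs G" "u \<in> hom G x y"
    "f \<in> hom G y z" "g \<in> hom G y z" "cmp G f u = cmp G g u"
  shows "f = g"
  using groupoid_bij_pre[OF assms(1-5)] assms(6-8) by (metis bij_betw_inv_into_left)

context polynomial_diagram begin

lemma cmp_eq_on_piece:
  assumes W: "is_ptree P W" and h: "h \<in> ptree_isos P W Q"
    and "\<And>x. x \<in> edges Q \<Longrightarrow> mapA u x = mapA v x \<and> natA u x = natA v x"
    "\<And>x. x \<in> marks Q \<Longrightarrow> mapM u x = mapM v x \<and> natM u x = natM v x"
    "\<And>x. x \<in> nodes Q \<Longrightarrow> mapN u x = mapN v x \<and> natN u x = natN v x"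
  shows "cmp (ptrees P) u h = cmp (ptrees P) v h"
  by (rule ptree_map_eqI)
    (use assms(3-5) isoD(1,11-13)[OF ptreeD(1)[OF W] h] in \<open>simp_all add: compose_eq\<close>)

text \<open>The map \<open>h\<close> is onto the piece and its decoration components are invertible,
  so it can be cancelled on the right, but only over that piece.\<close>

lemma eq_on_piece_if_cmp:
  assumes W: "is_ptree P W" and T: "is_ptree P T" and T': "is_ptree P T'"
    and h: "h \<in> ptree_isos P W (restr T A M N)" and sub: "A \<subseteq> edges T" "M \<subseteq> marks T" "N \<subseteq> nodes T"
    and u: "u \<in> ptree_isos P T T'" and v: "v \<in> ptree_isos P T T'"
    and eq: "cmp (ptrees P) u h = cmp (ptrees P) v h"
  shows "x \<in> A \<Longrightarrow> mapA u x = mapA v x \<and> natA u x = natA v x"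
    "x \<in> M \<Longrightarrow> mapM u x = mapM v x \<and> natM u x = natM v x"
    "x \<in> N \<Longrightarrow> mapN u x = mapN v x \<and> natN u x = natN v x"
proof -
  note hD = isoD[OF ptreeD(1)[OF W] h, simplified]
  note uD = isoD[OF ptreeD(1)[OF T] u] and vD = isoD[OF ptreeD(1)[OF T] v]
  note w = ptreeD[OF W] and t = ptreeD[OF T] and t' = ptreeD[OF T']
  have b: "mapA h ` edges W = A" "mapM h ` marks W = M" "mapN h ` nodes W = N"
    using hD(4) by (auto simp: tree_iso_def bij_betw_def)
  show "mapA u x = mapA v x \<and> natA u x = natA v x" if "x \<in> A"
  proof -
    from that[folded b(1)] obtain a where a: "a \<in> edges W" "x = mapA h a" by blast
    have x: "x \<in> edges T" using that sub by blast
    have 1: "mapA u x = mapA v x"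
      using arg_cong[OF eq, of "\<lambda>f. mapA f a"] a by (simp add: hD(1) compose_eq)
    have 2: "cmp (gI P) (natA u x) (natA h a) = cmp (gI P) (natA v x) (natA h a)"
      using arg_cong[OF eq, of "\<lambda>f. natA f a"] a by (simp add: hD(1))
    show ?thesis using 1
        groupoid_cancel_right[OF gpd(1) w(2)[OF a(1)] t(2)[OF x] t'(2)[OF uD(11)[OF x]] hD(5)[OF a(1), folded a(2)] uD(5)[OF x] _ 2]
        vD(5)[OF x] by simp
  qed
  show "mapM u x = mapM v x \<and> natM u x = natM v x" if "x \<in> M"
  proof -
    from that[folded b(2)] obtain a where a: "a \<in> marks W" "x = mapM h a" by blast
    have x: "x \<in> marks T" using that sub by blast
    have 1: "mapM u x = mapM v x"
      using arg_cong[OF eq, of "\<lambda>f. mapM f a"] a by (simp add: hD(1) compose_eq)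
    have 2: "cmp (gE P) (natM u x) (natM h a) = cmp (gE P) (natM v x) (natM h a)"
      using arg_cong[OF eq, of "\<lambda>f. natM f a"] a by (simp add: hD(1))
    show ?thesis using 1
        groupoid_cancel_right[OF gpd(2) w(3)[OF a(1)] t(3)[OF x] t'(3)[OF uD(12)[OF x]] hD(6)[OF a(1), folded a(2)] uD(6)[OF x] _ 2]
        vD(6)[OF x] by simp
  qed
  show "mapN u x = mapN v x \<and> natN u x = natN v x" if "x \<in> N"
  proof -
    from that[folded b(3)] obtain a where a: "a \<in> nodes W" "x = mapN h a" by blast
    have x: "x \<in> nodes T" using that sub by blast
    have 1: "mapN u x = mapN v x"
      using arg_cong[OF eq, of "\<lambda>f. mapN f a"] a by (simp add: hD(1) compose_eq)
    have 2: "cmp (gB P) (natN u x) (natN h a) = cmp (gB P) (natN v x) (natN h a)"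
      using arg_cong[OF eq, of "\<lambda>f. natN f a"] a by (simp add: hD(1))
    show ?thesis using 1
        groupoid_cancel_right[OF gpd(3) w(4)[OF a(1)] t(4)[OF x] t'(4)[OF uD(13)[OF x]] hD(7)[OF a(1), folded a(2)] uD(7)[OF x] _ 2]
        vD(7)[OF x] by simp
  qed
qed

end

context grafted begin

text \<open>Freeness of the action: the composites with \<open>h\<close> and with the
  \<open>k l\<close> determine \<open>u\<close> on every piece, and the pieces cover
  \<open>T\<close>.\<close>

lemma act_inj:
  assumes T': "is_ptree P T'" and u: "u \<in> ptree_isos P T T'" and v: "v \<in> ptree_isos P T T'"
    and eq: "act u T' (S, h, k) = act v T' (S, h, k)"
  shows "u = v"
proof -
  note uD = isoD[OF tT u] and vD = isoD[OF tT v]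
  have h': "h \<in> ptree_isos P S0 (restr T (edges S) (marks S) (nodes S))" using h by (simp only: C.c(6)[symmetric])
  have mS: "marks S \<subseteq> marks T" using C.c(5) by blast
  have 1: "cmp (ptrees P) u h = cmp (ptrees P) v h" using eq by (simp add: act_def)
  note S = eq_on_piece_if_cmp[OF S0 T T' h' C.c(3) mS C.c(4) u v 1]
  have I: "x \<in> edges (ideal_subtree T (mapA h l)) \<Longrightarrow> mapA u x = mapA v x \<and> natA u x = natA v x"
    "x \<in> marks (ideal_subtree T (mapA h l)) \<Longrightarrow> mapM u x = mapM v x \<and> natM u x = natM v x"
    "x \<in> nodes (ideal_subtree T (mapA h l)) \<Longrightarrow> mapN u x = mapN v x \<and> natN u x = natN v x"
    if l: "l \<in> leaves S0" for l x
  proof -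
    let ?I = "ideal_subtree T (mapA h l)"
    have k': "k l \<in> ptree_isos P (D l) (restr T (edges ?I) (marks ?I) (nodes ?I))"
      using k[OF l] unfolding ideal[OF l] by simp
    have sub: "edges ?I \<subseteq> edges T" "marks ?I \<subseteq> marks T" "nodes ?I \<subseteq> nodes T"
      using cov_edges cov_marks cov_nodes l by blast+
    have "restrict (\<lambda>l. cmp (ptrees P) u (k l)) (leaves S0) l = restrict (\<lambda>l. cmp (ptrees P) v (k l)) (leaves S0) l"
      using eq by (simp add: act_def)
    then have 2: "cmp (ptrees P) u (k l) = cmp (ptrees P) v (k l)" using l by simp
    note r = eq_on_piece_if_cmp[OF D[OF l] T T' k' sub u v 2]
    show "x \<in> edges ?I \<Longrightarrow> mapA u x = mapA v x \<and> natA u x = natA v x" by (rule r(1))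
    show "x \<in> marks ?I \<Longrightarrow> mapM u x = mapM v x \<and> natM u x = natM v x" by (rule r(2))
    show "x \<in> nodes ?I \<Longrightarrow> mapN u x = mapN v x \<and> natN u x = natN v x" by (rule r(3))
  qed
  show ?thesis
  proof (rule ptree_map_eqI[OF uD(2) vD(2)], unfold uD(1) vD(1))
    show "mapA u x = mapA v x \<and> natA u x = natA v x" if "x \<in> edges T" for x
      using that[unfolded cov_edges] S(1) I(1) by blast
    show "mapM u x = mapM v x \<and> natM u x = natM v x" if "x \<in> marks T" for x
      using that[unfolded cov_marks] S(2) I(2) by blast
    show "mapN u x = mapN v x \<and> natN u x = natN v x" if "x \<in> nodes T" for x
      using that[unfolded cov_nodes] S(3) I(3) by blast
  qed simp
qed

text \<open>On each piece the only candidate is the second chart after the inverse of the first.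
  Equality of the gluing data is exactly what makes the colour components of these candidates agree
  on the seams. Since \<open>T'\<close> may differ from \<open>T\<close>, this yields both
  transitivity under automorphisms and uniqueness of the glued tree up to isomorphism.\<close>

lemma act_trans:
  assumes T': "is_ptree P T'" and y': "(S', h', k') \<in> graftings T'"
    and \<phi>: "\<phi> \<in> gluing_data" "glues \<phi> (S, h, k)" "glues \<phi> (S', h', k')"
  shows "\<exists>u\<in>ptree_isos P T T'. act u T' (S, h, k) = (S', h', k')"
proof -
  interpret G': grafted P S0 D T' S' h' k' using T' y' by unfold_locales
  \<comment> \<open>The index \<open>None\<close> stands for the cut and \<open>Some l\<close> for
    the ideal subtree over the leaf \<open>l\<close>, so that one family covers both kinds of
    pieces.\<close>
  define Q where "Q i = (case i of None \<Rightarrow> S | Some l \<Rightarrow> ideal_subtree T (mapA h l))" for i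
  define Q' where "Q' i = (case i of None \<Rightarrow> S' | Some l \<Rightarrow> ideal_subtree T' (mapA h' l))" for i
  define W where "W i = (case i of None \<Rightarrow> S0 | Some l \<Rightarrow> D l)" for i
  define f where "f i = (case i of None \<Rightarrow> h | Some l \<Rightarrow> k l)" for i
  define f' where "f' i = (case i of None \<Rightarrow> h' | Some l \<Rightarrow> k' l)" for i
  define u where "u i = cmp (ptrees P) (f' i) (pinv P (W i) (Q i) (f i))" for i
  define J where "J = insert None (Some ` leaves S0)"
  have JE: "i \<in> J \<longleftrightarrow> i = None \<or> (\<exists>l\<in>leaves S0. i = Some l)" for i by (auto simp: J_def)
  note simps = Q_def Q'_def W_def f_def f'_def
  have pt: "is_ptree P (W i)" "is_ptree P (Q i)" "is_ptree P (Q' i)"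
     and ff: "f i \<in> ptree_isos P (W i) (Q i)" "f' i \<in> ptree_isos P (W i) (Q' i)" if "i \<in> J" for i
    using that S0 D S_ptree G'.S_ptree ideal_pt G'.ideal_pt h G'.h k G'.k by (auto simp: JE simps)
  have u: "u i \<in> ptree_isos P (Q i) (Q' i)" if "i \<in> J" for i
    unfolding u_def by (rule iso_cmp_full[OF pt(2)[OF that] pt(1)[OF that] pt(3)[OF that]
      pinv_inverse(1)[OF pt(1)[OF that] pt(2)[OF that] ff(1)[OF that]] ff(2)[OF that]])
  have uf: "cmp (ptrees P) (u i) (f i) = f' i" if i: "i \<in> J" for i
  proof -
    note pi = pinv_inverse[OF pt(1,2)[OF i] ff(1)[OF i]]
    have "cmp (ptrees P) (u i) (f i) = cmp (ptrees P) (f' i) (cmp (ptrees P) (pinv P (W i) (Q i) (f i)) (f i))"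
      unfolding u_def using groupoid_assoc[OF ptrees_groupoid, of "W i" "Q i" "W i" "Q' i"] pt[OF i] ff[OF i] pi(1)
      by simp
    also have "\<dots> = f' i" unfolding pi(2) by (rule cmp_idn(1)[OF pt(1,3)[OF i] ff(2)[OF i]])
    finally show ?thesis .
  qed
  have ufA: "mapA (u i) (mapA (f i) a) = mapA (f' i) a \<and> cmp (gI P) (natA (u i) (mapA (f i) a)) (natA (f i) a) = natA (f' i) a"
    if i: "i \<in> J" and a: "a \<in> edges (W i)" for i a
    using arg_cong[OF uf[OF i], of "\<lambda>g. mapA g a"] arg_cong[OF uf[OF i], of "\<lambda>g. natA g a"] a
    by (simp add: isoD(1)[OF ptreeD(1)[OF pt(1)[OF i]] ff(1)[OF i]] compose_eq)
  \<comment> \<open>Compatibility on the seam. Both candidates send \<open>mapA h l\<close> to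
    \<open>mapA h' l\<close>; their colour components agree after composition with
    \<open>natA (k l) (root (D l))\<close>, by the two gluing equations with the same
    \<open>\<phi>\<close>, and this arrow can be cancelled.\<close>
  have ul: "mapA (u None) (mapA h l) = mapA h' l" "mapA (u (Some l)) (mapA h l) = mapA h' l"
    "natA (u None) (mapA h l) = natA (u (Some l)) (mapA h l)" if l: "l \<in> leaves S0" for l
  proof -
    have J: "None \<in> J" "Some l \<in> J" using l by (auto simp: J_def)
    note 1 = ufA[OF J(1), of l, unfolded simps, simplified, folded simps, OF leaf0[OF l]]
    note 2 = ufA[OF J(2), of "root (D l)", unfolded simps, simplified, OF rootD[OF l]]
    show "mapA (u None) (mapA h l) = mapA h' l" using 1 by simp
    show "mapA (u (Some l)) (mapA h l) = mapA h' l" using 2 k_root[OF l] G'.k_root[OF l] by simp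
    have e: "mapA h l \<in> edges (Q None)" "mapA h l \<in> edges (Q (Some l))"
      using H.img(1) leaf0[OF l] ideal_leaf[OF l] by (auto simp: Q_def)
    have col: "colA (Q None) = colA T" "colA (Q' None) = colA T'" "colA (Q (Some l)) = colA T" "colA (Q' (Some l)) = colA T'"
      using colS G'.colS ideal[OF l] G'.ideal[OF l] by (simp_all add: simps)
    have n1: "natA (u None) (mapA h l) \<in> hom (gI P) (colA T (mapA h l)) (colA T' (mapA h' l))"
      using isoD(5)[OF ptreeD(1)[OF pt(2)[OF J(1)]] u[OF J(1)] e(1)] 1 col by simp
    have n2: "natA (u (Some l)) (mapA h l) \<in> hom (gI P) (colA T (mapA h l)) (colA T' (mapA h' l))"
      using isoD(5)[OF ptreeD(1)[OF pt(2)[OF J(2)]] u[OF J(2)] e(2)] 2 k_root[OF l] G'.k_root[OF l] col by simp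
    have \<phi>l: "\<phi> l \<in> hom (gI P) (colA (D l) (root (D l))) (colA S0 l)" using \<phi>(1) l by (auto simp: gluing_data_def)
    note o = ptreeD(2)[OF D[OF l] rootD[OF l]] ptreeD(2)[OF S0 leaf0[OF l]] ptreeD(2)[OF T leafT[OF l]]
       ptreeD(2)[OF T' G'.leafT[OF l]]
    have "cmp (gI P) (natA (u None) (mapA h l)) (natA (k l) (root (D l))) =
        cmp (gI P) (natA (u None) (mapA h l)) (cmp (gI P) (natA h l) (\<phi> l))"
      using \<phi>(2) l by (simp add: glues_def)
    also have "\<dots> = cmp (gI P) (natA h' l) (\<phi> l)"
      using groupoid_assoc[OF gpd(1) o \<phi>l h_nat[OF l] n1] 1 by simp
    also have "\<dots> = natA (k' l) (root (D l))" using \<phi>(3) l by (simp add: glues_def)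
    also have "\<dots> = cmp (gI P) (natA (u (Some l)) (mapA h l)) (natA (k l) (root (D l)))"
      using 2 k_root[OF l] by simp
    finally show "natA (u None) (mapA h l) = natA (u (Some l)) (mapA h l)"
      by (rule groupoid_cancel_right[OF gpd(1) o(1,3,4) k_nat[OF l] n1 n2])
  qed
  have bij: "bij_betw (mapA (u i)) (edges (Q i)) (edges (Q' i))"
     "bij_betw (mapM (u i)) (marks (Q i)) (marks (Q' i))" "bij_betw (mapN (u i)) (nodes (Q i)) (nodes (Q' i))"
     if i: "i \<in> J" for i
    using isoD(4)[OF ptreeD(1)[OF pt(2)[OF i]] u[OF i]] by (auto simp: tree_iso_def)
  have injA: "mapA (u i) x = mapA (u i) y \<longleftrightarrow> x = y" if "i \<in> J" "x \<in> edges (Q i)" "y \<in> edges (Q i)" for i x y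
    using bij(1)[OF that(1)] that(2,3) by (metis bij_betw_def inj_on_eq_iff)
  have injM: "mapM (u i) x = mapM (u i) y \<longleftrightarrow> x = y" if "i \<in> J" "x \<in> marks (Q i)" "y \<in> marks (Q i)" for i x y
    using bij(2)[OF that(1)] that(2,3) by (metis bij_betw_def inj_on_eq_iff)
  have injN: "mapN (u i) x = mapN (u i) y \<longleftrightarrow> x = y" if "i \<in> J" "x \<in> nodes (Q i)" "y \<in> nodes (Q i)" for i x y
    using bij(3)[OF that(1)] that(2,3) by (metis bij_betw_def inj_on_eq_iff)
  have mem: "mapA (u i) x \<in> edges (Q' i)" if "i \<in> J" "x \<in> edges (Q i)" for i x
    using bij(1)[OF that(1)] that(2) by (metis bij_betwE)
  have memM: "mapM (u i) x \<in> marks (Q' i)" if "i \<in> J" "x \<in> marks (Q i)" for i x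
    using bij(2)[OF that(1)] that(2) by (metis bij_betwE)
  have memN: "mapN (u i) x \<in> nodes (Q' i)" if "i \<in> J" "x \<in> nodes (Q i)" for i x
    using bij(3)[OF that(1)] that(2) by (metis bij_betwE)
  have NJ: "None \<in> J" and SJ: "l \<in> leaves S0 \<Longrightarrow> Some l \<in> J" for l by (auto simp: J_def)
  \<comment> \<open>Two images can meet only in the edge \<open>mapA h' l\<close>, whose preimage in
    either piece is \<open>mapA h l\<close>.\<close>
  have AS: "mapA (u None) x = mapA (u (Some l)) y \<longleftrightarrow> x = y"
    if l: "l \<in> leaves S0" and x: "x \<in> edges S" and y: "y \<in> edges (ideal_subtree T (mapA h l))" for l x y
  proof
    have e: "mapA h l \<in> edges S" using H.img(1) leaf0[OF l] by auto
    assume eq: "mapA (u None) x = mapA (u (Some l)) y"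
    have "mapA (u None) x \<in> edges S'" "mapA (u None) x \<in> edges (ideal_subtree T' (mapA h' l))"
      using mem[OF NJ, of x] mem[OF SJ[OF l], of y] x y eq by (simp_all add: simps)
    then have "mapA (u None) x = mapA h' l" using G'.overlap_edges l by blast
    then have "x = mapA h l" "y = mapA h l"
      using injA[OF NJ, of x "mapA h l"] injA[OF SJ[OF l], of y "mapA h l"] ul[OF l] x y e ideal_leaf[OF l] eq
      by (simp_all add: Q_def)
    then show "x = y" by simp
  next
    assume "x = y"
    then have "x = mapA h l" using overlap_edges l x y by blast
    then show "mapA (u None) x = mapA (u (Some l)) y" using ul[OF l] \<open>x = y\<close> by simp
  qed
  have "\<exists>w\<in>ptree_isos P T T'. \<forall>i\<in>J.
     (\<forall>x\<in>edges (Q i). mapA w x = mapA (u i) x \<and> natA w x = natA (u i) x) \<and>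
     (\<forall>x\<in>marks (Q i). mapM w x = mapM (u i) x \<and> natM w x = natM (u i) x) \<and>
     (\<forall>x\<in>nodes (Q i). mapN w x = mapN (u i) x \<and> natN w x = natN (u i) x)"
  proof (rule glue_isos[OF T T', where Q' = Q'])
    show "is_tree (Q i) \<and> Q i = restr T (edges (Q i)) (marks (Q i)) (nodes (Q i))" if "i \<in> J" for i
      using that[unfolded JE] ptreeD(1)[OF pt(2)[OF that]] C.c(6) by (auto simp: Q_def ideal)
    show "Q' i = restr T' (edges (Q' i)) (marks (Q' i)) (nodes (Q' i))" if "i \<in> J" for i
      using that[unfolded JE] G'.C.c(6) by (auto simp: Q'_def G'.ideal)
    show "u i \<in> ptree_isos P (Q i) (Q' i)" if "i \<in> J" for i using u[OF that] .
    show "edges T = (\<Union>i\<in>J. edges (Q i))" "marks T = (\<Union>i\<in>J. marks (Q i))" "nodes T = (\<Union>i\<in>J. nodes (Q i))"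
      by (auto simp: J_def Q_def cov_edges cov_marks cov_nodes)
    show "edges T' = (\<Union>i\<in>J. edges (Q' i))" "marks T' = (\<Union>i\<in>J. marks (Q' i))" "nodes T' = (\<Union>i\<in>J. nodes (Q' i))"
      by (auto simp: J_def Q'_def G'.cov_edges G'.cov_marks G'.cov_nodes)
  next
    fix i j x y assume i: "i \<in> J" and j: "j \<in> J"
    { assume x: "x \<in> edges (Q i)" and y: "y \<in> edges (Q j)"
      show "mapA (u i) x = mapA (u j) y \<longleftrightarrow> x = y"
      proof (cases "i = j")
        case True then show ?thesis using injA[OF i] x y by blast
      next
        case False
        show ?thesis
        proof (cases i)
          case None
          then obtain l where "l \<in> leaves S0" "j = Some l" using False j JE by auto
          then show ?thesis using AS x y None by (simp add: Q_def)
        next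
          case (Some l)
          then have l: "l \<in> leaves S0" using i JE by auto
          show ?thesis
          proof (cases j)
            case None then show ?thesis using AS[OF l, of y x] x y Some by (auto simp: Q_def)
          next
            case (Some l')
            with j have l': "l' \<in> leaves S0" using JE by auto
            have "l \<noteq> l'" using False \<open>i = Some l\<close> Some by simp
            then have "x \<noteq> y" "mapA (u i) x \<noteq> mapA (u j) y"
              using x y mem[OF i x] mem[OF j y] \<open>i = Some l\<close> Some
                disjoint_ideals(1)[OF l l', of x] G'.disjoint_ideals(1)[OF l l', of "mapA (u i) x"]
              by (auto simp: simps)
            then show ?thesis by simp
          qed
        qed
      qed }
    { assume x: "x \<in> marks (Q i)" and y: "y \<in> marks (Q j)"
      show "mapM (u i) x = mapM (u j) y \<longleftrightarrow> x = y"
      proof (cases "i = j")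
        case True then show ?thesis using injM[OF i] x y by blast
      next
        case False
        then have "x \<noteq> y" "mapM (u i) x \<noteq> mapM (u j) y"
          using x y memM[OF i x] memM[OF j y] i[unfolded JE] j[unfolded JE] 
            overlap_marks disjoint_ideals(3) G'.overlap_marks G'.disjoint_ideals(3)
          by (auto simp: simps)
        then show ?thesis by simp
      qed }
    { assume x: "x \<in> nodes (Q i)" and y: "y \<in> nodes (Q j)"
      show "mapN (u i) x = mapN (u j) y \<longleftrightarrow> x = y"
      proof (cases "i = j")
        case True then show ?thesis using injN[OF i] x y by blast
      next
        case False
        then have "x \<noteq> y" "mapN (u i) x \<noteq> mapN (u j) y"
          using x y memN[OF i x] memN[OF j y] i[unfolded JE] j[unfolded JE] 
            overlap_nodes disjoint_ideals(2) G'.overlap_nodes G'.disjoint_ideals(2)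
          by (auto simp: simps)
        then show ?thesis by simp
      qed }
    { assume x: "x \<in> edges (Q i)" and y: "x \<in> edges (Q j)"
      show "natA (u i) x = natA (u j) x"
        using i[unfolded JE] j[unfolded JE] x y
      proof (elim disjE bexE; hypsubst?)
        fix l assume a: "l \<in> leaves S0" "x \<in> edges (Q None)" "x \<in> edges (Q (Some l))"
        then have "x = mapA h l" using overlap_edges by (simp add: Q_def)
        then show "natA (u None) x = natA (u (Some l)) x" "natA (u (Some l)) x = natA (u None) x"
          using ul(3)[OF a(1)] by auto
      next
        fix l l' assume a: "l \<in> leaves S0" "l' \<in> leaves S0" "x \<in> edges (Q (Some l))" "x \<in> edges (Q (Some l'))"
        then have "l = l'" using disjoint_ideals(1) by (simp add: Q_def)
        then show "natA (u (Some l)) x = natA (u (Some l')) x" by simp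
      qed simp }
    { assume x: "x \<in> marks (Q i)" and y: "x \<in> marks (Q j)"
      have "i = j" using i[unfolded JE] j[unfolded JE] x y overlap_marks disjoint_ideals(3)
        by (auto simp: Q_def)
      then show "natM (u i) x = natM (u j) x" by simp }
    { assume x: "x \<in> nodes (Q i)" and y: "x \<in> nodes (Q j)"
      have "i = j" using i[unfolded JE] j[unfolded JE] x y overlap_nodes disjoint_ideals(2)
        by (auto simp: Q_def)
      then show "natN (u i) x = natN (u j) x" by simp }
  qed
  then obtain w where w: "w \<in> ptree_isos P T T'"
    and wi: "\<And>i x. i \<in> J \<Longrightarrow> x \<in> edges (Q i) \<Longrightarrow> mapA w x = mapA (u i) x \<and> natA w x = natA (u i) x"
      "\<And>i x. i \<in> J \<Longrightarrow> x \<in> marks (Q i) \<Longrightarrow> mapM w x = mapM (u i) x \<and> natM w x = natM (u i) x"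
      "\<And>i x. i \<in> J \<Longrightarrow> x \<in> nodes (Q i) \<Longrightarrow> mapN w x = mapN (u i) x \<and> natN w x = natN (u i) x"
    by blast
  have wf: "cmp (ptrees P) w (f i) = f' i" if i: "i \<in> J" for i
    using cmp_eq_on_piece[OF pt(1)[OF i] ff(1)[OF i] wi(1)[OF i] wi(2)[OF i] wi(3)[OF i]] uf[OF i] by simp
  have "cmp (ptrees P) w h = h'" using wf[OF NJ] by (simp add: simps)
  moreover have "restrict (\<lambda>l. cmp (ptrees P) w (k l)) (leaves S0) = k'"
    by (rule extensionalityI[of _ "leaves S0"]) (use G'.kext wf[OF SJ] in \<open>auto simp: simps\<close>)
  moreover have "restr T' (mapA w ` edges S) (mapM w ` marks S) (mapN w ` nodes S) = S'"
  proof -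
    have "mapA w ` edges S = edges S'" "mapM w ` marks S = marks S'" "mapN w ` nodes S = nodes S'"
      using bij[OF NJ] wi[OF NJ] by (simp_all add: bij_betw_def Q_def Q'_def)
    then show ?thesis using G'.C.c(6) by simp
  qed
  ultimately show ?thesis using w by (auto simp: act_def)
qed

end

section \<open>Construction of the glued tree\<close>

locale graft_construction = grafting P S0 D for P :: "('i, 'ia, 'e, 'ea, 'b, 'ba) poly_diagram" and S0 D +
  fixes \<phi> assumes \<phi>: "\<phi> \<in> gluing_data"
begin

text \<open>The index \<open>0\<close> stands for \<open>S0\<close> and \<open>Suc l\<close> for \<open>D l\<close>, whose root is identified with the
  leaf \<open>l\<close> of \<open>S0\<close> and recoloured along \<open>\<phi> l\<close>.\<close>

definition pc where "pc i = (case i of 0 \<Rightarrow> S0 | Suc l \<Rightarrow> D l)"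
definition J where "J = insert 0 (Suc ` leaves S0)"
definition e :: "nat \<Rightarrow> nat \<Rightarrow> nat" where "e i x = prod_encode (i, x)"
definition eA where "eA i x = (case i of 0 \<Rightarrow> e 0 x | Suc l \<Rightarrow> if x = root (D l) then e 0 l else e i x)"
text \<open>The colour component of the inclusion of a piece: it compares the colour of an edge in
  its piece with its colour in the glued tree.\<close>

definition tau where
  "tau i x = (case i of 0 \<Rightarrow> idn (gI P) (colA S0 x)
     | Suc l \<Rightarrow> if x = root (D l) then \<phi> l else idn (gI P) (colA (D l) x))"

abbreviation on_code :: "(nat \<Rightarrow> nat \<Rightarrow> 'x) \<Rightarrow> nat \<Rightarrow> 'x" where
  "on_code f c \<equiv> case_prod f (prod_decode c)"

text \<open>A seam edge takes its colour from \<open>S0\<close>. Hence \<open>isoT\<close> must be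
  corrected at a node whose output edge is the root of some \<open>D l\<close>, while
  \<open>isoS\<close> can be kept, because a root is never an input edge.\<close>

definition graft where
  "graft = \<lparr>edges = (\<Union>i\<in>J. eA i ` edges (pc i)), marks = (\<Union>i\<in>J. e i ` marks (pc i)),
     nodes = (\<Union>i\<in>J. e i ` nodes (pc i)),
     ts = on_code (\<lambda>i m. eA i (ts (pc i) m)), tp = on_code (\<lambda>i m. e i (tp (pc i) m)),
     tt = on_code (\<lambda>i n. eA i (tt (pc i) n)),
     colA = on_code (\<lambda>i. colA (pc i)), colM = on_code (\<lambda>i. colM (pc i)), colN = on_code (\<lambda>i. colN (pc i)),
     isoS = on_code (\<lambda>i. isoS (pc i)), isoP = on_code (\<lambda>i. isoP (pc i)),
     isoT = on_code (\<lambda>i n. cmp (gI P) (tau i (tt (pc i) n)) (isoT (pc i) n))\<rparr>"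

lemma graft_simps [simp]:
  "edges graft = (\<Union>i\<in>J. eA i ` edges (pc i))" "marks graft = (\<Union>i\<in>J. e i ` marks (pc i))"
  "nodes graft = (\<Union>i\<in>J. e i ` nodes (pc i))"
  "ts graft (e i x) = eA i (ts (pc i) x)" "tp graft (e i x) = e i (tp (pc i) x)" "tt graft (e i x) = eA i (tt (pc i) x)"
  "colA graft (e i x) = colA (pc i) x" "colM graft (e i x) = colM (pc i) x" "colN graft (e i x) = colN (pc i) x"
  "isoS graft (e i x) = isoS (pc i) x" "isoP graft (e i x) = isoP (pc i) x"
  "isoT graft (e i x) = cmp (gI P) (tau i (tt (pc i) x)) (isoT (pc i) x)"
  by (simp_all add: graft_def e_def)

lemma e_inj [simp]: "e i x = e j y \<longleftrightarrow> i = j \<and> x = y" by (simp add: e_def)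

lemma e_mem [simp]: "e i x \<in> e j ` X \<longleftrightarrow> i = j \<and> x \<in> X" by auto

lemma pc_ptree: "i \<in> J \<Longrightarrow> is_ptree P (pc i)"
  using S0 D by (auto simp: J_def pc_def)

lemma pc_simps [simp]: "pc 0 = S0" "pc (Suc l) = D l" by (simp_all add: pc_def)

lemma J_simps [simp]: "0 \<in> J" "Suc l \<in> J \<longleftrightarrow> l \<in> leaves S0" by (auto simp: J_def)

lemmas pc_tree = ptreeD(1)[OF pc_ptree]
lemmas pcD = pretreeD[OF is_treeD(1)[OF pc_tree]]

text \<open>The only identifications are those of a root with its leaf. Different \<open>D l\<close>
  never meet, since their roots become different leaves.\<close>

lemma eA_eq_iff:
  assumes "i \<in> J" "j \<in> J"
  shows "eA i x = eA j y \<longleftrightarrow> i = j \<and> x = y \<or>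
    (j = 0 \<and> i = Suc y \<and> x = root (D y)) \<or> (i = 0 \<and> j = Suc x \<and> y = root (D x))"
  using assms by (auto simp: eA_def split: nat.splits if_splits)

lemma eA_not_root: "x \<noteq> root (pc i) \<Longrightarrow> eA i x = e i x"
  by (auto simp: eA_def split: nat.splits)

lemma eA_0 [simp]: "eA 0 x = e 0 x" by (simp add: eA_def)
lemma eA_root [simp]: "eA (Suc l) (root (D l)) = e 0 l" by (simp add: eA_def)

lemma tau_hom:
  assumes "i \<in> J" "x \<in> edges (pc i)"
  shows "tau i x \<in> hom (gI P) (colA (pc i) x) (colA graft (eA i x))"
proof (cases i)
  case 0
  then show ?thesis using assms groupoid_idn[OF gpd(1) ptreeD(2)[OF S0]] by (simp add: tau_def)
next
  case (Suc l)
  then have l: "l \<in> leaves S0" using assms by simp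
  show ?thesis
  proof (cases "x = root (D l)")
    case True
    then show ?thesis using Suc l \<phi> by (auto simp: tau_def gluing_data_def)
  next
    case False
    then show ?thesis using Suc assms groupoid_idn[OF gpd(1) ptreeD(2)[OF D[OF l]]] by (simp add: tau_def eA_not_root)
  qed
qed

lemma tau_not_root: "x \<noteq> root (pc i) \<Longrightarrow> tau i x = idn (gI P) (colA (pc i) x)"
  by (auto simp: tau_def split: nat.splits)

lemma finite_J: "finite J" by (simp add: J_def finite_leaves0)

lemma graft_pretree: "pretree graft" "root graft = e 0 (root S0)"
proof -
  have 1: "edges graft - ts graft ` marks graft = {e 0 (root S0)}"
  proof (intro equalityI subsetI)
    fix c assume "c \<in> edges graft - ts graft ` marks graft"
    then obtain i x where c: "i \<in> J" "x \<in> edges (pc i)" "c = eA i x" and nc: "c \<notin> ts graft ` marks graft" by auto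
    have mk: "eA j (ts (pc j) m) \<in> ts graft ` marks graft" if "j \<in> J" "m \<in> marks (pc j)" for j m
      using that by (intro image_eqI[of _ _ "e j m"]) auto
    have x: "x = root (pc i)" using pcD(11)[OF c(1,2)] mk[OF c(1)] nc c(3) by metis
    show "c \<in> {e 0 (root S0)}"
    proof (cases i)
      case 0 then show ?thesis using x c by simp
    next
      case (Suc l)
      then have "l \<in> leaves S0" "c = eA 0 l" using c x by auto
      \<comment> \<open>The root of \<open>D l\<close> is a leaf of \<open>S0\<close> in the glued
        tree, hence an input edge there, unless that leaf is itself the root of \<open>S0\<close>;
        in that case it has the same code as the root of \<open>S0\<close>.\<close>
      moreover have "l = root S0"
      proof (rule ccontr)
        assume "l \<noteq> root S0"
        then obtain m where "m \<in> marks S0" "l = ts S0 m" using p0(11)[OF leaf0] \<open>l \<in> leaves S0\<close> by blast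
        then show False using mk[of 0 m] nc \<open>c = eA 0 l\<close> by simp
      qed
      ultimately show ?thesis by simp
    qed
  next
    fix c assume "c \<in> {e 0 (root S0)}"
    then have c: "c = e 0 (root S0)" by simp
    have "c \<in> edges graft" unfolding graft_simps using p0(9) c by (intro UN_I[of 0]) auto
    moreover have "c \<notin> ts graft ` marks graft"
    proof
      assume "c \<in> ts graft ` marks graft"
      then obtain i m where "i \<in> J" "m \<in> marks (pc i)" "c = eA i (ts (pc i) m)" by auto
      then show False using pcD(10)[of i m] c by (auto simp: eA_not_root)
    qed
    ultimately show "c \<in> edges graft - ts graft ` marks graft" by blast
  qed
  have "finite (edges graft)" "finite (marks graft)" "finite (nodes graft)"
    using finite_J pcD(1-3) by auto
  moreover have "ts graft \<in> marks graft \<rightarrow> edges graft" "tp graft \<in> marks graft \<rightarrow> nodes graft"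
      "tt graft \<in> nodes graft \<rightarrow> edges graft"
    using pcD(4-6) by fastforce+
  moreover have "inj_on (tt graft) (nodes graft)"
  proof (rule inj_onI)
    fix c c' assume a: "c \<in> nodes graft" "c' \<in> nodes graft" "tt graft c = tt graft c'"
    then obtain i n j n' where b: "i \<in> J" "j \<in> J" "n \<in> nodes (pc i)" "n' \<in> nodes (pc j)" "c = e i n" "c' = e j n'" by auto
    \<comment> \<open>Two output edges from different pieces could coincide only on a seam, and
      there the one from \<open>S0\<close> would be a leaf.\<close>
    have nl: "tt S0 n \<notin> leaves S0" if "n \<in> nodes S0" for n using that by (auto simp: leaves_def)
    have "eA i (tt (pc i) n) = eA j (tt (pc j) n')" using a(3) b by simp
    then have "i = j \<and> tt (pc i) n = tt (pc j) n'"
      unfolding eA_eq_iff[OF b(1,2)] using b nl by auto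
    then show "c = c'" using b inj_onD[OF pcD(7)[OF b(1)], of n n'] by auto
  qed
  moreover have "inj_on (ts graft) (marks graft)"
  proof (rule inj_onI)
    fix c c' assume a: "c \<in> marks graft" "c' \<in> marks graft" "ts graft c = ts graft c'"
    then obtain i n j n' where b: "i \<in> J" "j \<in> J" "n \<in> marks (pc i)" "n' \<in> marks (pc j)" "c = e i n" "c' = e j n'" by auto
    then have "e i (ts (pc i) n) = e j (ts (pc j) n')"
      using a(3) pcD(10)[OF b(1,3)] pcD(10)[OF b(2,4)] by (simp add: eA_not_root del: e_inj)
    then have "i = j \<and> ts (pc i) n = ts (pc j) n'" using e_inj by blast
    then show "c = c'" using b inj_onD[OF pcD(8)[OF b(1)], of n n'] by auto
  qed
  ultimately show "pretree graft" "root graft = e 0 (root S0)"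
    using pretreeI[OF _ _ _ _ _ _ _ _ 1] by blast+
qed

lemma above_graft:
  assumes "i \<in> J" "x \<in> above (pc i) l" shows "eA i x \<in> above graft (eA i l)"
  using assms(2)
proof induction
  case base show ?case by (rule above.base)
next
  case (step m)
  have "ts graft (e i m) \<in> above graft (eA i l)"
    by (rule above.step) (use step assms(1) in auto)
  then show ?case by simp
qed

text \<open>An edge of \<open>D l\<close> descends within its piece to the root of
  \<open>D l\<close>, which is the leaf \<open>l\<close>, and from there within \<open>S0\<close> to
  its root.\<close>

lemma graft_tree: "is_tree graft"
  unfolding is_tree_iff
proof (intro conjI graft_pretree subsetI)
  fix c assume "c \<in> edges graft"
  then obtain i x where c: "i \<in> J" "x \<in> edges (pc i)" "c = eA i x" by auto
  then have x: "c \<in> above graft (eA i (root (pc i)))" using above_graft is_treeD(2)[OF pc_tree] by blast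
  have 0: "e 0 z \<in> above graft (root graft)" if "z \<in> edges S0" for z
    using above_graft[of 0 z "root S0"] is_treeD(2)[OF tS0 that] graft_pretree(2) by simp
  show "c \<in> above graft (root graft)"
  proof (cases i)
    case 0 then show ?thesis using x graft_pretree(2) by simp
  next
    case (Suc l)
    then have l: "l \<in> leaves S0" using c by simp
    have "c \<in> above graft (e 0 l)" using x Suc by simp
    then show ?thesis using 0[OF leaf0[OF l]] above_trans by blast
  qed
qed

lemma colA_graft: assumes "i \<in> J" "x \<in> edges (pc i)" shows "colA graft (eA i x) \<in> obs (gI P)"
proof (cases "x = root (pc i)")
  case True
  then show ?thesis using assms ptreeD(2)[OF S0] p0(9) leaf0 by (cases i) auto
next
  case False
  then show ?thesis using assms ptreeD(2)[OF pc_ptree] by (simp add: eA_not_root)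
qed

text \<open>A node and its input marks come from the same piece with unchanged decorations, so the
  two conditions replacing the homotopy pullback are inherited. Recolouring concerns edges
  only.\<close>

lemma graft_ptree: "is_ptree P graft"
  unfolding is_ptree_iff
proof (intro conjI graft_tree)
  show "colA graft \<in> edges graft \<rightarrow> obs (gI P)" using colA_graft by auto
  show "colM graft \<in> marks graft \<rightarrow> obs (gE P)" "colN graft \<in> nodes graft \<rightarrow> obs (gB P)"
    using ptreeD(3,4)[OF pc_ptree] by auto
  show "\<forall>m\<in>marks graft. isoS graft m \<in> hom (gI P) (on_ob (src_f P) (colM graft m)) (colA graft (ts graft m))"
    using ptreeD(5)[OF pc_ptree] pcD(10) by (auto simp: eA_not_root)
  show "\<forall>m\<in>marks graft. isoP graft m \<in> hom (gB P) (on_ob (mid_f P) (colM graft m)) (colN graft (tp graft m))"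
    using ptreeD(6)[OF pc_ptree] by auto
  show "\<forall>n\<in>nodes graft. isoT graft n \<in> hom (gI P) (on_ob (tgt_f P) (colN graft n)) (colA graft (tt graft n))"
  proof
    fix c assume "c \<in> nodes graft"
    then obtain i n where c: "i \<in> J" "n \<in> nodes (pc i)" "c = e i n" by auto
    note t = ptreeD[OF pc_ptree[OF c(1)]]
    have x: "tt (pc i) n \<in> edges (pc i)" using pcD(6) c by blast
    show "isoT graft c \<in> hom (gI P) (on_ob (tgt_f P) (colN graft c)) (colA graft (tt graft c))"
      using groupoid_cmp[OF gpd(1) functor_square(3)[OF pc_ptree[OF c(1)] c(2)] t(2)[OF x] colA_graft[OF c(1) x] t(7)[OF c(2)] tau_hom[OF c(1) x]] c
      by simp
  qed
  show "\<forall>m\<in>marks graft. \<forall>m'\<in>marks graft. \<forall>u\<in>hom (gE P) (colM graft m) (colM graft m'). tp graft m = tp graft m' \<longrightarrow>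
        cmp (gB P) (isoP graft m') (on_arr (mid_f P) u) = isoP graft m \<longrightarrow>
        m = m' \<and> u = idn (gE P) (colM graft m)"
  proof (intro ballI impI)
    fix c c' u assume a: "c \<in> marks graft" "c' \<in> marks graft" "u \<in> hom (gE P) (colM graft c) (colM graft c')"
      "tp graft c = tp graft c'" "cmp (gB P) (isoP graft c') (on_arr (mid_f P) u) = isoP graft c"
    then obtain i m j m' where c: "i \<in> J" "m \<in> marks (pc i)" "c = e i m" "j \<in> J" "m' \<in> marks (pc j)" "c' = e j m'" by auto
    have ij: "j = i" "tp (pc i) m = tp (pc i) m'" using a(4) c by auto
    show "c = c' \<and> u = idn (gE P) (colM graft c)"
      using ptree_full[OF pc_ptree[OF c(1)] c(2) c(5)[unfolded ij] _ ij(2), of u] a c ij by simp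
  qed
  show "\<forall>x\<in>obs (gE P). \<forall>n\<in>nodes graft. \<forall>\<theta>\<in>hom (gB P) (on_ob (mid_f P) x) (colN graft n).
        \<exists>m\<in>marks graft. tp graft m = n \<and> (\<exists>u\<in>hom (gE P) (colM graft m) x.
          cmp (gB P) \<theta> (on_arr (mid_f P) u) = isoP graft m)"
  proof (intro ballI)
    fix x c \<theta> assume a: "x \<in> obs (gE P)" "c \<in> nodes graft" "\<theta> \<in> hom (gB P) (on_ob (mid_f P) x) (colN graft c)"
    then obtain i n where c: "i \<in> J" "n \<in> nodes (pc i)" "c = e i n" by auto
    from ptree_surj[OF pc_ptree[OF c(1)] a(1) c(2), of \<theta>] a(3) c
    obtain m u where m: "m \<in> marks (pc i)" "tp (pc i) m = n" "u \<in> hom (gE P) (colM (pc i) m) x"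
       "cmp (gB P) \<theta> (on_arr (mid_f P) u) = isoP (pc i) m" by auto
    show "\<exists>m\<in>marks graft. tp graft m = c \<and> (\<exists>u\<in>hom (gE P) (colM graft m) x.
          cmp (gB P) \<theta> (on_arr (mid_f P) u) = isoP graft m)"
    proof (intro bexI conjI)
      show "e i m \<in> marks graft" "tp graft (e i m) = c" using m c by auto
      show "u \<in> hom (gE P) (colM graft (e i m)) x" "cmp (gB P) \<theta> (on_arr (mid_f P) u) = isoP graft (e i m)"
        using m by auto
    qed
  qed
qed

definition inc where
  "inc i = \<lparr>dm = pc i, mapA = restrict (eA i) (edges (pc i)), mapM = restrict (e i) (marks (pc i)),
     mapN = restrict (e i) (nodes (pc i)), natA = restrict (tau i) (edges (pc i)),
     natM = restrict (\<lambda>m. idn (gE P) (colM (pc i) m)) (marks (pc i)),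
     natN = restrict (\<lambda>n. idn (gB P) (colN (pc i) n)) (nodes (pc i))\<rparr>"

abbreviation piece where
  "piece i \<equiv> restr graft (eA i ` edges (pc i)) (e i ` marks (pc i)) (e i ` nodes (pc i))"

text \<open>The squares at nodes hold by the definition of \<open>isoT graft\<close>; those at marks
  hold because input edges are not roots, where \<open>tau\<close> is an identity.\<close>

lemma inc_iso:
  assumes i: "i \<in> J"
  shows "inc i \<in> ptree_isos P (pc i) (piece i)"
proof -
  note t = ptreeD[OF pc_ptree[OF i]] and o = functor_square[OF pc_ptree[OF i]]
  note p = pcD[OF i]
  note F = is_functorD(2)[OF fct(1)] is_functorD(2)[OF fct(2)] is_functorD(2)[OF fct(3)]
  have "tree_iso (pc i) (piece i) (eA i) (e i) (e i)"
    by (auto simp: tree_iso_def bij_betw_def inj_on_def eA_eq_iff[OF i i])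
  then have "tree_iso (pc i) (piece i) (mapA (inc i)) (mapM (inc i)) (mapN (inc i))"
    using p by (simp add: inc_def tree_iso_def cong: bij_betw_cong)
  moreover have "cmp (gI P) (isoS (pc i) m) (on_arr (src_f P) (idn (gE P) (colM (pc i) m))) = cmp (gI P) (tau i (ts (pc i) m)) (isoS (pc i) m)"
     "cmp (gB P) (isoP (pc i) m) (on_arr (mid_f P) (idn (gE P) (colM (pc i) m))) = cmp (gB P) (idn (gB P) (colN (pc i) (tp (pc i) m))) (isoP (pc i) m)"
     if m: "m \<in> marks (pc i)" for m
    using m groupoid_idl[OF gpd(1) o(1)[OF m] t(2)[OF p(4)[OF m]] t(5)[OF m]] groupoid_idr[OF gpd(1) o(1)[OF m] t(2)[OF p(4)[OF m]] t(5)[OF m]]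
       groupoid_idl[OF gpd(3) o(2)[OF m] t(4)[OF p(5)[OF m]] t(6)[OF m]] groupoid_idr[OF gpd(3) o(2)[OF m] t(4)[OF p(5)[OF m]] t(6)[OF m]]
    by (simp_all add: F t tau_not_root p(10))
  moreover have "cmp (gI P) (cmp (gI P) (tau i (tt (pc i) n)) (isoT (pc i) n)) (on_arr (tgt_f P) (idn (gB P) (colN (pc i) n))) =
      cmp (gI P) (tau i (tt (pc i) n)) (isoT (pc i) n)"
     if n: "n \<in> nodes (pc i)" for n
    using n groupoid_idr[OF gpd(1) o(3)[OF n] colA_graft[OF i p(6)[OF n]] groupoid_cmp[OF gpd(1) o(3)[OF n] t(2)[OF p(6)[OF n]]
       colA_graft[OF i p(6)[OF n]] t(7)[OF n] tau_hom[OF i p(6)[OF n]]]]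
    by (simp add: F t)
  moreover have "extensional_map (inc i)" "dm (inc i) = pc i" by (simp_all add: inc_def extensional_map_def)
  ultimately show ?thesis
    using groupoid_idn[OF gpd(2)] groupoid_idn[OF gpd(3)] t(3,4) p(4-6) tau_hom[OF i]
    unfolding ptree_isos_iff[OF pc_tree[OF i]] iso_data_def by (simp add: inc_def)
qed

lemma piece_cut: "piece 0 \<in> cuts graft"
proof (rule cutsI[OF refl])
  interpret tree_isomorphism S0 "piece 0" "mapA (inc 0)" "mapM (inc 0)" "mapN (inc 0)"
    using isoD(4)[OF pc_tree inc_iso, of 0] tS0 by unfold_locales simp_all
  show "is_tree (piece 0)" by (rule is_tree)
  show "root (piece 0) = root graft" using root p0(9) by (simp add: graft_pretree inc_def)
  show "eA 0 ` edges (pc 0) \<subseteq> edges graft" "e 0 ` nodes (pc 0) \<subseteq> nodes graft"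
    unfolding graft_simps using J_simps(1) by blast+
  show "e 0 ` marks (pc 0) = {m \<in> marks graft. tp graft m \<in> e 0 ` nodes (pc 0)}"
  proof -
    have "e 0 m \<in> marks graft" if "m \<in> marks S0" for m
      unfolding graft_simps using that by (intro UN_I[of 0]) auto
    then show ?thesis using p0(5) by auto
  qed
qed

text \<open>Upward paths from the seam stay in the copy of \<open>D l\<close>: a node of another
  piece with output edge in this copy would belong to \<open>S0\<close> and have output edge
  \<open>l\<close>, but \<open>l\<close> is a leaf.\<close>

lemma piece_ideal:
  assumes l: "l \<in> leaves S0"
  shows "ideal_subtree graft (e 0 l) = piece (Suc l)"
proof -
  let ?i = "Suc l"
  have i: "?i \<in> J" using l by simp
  have l': "e 0 l \<in> edges graft" unfolding graft_simps using leaf0[OF l] by (intro UN_I[of 0]) auto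
  have nl: "tt S0 n \<noteq> l" if "n \<in> nodes S0" for n using that l by (auto simp: leaves_def)
  have node: "eA j (tt (pc j) n) \<in> eA ?i ` edges (D l) \<longleftrightarrow> j = ?i" if "j \<in> J" "n \<in> nodes (pc j)" for j n
  proof
    assume "eA j (tt (pc j) n) \<in> eA ?i ` edges (D l)"
    then obtain x where x: "x \<in> edges (D l)" "eA j (tt (pc j) n) = eA ?i x" by blast
    show "j = ?i"
    proof (rule ccontr)
      assume "j \<noteq> ?i"
      then have "j = 0" "tt (pc j) n = l" using x(2)[unfolded eA_eq_iff[OF that(1) i]] by auto
      then show False using nl that(2) by simp
    qed
  next
    assume "j = ?i"
    then show "eA j (tt (pc j) n) \<in> eA ?i ` edges (D l)" using pcD(6)[OF that] by simp
  qed
  define X where "X = eA ?i ` edges (D l)"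
  note nodeX = node[folded X_def]
  have ab: "above graft (e 0 l) = eA ?i ` edges (D l)"
  proof (intro equalityI subsetI)
    fix c assume "c \<in> above graft (e 0 l)"
    then show "c \<in> eA ?i ` edges (D l)"
    proof induction
      case base
      show ?case using pcD(9)[OF i] by (intro image_eqI[of _ _ "root (D l)"]) auto
    next
      case (step c)
      then obtain j m where c: "j \<in> J" "m \<in> marks (pc j)" "c = e j m" by auto
      then have "j = ?i" using step(3) node[OF c(1) pcD(5)[OF c(1,2)]] by simp
      then show ?case using c pcD(4)[OF c(1,2)] by auto
    qed
  next
    fix c assume "c \<in> eA ?i ` edges (D l)"
    then show "c \<in> above graft (e 0 l)"
      using above_graft[OF i, of _ "root (D l)"] is_treeD(2)[OF pc_tree[OF i]] by auto
  qed
  have "{m \<in> marks graft. tt graft (tp graft m) \<in> above graft (e 0 l)} = e ?i ` marks (pc ?i)"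
    unfolding ab X_def[symmetric] using i nodeX[OF _ pcD(5)] nodeX[OF i pcD(5)[OF i]] by auto
  moreover have "{n \<in> nodes graft. tt graft n \<in> above graft (e 0 l)} = e ?i ` nodes (pc ?i)"
    unfolding ab X_def[symmetric] using i nodeX nodeX[OF i] by auto
  ultimately show ?thesis unfolding ideal_subtree_eq[OF graft_tree l'] ab by simp
qed

lemma graft_exists:
  "\<exists>T y. is_ptree P T \<and> y \<in> graftings T \<and> glues \<phi> y"
proof (intro exI conjI)
  show "is_ptree P graft" by (rule graft_ptree)
  let ?k = "restrict (\<lambda>l. inc (Suc l)) (leaves S0)"
  have m: "mapA (inc 0) l = e 0 l" if "l \<in> leaves S0" for l using leaf0[OF that] by (simp add: inc_def)
  show "(piece 0, inc 0, ?k) \<in> graftings graft"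
    using piece_cut inc_iso[of 0] inc_iso[of "Suc _"] m piece_ideal by (auto simp: graftings_def)
  \<comment> \<open>The gluing equation for the inclusions: \<open>tau\<close> is an identity on
    \<open>S0\<close> and equals \<open>\<phi> l\<close> at the root of \<open>D l\<close>.\<close>
  have "cmp (gI P) (tau 0 l) (\<phi> l) = tau (Suc l) (root (D l))" if l: "l \<in> leaves S0" for l
  proof -
    have "\<phi> l \<in> hom (gI P) (colA (D l) (root (D l))) (colA S0 l)" using \<phi> l by (auto simp: gluing_data_def)
    then show ?thesis
      using groupoid_idl[OF gpd(1) ptreeD(2)[OF D[OF l]] ptreeD(2)[OF S0 leaf0[OF l]]] pcD(9)[of "Suc l"] l
      by (simp add: tau_def)
  qed
  then show "glues \<phi> (piece 0, inc 0, ?k)"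
    using leaf0 pcD(9)[of "Suc _"] by (simp add: glues_def inc_def)
qed

end

section \<open>Counting graftings\<close>

locale finite_polynomial_diagram = polynomial_diagram P for P :: "('i, 'ia, 'e, 'ea, 'b, 'ba) poly_diagram" +
  assumes finite_aut: "\<forall>T\<in>obs (ptrees P). finite (aut (ptrees P) T)"
begin

lemma finite_aut_ptree: "is_ptree P T \<Longrightarrow> finite (ptree_isos P T T)"
  using finite_aut by (simp add: aut_def)

lemma finite_isos: "is_ptree P S \<Longrightarrow> is_ptree P T \<Longrightarrow> finite (ptree_isos P S T)"
  using finite_hom[OF ptrees_groupoid, of S T] finite_aut by simp

text \<open>Automorphisms of the colour \<open>v\<close> embed into those of the trivial tree
  \<open>E\<close> with a single edge of colour \<open>v\<close>, which are finite in
  number.\<close>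

lemma finite_aut_colour:
  assumes v: "v \<in> obs (gI P)"
  shows "finite (aut (gI P) v)"
proof -
  define E :: "('i, 'ia, 'e, 'b, 'ba) ptree" where
    "E = \<lparr>edges = {0}, marks = {}, nodes = {}, ts = id, tp = id, tt = id, colA = (\<lambda>_. v), colM = undefined,
       colN = undefined, isoS = undefined, isoP = undefined, isoT = undefined\<rparr>"
  have s: "edges E = {0}" "marks E = {}" "nodes E = {}" "colA E = (\<lambda>_. v)" by (simp_all add: E_def)
  have "pretree E" "root E = 0" by (rule pretreeI[where r = 0]; simp add: s)+
  then have t: "is_tree E" by (auto simp: is_tree_iff s intro: above.base)
  have E: "is_ptree P E" using t v by (simp add: is_ptree_iff s)
  define i where "i a = (\<lparr>dm = E, mapA = restrict id {0}, mapM = restrict id {}, mapN = restrict id {},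
     natA = restrict (\<lambda>_. a) {0}, natM = restrict undefined {}, natN = restrict undefined {}\<rparr>
        :: ('i, 'ia, 'e, 'ea, 'b, 'ba) ptree_map)" for a
  have "i ` aut (gI P) v \<subseteq> ptree_isos P E E"
    by (auto simp: ptree_isos_iff[OF t] iso_data_def extensional_map_def i_def aut_def s tree_iso_def bij_betw_def restrict_def extensional_def)
  moreover have "inj_on i (aut (gI P) v)"
    by (rule inj_onI) (auto simp: i_def dest: fun_cong[of _ _ 0])
  ultimately show ?thesis using finite_aut_ptree[OF E] inj_on_finite by blast
qed

lemma finite_hom_colour: "v \<in> obs (gI P) \<Longrightarrow> w \<in> obs (gI P) \<Longrightarrow> finite (hom (gI P) v w)"
  using finite_hom[OF gpd(1)] finite_aut_colour by blast

end

locale grafting_finite = grafting P S0 D + finite_polynomial_diagram P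
  for P :: "('i, 'ia, 'e, 'ea, 'b, 'ba) poly_diagram" and S0 D
begin

lemma finite_gluing_data: "finite gluing_data"
  unfolding gluing_data_def
  by (intro finite_PiE finite_leaves0 finite_hom_colour) (use ptreeD(2)[OF D rootD] ptreeD(2)[OF S0 leaf0] in auto)

lemma fibre_bij:
  assumes T: "is_ptree P T" and \<phi>: "\<phi> \<in> gluing_data" and y: "y \<in> graftings T" "glues \<phi> y"
  shows "bij_betw (\<lambda>u. act u T y) (ptree_isos P T T) {y' \<in> graftings T. glues \<phi> y'}"
proof -
  obtain S h k where yy: "y = (S, h, k)" by (cases y)
  interpret G: grafted P S0 D T S h k using T y(1) yy by unfold_locales auto
  have "inj_on (\<lambda>u. act u T y) (ptree_isos P T T)"
    by (rule inj_onI) (use G.act_inj[OF T] yy in blast)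
  moreover have "y' \<in> (\<lambda>u. act u T y) ` ptree_isos P T T" if "y' \<in> graftings T" "glues \<phi> y'" for y'
  proof -
    obtain S' h' k' where y': "y' = (S', h', k')" by (cases y')
    show ?thesis using G.act_trans[OF T _ \<phi>, of S' h' k'] that y(2) y' yy by (metis image_eqI)
  qed
  moreover have "act u T y \<in> graftings T \<and> glues \<phi> (act u T y)" if "u \<in> ptree_isos P T T" for u
    using G.act_graftings[OF T that] \<phi> y(2) yy by blast
  ultimately show ?thesis unfolding bij_betw_def by blast
qed

definition realised where
  "realised T = {\<phi> \<in> gluing_data. \<exists>y\<in>graftings T. glues \<phi> y}"

lemma ex1_gluing:
  assumes "is_ptree P T" "y \<in> graftings T"
  shows "\<exists>!\<phi>. \<phi> \<in> gluing_data \<and> glues \<phi> y"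
proof -
  obtain S h k where yy: "y = (S, h, k)" by (cases y)
  interpret G: grafted P S0 D T S h k using assms yy by unfold_locales auto
  show ?thesis using G.ex1_glues yy by simp
qed

lemma card_graftings:
  assumes T: "is_ptree P T"
  shows "finite (graftings T)" "card (graftings T) = card (realised T) * card (aut (ptrees P) T)"
proof -
  have fin: "finite (realised T)" using finite_gluing_data by (simp add: realised_def)
  have U: "graftings T = (\<Union>\<phi>\<in>realised T. {y \<in> graftings T. glues \<phi> y})"
    using ex1_implies_ex[OF ex1_gluing[OF T]] unfolding realised_def by blast
  have c: "finite {y \<in> graftings T. glues \<phi> y}" "card {y \<in> graftings T. glues \<phi> y} = card (aut (ptrees P) T)"
    if a: "\<phi> \<in> realised T" for \<phi>
  proof -
    obtain y where "\<phi> \<in> gluing_data" "y \<in> graftings T" "glues \<phi> y" using a by (auto simp: realised_def)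
    from fibre_bij[OF T this] show "finite {y \<in> graftings T. glues \<phi> y}"
       "card {y \<in> graftings T. glues \<phi> y} = card (aut (ptrees P) T)"
      using finite_aut_ptree[OF T] by (simp_all add: bij_betw_finite bij_betw_same_card[symmetric] aut_def)
  qed
  show "finite (graftings T)" by (subst U) (intro finite_UN_I fin c)
  have "card (graftings T) = (\<Sum>\<phi>\<in>realised T. card {y \<in> graftings T. glues \<phi> y})"
  proof (subst U, rule card_UN_disjoint[OF fin])
    have "\<phi> = \<psi>" if "\<phi> \<in> gluing_data" "\<psi> \<in> gluing_data" "y \<in> graftings T" "glues \<phi> y" "glues \<psi> y" for \<phi> \<psi> y
      using ex1_gluing[OF T that(3)] that by blast
    then show "\<forall>\<phi>\<in>realised T. \<forall>\<psi>\<in>realised T. \<phi> \<noteq> \<psi> \<longrightarrow>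
        {y \<in> graftings T. glues \<phi> y} \<inter> {y \<in> graftings T. glues \<psi> y} = {}"
      unfolding realised_def by blast
  qed (use c in blast)
  then show "card (graftings T) = card (realised T) * card (aut (ptrees P) T)" by (simp add: c)
qed

text \<open>Existence is the glued tree, moved to the chosen representative of its class by the
  action. Uniqueness is \<open>act_trans\<close> between two trees that realise the same
  data.\<close>

lemma realised_ex1:
  assumes \<phi>: "\<phi> \<in> gluing_data"
  shows "\<exists>!c. c \<in> pi0 (ptrees P) \<and> \<phi> \<in> realised (rep c)"
proof -
  interpret C: graft_construction P S0 D \<phi> using \<phi> by unfold_locales
  obtain T y where T: "is_ptree P T" and y: "y \<in> graftings T" "glues \<phi> y" using C.graft_exists by blast
  let ?c = "ptree_class P T"
  have c: "?c \<in> pi0 (ptrees P)" using T by (intro iso_class_in_pi0) simp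
  note r = rep_pi0[OF ptrees_groupoid c]
  have "hom (ptrees P) T (rep ?c) \<noteq> {}"
    using iso_class_eq_iff[OF ptrees_groupoid, of T "rep ?c"] r T by simp
  then obtain u where u: "u \<in> ptree_isos P T (rep ?c)" by auto
  have rp: "is_ptree P (rep ?c)" using r by simp
  obtain S h k where yy: "y = (S, h, k)" by (cases y)
  interpret G: grafted P S0 D T S h k using T y(1) yy by unfold_locales auto
  have "\<phi> \<in> realised (rep ?c)"
    using G.act_graftings[OF rp u] \<phi> y(2) yy unfolding realised_def by blast
  moreover have "c' = ?c" if c': "c' \<in> pi0 (ptrees P)" "\<phi> \<in> realised (rep c')" for c'
  proof -
    obtain S' h' k' where y': "(S', h', k') \<in> graftings (rep c')" "glues \<phi> (S', h', k')"
      using c'(2) by (auto simp: realised_def)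
    note r' = rep_pi0[OF ptrees_groupoid c'(1)]
    have "ptree_isos P T (rep c') \<noteq> {}"
      using G.act_trans[OF _ y'(1) \<phi>] y(2) y'(2) r'(1) yy by auto
    then show "c' = ?c" using iso_class_eq_iff[OF ptrees_groupoid, of T "rep c'"] r' T by simp
  qed
  ultimately show ?thesis using c by blast
qed

text \<open>Since |graftings|/|Aut| is the number of realised data, the sum counts every element of
  \<open>gluing_data\<close> once. The finite range \<open>C\<close> is left open so that a common
  one can serve for several choices of \<open>D\<close>.\<close>

lemma sum_graftings:
  shows "finite {c \<in> pi0 (ptrees P). graftings (rep c) \<noteq> {}}"
    and "finite C \<Longrightarrow> {c \<in> pi0 (ptrees P). graftings (rep c) \<noteq> {}} \<subseteq> C \<Longrightarrow> C \<subseteq> pi0 (ptrees P) \<Longrightarrow>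
      (\<Sum>c\<in>C. (of_nat (card (graftings (rep c))) :: rat) / of_nat (card (aut (ptrees P) (rep c)))) =
      of_nat (\<Prod>l\<in>leaves S0. card (hom (gI P) (colA (D l) (root (D l))) (colA S0 l)))"
proof -
  have rp: "is_ptree P (rep c)" if "c \<in> pi0 (ptrees P)" for c
    using rep_pi0(1)[OF ptrees_groupoid that] by simp
  \<comment> \<open>The class of the tree glued along \<open>\<phi>\<close>; its fibres are the sets
    of realised data.\<close>
  define cl where "cl \<phi> = (THE c. c \<in> pi0 (ptrees P) \<and> \<phi> \<in> realised (rep c))" for \<phi>
  have cl: "cl \<phi> = c \<longleftrightarrow> \<phi> \<in> realised (rep c)" if "\<phi> \<in> gluing_data" "c \<in> pi0 (ptrees P)" for \<phi> c
    using realised_ex1[OF that(1)] that(2) unfolding cl_def by (metis (mono_tags, lifting) theI')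
  have clpi: "cl \<phi> \<in> pi0 (ptrees P)" if "\<phi> \<in> gluing_data" for \<phi>
    using realised_ex1[OF that] unfolding cl_def by (metis (mono_tags, lifting) theI')
  have ne: "graftings (rep c) \<noteq> {} \<longleftrightarrow> realised (rep c) \<noteq> {}" if "c \<in> pi0 (ptrees P)" for c
    using ex1_gluing[OF rp[OF that]] unfolding realised_def by blast
  have img: "{c \<in> pi0 (ptrees P). graftings (rep c) \<noteq> {}} = cl ` gluing_data"
    using ne cl clpi unfolding realised_def by blast
  then show "finite {c \<in> pi0 (ptrees P). graftings (rep c) \<noteq> {}}" using finite_gluing_data by simp
  assume C: "finite C" "{c \<in> pi0 (ptrees P). graftings (rep c) \<noteq> {}} \<subseteq> C" "C \<subseteq> pi0 (ptrees P)"
  have real: "realised (rep c) = {\<phi> \<in> gluing_data. cl \<phi> = c}" if "c \<in> C" for c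
    using cl C(3) that by (auto simp: realised_def)
  have "(\<Sum>c\<in>C. (of_nat (card (graftings (rep c))) :: rat) / of_nat (card (aut (ptrees P) (rep c)))) =
     (\<Sum>c\<in>C. of_nat (card (realised (rep c))))"
  proof (rule sum.cong)
    fix c assume "c \<in> C"
    then have r: "is_ptree P (rep c)" using C(3) rp by blast
    have "card (aut (ptrees P) (rep c)) > 0"
      using card_aut_pos[OF ptrees_groupoid] r finite_aut by simp
    then show "(of_nat (card (graftings (rep c))) :: rat) / of_nat (card (aut (ptrees P) (rep c))) = of_nat (card (realised (rep c)))"
      using card_graftings(2)[OF r] by simp
  qed simp
  also have "\<dots> = of_nat (\<Sum>c\<in>C. card {\<phi> \<in> gluing_data. cl \<phi> = c})" using real by simp
  also have "(\<Sum>c\<in>C. card {\<phi> \<in> gluing_data. cl \<phi> = c}) = card gluing_data"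
  proof -
    have "(\<Sum>c\<in>C. \<Sum>\<phi>\<in>{\<phi> \<in> gluing_data. cl \<phi> = c}. 1) = (\<Sum>\<phi>\<in>gluing_data. (1::nat))"
      by (rule sum.group) (use finite_gluing_data C img in auto)
    then show ?thesis by simp
  qed
  also have "card gluing_data = (\<Prod>l\<in>leaves S0. card (hom (gI P) (colA (D l) (root (D l))) (colA S0 l)))"
    unfolding gluing_data_def by (rule card_PiE[OF finite_leaves0])
  finally show "(\<Sum>c\<in>C. (of_nat (card (graftings (rep c))) :: rat) / of_nat (card (aut (ptrees P) (rep c)))) =
      of_nat (\<Prod>l\<in>leaves S0. card (hom (gI P) (colA (D l) (root (D l))) (colA S0 l)))" .
qed

text \<open>The second way of counting: choose the cut, then the isomorphism with \<open>S0\<close>,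
  then one isomorphism for each leaf independently.\<close>

lemma card_graftings_cuts:
  assumes T: "is_ptree P T"
  shows "card (graftings T) = (\<Sum>S\<in>cuts T. \<Sum>h\<in>ptree_isos P S0 S. \<Prod>l\<in>leaves S0. card (ptree_isos P (D l) (ideal_subtree T (mapA h l))))"
proof -
  have "graftings T = (SIGMA S:cuts T. SIGMA h:ptree_isos P S0 S.
      (\<Pi>\<^sub>E l\<in>leaves S0. ptree_isos P (D l) (ideal_subtree T (mapA h l))))"
    unfolding graftings_def by blast
  moreover have f1: "finite (ptree_isos P S0 S)" if "S \<in> cuts T" for S
    using finite_isos[OF S0 cut_ptree[OF T that]] .
  moreover have "finite (\<Pi>\<^sub>E l\<in>leaves S0. ptree_isos P (D l) (ideal_subtree T (mapA h l)))"
    if S: "S \<in> cuts T" and h: "h \<in> ptree_isos P S0 S" for S h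
  proof (intro finite_PiE finite_leaves0 finite_isos D ideal_ptree T)
    fix l assume "l \<in> leaves S0"
    then show "mapA h l \<in> edges T" using isoD(11)[OF tS0 h leaf0] cutsD(3)[OF ptreeD(1)[OF T] S] by blast
  qed
  ultimately show ?thesis
    using finite_cuts[OF ptreeD(1)[OF T]] by (simp add: card_SigmaI card_PiE[OF finite_leaves0])
qed

end

section \<open>Cuts with prescribed crown and bottom\<close>

context finite_polynomial_diagram begin

text \<open>The coefficient of the comultiplication of a tree at the pair \<open>(a, {#s#})\<close>,
  as \<open>lookup_comult_tree\<close> confirms.\<close>

definition cut_count where
  "cut_count T a s = card {S \<in> cuts T. forest_monomial P (crown T S) = a \<and> ptree_class P S = s}"

lemma card_isos_rep:
  assumes "c \<in> pi0 (ptrees P)" "is_ptree P T"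
  shows "card (ptree_isos P (rep c) T) = (if ptree_class P T = c then card (aut (ptrees P) (rep c)) else 0)"
proof -
  note r = rep_pi0[OF ptrees_groupoid assms(1)]
  have "ptree_class P T = c \<longleftrightarrow> ptree_isos P (rep c) T \<noteq> {}"
    using iso_class_eq_iff[OF ptrees_groupoid, of "rep c" T] r assms(2) by auto
  then show ?thesis
    using card_hom_eq_card_aut[OF ptrees_groupoid, of "rep c" T] r assms(2) by auto
qed

text \<open>All distributions of the factors of the monomial \<open>a\<close> over the leaves of
  \<open>S\<close>. Each distribution is counted separately, which absorbs the symmetries of the
  forest. The values lie in the support of \<open>a\<close> to make the set visibly finite.\<close>

definition labellings where
  "labellings S a = {F \<in> leaves S \<rightarrow>\<^sub>E pi0 (ptrees P) \<inter> set_mset a. image_mset F (mset_set (leaves S)) = a}"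

lemma finite_labellings: "is_ptree P S \<Longrightarrow> finite (labellings S a)"
  unfolding labellings_def
  by (rule finite_subset[of _ "leaves S \<rightarrow>\<^sub>E pi0 (ptrees P) \<inter> set_mset a"]) (auto intro!: finite_PiE finite_leaves)

lemma labelling_grafting:
  assumes "is_ptree P S" "F \<in> labellings S a"
  shows "grafting_finite P S (\<lambda>l. rep (F l))"
proof unfold_locales
  fix l assume "l \<in> leaves S"
  then have "F l \<in> pi0 (ptrees P)" using assms(2) by (auto simp: labellings_def)
  then show "is_ptree P (rep (F l))" using rep_pi0(1)[OF ptrees_groupoid] by fastforce
qed (use assms finite_aut in auto)

abbreviation aut_card where "aut_card c \<equiv> (of_nat (card (aut (ptrees P) (rep c))) :: rat)"

lemma aut_card_pos: "c \<in> pi0 (ptrees P) \<Longrightarrow> aut_card c > 0"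
  using card_aut_pos[OF ptrees_groupoid] finite_aut rep_pi0(1)[OF ptrees_groupoid] by (metis of_nat_0_less_iff)

text \<open>A cut \<open>S\<close> and an isomorphism \<open>h\<close> onto it dictate one
  labelling, the classes of the ideal subtrees; it is admissible iff the crown has monomial
  \<open>a\<close>. For this labelling the isomorphisms \<open>k\<close> number the product of the
  |Aut|, for every other one there are none. After division each pair of \<open>S\<close> and
  \<open>h\<close> counts once, and a cut of class \<open>s\<close> admits |Aut(rep s)| choices of
  \<open>h\<close>.\<close>

lemma cut_count_graftings:
  assumes s: "s \<in> pi0 (ptrees P)" and T: "is_ptree P T"
  shows "(of_nat (cut_count T a s) :: rat) * aut_card s =
    (\<Sum>F\<in>labellings (rep s) a. of_nat (card (grafting.graftings P (rep s) (\<lambda>l. rep (F l)) T)) / (\<Prod>l\<in>leaves (rep s). aut_card (F l)))"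
proof -
  let ?S0 = "rep s" and ?L = "leaves (rep s)"
  have S0: "is_ptree P ?S0" using rep_pi0(1)[OF ptrees_groupoid s] by simp
  note fL = finite_leaves[OF S0]
  have tS0: "is_tree ?S0" by (rule ptreeD(1)[OF S0])
  let ?F = "\<lambda>h. restrict (\<lambda>l. ptree_class P (ideal_subtree T (mapA h l))) ?L"
  have edge: "mapA h l \<in> edges T" if "S \<in> cuts T" "h \<in> ptree_isos P ?S0 S" "l \<in> ?L" for S h l
    using isoD(11)[OF tS0 that(2), of l] cutsD(3)[OF ptreeD(1)[OF T] that(1)] that(3) by (auto simp: leaves_def)
  have img: "image_mset (?F h) (mset_set ?L) = forest_monomial P (crown T S)"
    if S: "S \<in> cuts T" and h: "h \<in> ptree_isos P ?S0 S" for S h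
  proof -
    interpret H: tree_isomorphism ?S0 S "mapA h" "mapM h" "mapN h"
      using isoD(4)[OF tS0 h] tS0 by unfold_locales
    have "inj_on (mapA h) ?L" by (rule inj_on_subset[OF H.inj(1)]) (auto simp: leaves_def)
    then have "mset_set (leaves S) = image_mset (mapA h) (mset_set ?L)"
      unfolding H.leaves by (rule image_mset_mset_set[symmetric])
    then have "forest_monomial P (crown T S) = image_mset (\<lambda>l. ptree_class P (ideal_subtree T (mapA h l))) (mset_set ?L)"
      by (simp add: forest_monomial_def crown_def multiset.map_comp comp_def)
    also have "\<dots> = image_mset (?F h) (mset_set ?L)"
      by (rule image_mset_cong) (use fL in auto)
    finally show ?thesis by simp
  qed
  have mem: "?F h \<in> labellings ?S0 a \<longleftrightarrow> forest_monomial P (crown T S) = a"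
    if S: "S \<in> cuts T" and h: "h \<in> ptree_isos P ?S0 S" for S h
  proof -
    have "?F h l \<in> pi0 (ptrees P)" if "l \<in> ?L" for l
      using that iso_class_in_pi0[of "ideal_subtree T (mapA h l)" "ptrees P"] ideal_ptree[OF T edge[OF S h that]] by simp
    moreover have "?F h l \<in># image_mset (?F h) (mset_set ?L)" if "l \<in> ?L" for l
      using that fL by (simp only: set_image_mset finite_set_mset_mset_set) blast
    ultimately show ?thesis using img[OF S h] by (auto simp: labellings_def PiE_iff)
  qed
  have fac: "(\<Prod>l\<in>?L. card (ptree_isos P (rep (F l)) (ideal_subtree T (mapA h l)))) =
      (if F = ?F h then \<Prod>l\<in>?L. card (aut (ptrees P) (rep (F l))) else 0)"
    if S: "S \<in> cuts T" and h: "h \<in> ptree_isos P ?S0 S" and F: "F \<in> labellings ?S0 a" for S h F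
  proof -
    have Fp: "F l \<in> pi0 (ptrees P)" if "l \<in> ?L" for l using F that by (auto simp: labellings_def)
    have Fext: "F \<in> extensional ?L" using F by (auto simp: labellings_def PiE_iff)
    have c: "card (ptree_isos P (rep (F l)) (ideal_subtree T (mapA h l))) =
       (if ptree_class P (ideal_subtree T (mapA h l)) = F l then card (aut (ptrees P) (rep (F l))) else 0)" if "l \<in> ?L" for l
      by (rule card_isos_rep[OF Fp[OF that] ideal_ptree[OF T edge[OF S h that]]])
    show ?thesis
    proof (cases "F = ?F h")
      case True
      have "ptree_class P (ideal_subtree T (mapA h l)) = F l" if "l \<in> ?L" for l
        using fun_cong[OF True, of l] that by simp
      then show ?thesis using True c by (auto intro!: prod.cong)
    next
      case False
      then obtain l where "l \<in> ?L" "F l \<noteq> ptree_class P (ideal_subtree T (mapA h l))"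
        using extensionalityI[OF Fext, of "?F h"] by force
      then have "\<exists>l\<in>?L. card (ptree_isos P (rep (F l)) (ideal_subtree T (mapA h l))) = 0" using c by (intro bexI[of _ l]) auto
      then show ?thesis using False prod_zero[OF fL] by simp
    qed
  qed
  have pos: "(\<Prod>l\<in>?L. aut_card (F l)) \<noteq> 0" if "F \<in> labellings ?S0 a" for F
  proof -
    have "F l \<in> pi0 (ptrees P)" if "l \<in> ?L" for l using \<open>F \<in> _\<close> that by (auto simp: labellings_def)
    then show ?thesis using aut_card_pos fL by (fastforce simp: prod_zero_iff)
  qed
  have "(\<Sum>F\<in>labellings ?S0 a. of_nat (card (grafting.graftings P ?S0 (\<lambda>l. rep (F l)) T)) / (\<Prod>l\<in>?L. aut_card (F l)))
    = (\<Sum>F\<in>labellings ?S0 a. \<Sum>S\<in>cuts T. \<Sum>h\<in>ptree_isos P ?S0 S. if F = ?F h then 1 else 0)"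
  proof (rule sum.cong[OF refl])
    fix F assume F: "F \<in> labellings ?S0 a"
    interpret G: grafting_finite P ?S0 "\<lambda>l. rep (F l)" by (rule labelling_grafting[OF S0 F])
    have "card (G.graftings T) = (\<Sum>S\<in>cuts T. \<Sum>h\<in>ptree_isos P ?S0 S. if F = ?F h then \<Prod>l\<in>?L. card (aut (ptrees P) (rep (F l))) else 0)"
      unfolding G.card_graftings_cuts[OF T] by (intro sum.cong refl fac F)
    also have "(of_nat \<dots> :: rat) = (\<Sum>S\<in>cuts T. \<Sum>h\<in>ptree_isos P ?S0 S. if F = ?F h then 1 else 0) * (\<Prod>l\<in>?L. aut_card (F l))"
      unfolding of_nat_sum sum_distrib_right by (intro sum.cong refl) simp
    finally have e: "(of_nat (card (G.graftings T)) :: rat) = (\<Sum>S\<in>cuts T. \<Sum>h\<in>ptree_isos P ?S0 S. if F = ?F h then 1 else 0) * (\<Prod>l\<in>?L. aut_card (F l))" .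
    show "of_nat (card (G.graftings T)) / (\<Prod>l\<in>?L. aut_card (F l)) =
        (\<Sum>S\<in>cuts T. \<Sum>h\<in>ptree_isos P ?S0 S. if F = ?F h then 1 else 0)"
      unfolding e by (rule nonzero_mult_div_cancel_right[OF pos[OF F]])
  qed
  \<comment> \<open>With the labelling summed innermost, at most one term survives for each pair of
    \<open>S\<close> and \<open>h\<close>.\<close>
  also have "\<dots> = (\<Sum>S\<in>cuts T. \<Sum>h\<in>ptree_isos P ?S0 S. \<Sum>F\<in>labellings ?S0 a. if F = ?F h then 1 else 0)"
    by (subst sum.swap, intro sum.cong refl, rule sum.swap)
  also have "\<dots> = (\<Sum>S\<in>cuts T. \<Sum>h\<in>ptree_isos P ?S0 S. if forest_monomial P (crown T S) = a then 1 else 0)"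
    by (intro sum.cong refl) (simp only: sum.delta[OF finite_labellings[OF S0]] mem)
  also have "\<dots> = (\<Sum>S\<in>cuts T. if forest_monomial P (crown T S) = a \<and> ptree_class P S = s then aut_card s else 0)"
    by (intro sum.cong refl) (use card_isos_rep[OF s cut_ptree[OF T]] in auto)
  also have "\<dots> = of_nat (cut_count T a s) * aut_card s"
    unfolding cut_count_def using finite_cuts[OF ptreeD(1)[OF T]]
    by (simp add: sum.If_cases Int_def)
  finally show ?thesis by simp
qed

text \<open>\<open>cut_count_graftings\<close> turns cuts into graftings with fixed bottom and fixed
  crown trees. Exchanging the two summations lets \<open>sum_graftings\<close> evaluate the sum over
  all trees for each labelling separately.\<close>

lemma finite_cut_classes:
  assumes s: "s \<in> pi0 (ptrees P)"
  shows "finite {c \<in> pi0 (ptrees P). cut_count (rep c) a s \<noteq> 0}"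
    "(\<Sum>c | c \<in> pi0 (ptrees P) \<and> cut_count (rep c) a s \<noteq> 0. of_nat (cut_count (rep c) a s) / aut_card c) =
     (1 / aut_card s) * (\<Sum>F\<in>labellings (rep s) a. \<Prod>l\<in>leaves (rep s).
        of_nat (card (hom (gI P) (colA (rep (F l)) (root (rep (F l)))) (colA (rep s) l))) / aut_card (F l))"
proof -
  let ?S0 = "rep s" and ?L = "leaves (rep s)"
  have S0: "is_ptree P ?S0" using rep_pi0(1)[OF ptrees_groupoid s] by simp
  define g where "g F c = card (grafting.graftings P ?S0 (\<lambda>l. rep (F l)) (rep c))" for F c
  \<comment> \<open>One finite set of classes that contains the support for every labelling, so the
    summations can be exchanged.\<close>
  define C where "C = (\<Union>F\<in>labellings ?S0 a. {c \<in> pi0 (ptrees P). grafting.graftings P ?S0 (\<lambda>l. rep (F l)) (rep c) \<noteq> {}})"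
  have C: "finite C" "C \<subseteq> pi0 (ptrees P)"
    unfolding C_def using finite_labellings[OF S0] grafting_finite.sum_graftings(1)[OF labelling_grafting[OF S0]]
    by blast+
  have cc: "of_nat (cut_count (rep c) a s) = 
     (1 / aut_card s) * (\<Sum>F\<in>labellings ?S0 a. of_nat (g F c) / (\<Prod>l\<in>?L. aut_card (F l)))" if "c \<in> pi0 (ptrees P)" for c
    using cut_count_graftings[OF s, of "rep c" a] rep_pi0(1)[OF ptrees_groupoid that] aut_card_pos[OF s]
    by (simp add: g_def field_simps)
  have sub: "{c \<in> pi0 (ptrees P). cut_count (rep c) a s \<noteq> 0} \<subseteq> C"
  proof
    fix c assume "c \<in> {c \<in> pi0 (ptrees P). cut_count (rep c) a s \<noteq> 0}"
    then have c: "c \<in> pi0 (ptrees P)" "cut_count (rep c) a s \<noteq> 0" by auto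
    then have "(\<Sum>F\<in>labellings ?S0 a. of_nat (g F c) / (\<Prod>l\<in>?L. aut_card (F l))) \<noteq> 0"
      using cc[OF c(1)] by auto
    then obtain F where "F \<in> labellings ?S0 a" "g F c \<noteq> 0"
      by (metis (no_types, lifting) div_0 of_nat_0 sum.neutral)
    then have "grafting.graftings P ?S0 (\<lambda>l. rep (F l)) (rep c) \<noteq> {}" unfolding g_def by (metis card.empty)
    with \<open>F \<in> _\<close> show "c \<in> C" using c(1) unfolding C_def by blast
  qed
  then show "finite {c \<in> pi0 (ptrees P). cut_count (rep c) a s \<noteq> 0}" using C(1) finite_subset by blast
  have "(\<Sum>c | c \<in> pi0 (ptrees P) \<and> cut_count (rep c) a s \<noteq> 0. of_nat (cut_count (rep c) a s) / aut_card c) =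
     (\<Sum>c\<in>C. of_nat (cut_count (rep c) a s) / aut_card c)"
    using C(2) by (intro sum.mono_neutral_left C(1) sub) auto
  also have "\<dots> = (\<Sum>c\<in>C. \<Sum>F\<in>labellings ?S0 a. (1 / aut_card s) * (of_nat (g F c) / aut_card c / (\<Prod>l\<in>?L. aut_card (F l))))"
  proof (rule sum.cong[OF refl])
    fix c assume "c \<in> C"
    then show "of_nat (cut_count (rep c) a s) / aut_card c =
       (\<Sum>F\<in>labellings ?S0 a. (1 / aut_card s) * (of_nat (g F c) / aut_card c / (\<Prod>l\<in>?L. aut_card (F l))))"
      using cc[of c] C(2) by (simp add: subset_iff sum_divide_distrib sum_distrib_left mult_ac)
  qed
  also have "\<dots> = (\<Sum>F\<in>labellings ?S0 a. \<Sum>c\<in>C. (1 / aut_card s) * (of_nat (g F c) / aut_card c / (\<Prod>l\<in>?L. aut_card (F l))))"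
    by (rule sum.swap)
  also have "\<dots> = (\<Sum>F\<in>labellings ?S0 a. (1 / aut_card s) * ((\<Sum>c\<in>C. of_nat (g F c) / aut_card c) / (\<Prod>l\<in>?L. aut_card (F l))))"
    by (simp only: sum_distrib_left sum_divide_distrib)
  also have "\<dots> = (\<Sum>F\<in>labellings ?S0 a. (1 / aut_card s) * (\<Prod>l\<in>?L.
        of_nat (card (hom (gI P) (colA (rep (F l)) (root (rep (F l)))) (colA ?S0 l))) / aut_card (F l)))"
  proof (rule sum.cong[OF refl])
    fix F assume F: "F \<in> labellings ?S0 a"
    have "(\<Sum>c\<in>C. of_nat (g F c) / aut_card c) =
       of_nat (\<Prod>l\<in>?L. card (hom (gI P) (colA (rep (F l)) (root (rep (F l)))) (colA ?S0 l)))"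
      unfolding g_def by (rule grafting_finite.sum_graftings(2)[OF labelling_grafting[OF S0 F] C(1) _ C(2)])
        (use F in \<open>auto simp: C_def\<close>)
    then show "(1 / aut_card s) * ((\<Sum>c\<in>C. of_nat (g F c) / aut_card c) / (\<Prod>l\<in>?L. aut_card (F l))) =
      (1 / aut_card s) * (\<Prod>l\<in>?L.
        of_nat (card (hom (gI P) (colA (rep (F l)) (root (rep (F l)))) (colA ?S0 l))) / aut_card (F l))"
      by (simp add: prod_dividef)
  qed
  finally show "(\<Sum>c | c \<in> pi0 (ptrees P) \<and> cut_count (rep c) a s \<noteq> 0. of_nat (cut_count (rep c) a s) / aut_card c) =
     (1 / aut_card s) * (\<Sum>F\<in>labellings (rep s) a. \<Prod>l\<in>leaves (rep s).
        of_nat (card (hom (gI P) (colA (rep (F l)) (root (rep (F l)))) (colA (rep s) l))) / aut_card (F l))"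
    by (simp only: sum_distrib_left)
qed

end

section \<open>Mass of a homotopy fibre; products of linear series\<close>

lemma homotopy_fibre_simps:
  "(x, \<phi>) \<in> obs (homotopy_fibre G H F v) \<longleftrightarrow> x \<in> obs G \<and> \<phi> \<in> hom H (on_ob F x) v"
  "f \<in> hom (homotopy_fibre G H F v) (x, \<phi>) (y, \<psi>) \<longleftrightarrow> f \<in> hom G x y \<and> cmp H \<psi> (on_arr F f) = \<phi>"
  "idn (homotopy_fibre G H F v) (x, \<phi>) = idn G x"
  "cmp (homotopy_fibre G H F v) = cmp G"
  by (auto simp: homotopy_fibre_def)

lemma homotopy_fibre_groupoid:
  assumes G: "is_groupoid G" and H: "is_groupoid H" and F: "is_functor G H F" and v: "v \<in> obs H"
  shows "is_groupoid (homotopy_fibre G H F v)"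
proof -
  let ?X = "homotopy_fibre G H F v"
  note f = is_functorD[OF F]
  show ?thesis
    unfolding is_groupoid_def split_paired_Ball_Sigma
  proof (intro conjI ballI)
    fix x assume "x \<in> obs (?X)"
    then show "idn (?X) x \<in> hom (?X) x x"
      using groupoid_idn[OF G] groupoid_idr[OF H _ v] f by (cases x) (simp add: homotopy_fibre_simps)
  next
    fix x y z s t
    assume a: "x \<in> obs (?X)" "y \<in> obs (?X)" "z \<in> obs (?X)"
      "s \<in> hom (?X) x y" "t \<in> hom (?X) y z"
    obtain x1 x2 y1 y2 z1 z2 where e: "x = (x1, x2)" "y = (y1, y2)" "z = (z1, z2)" by (cases x; cases y; cases z)
    note b = a[unfolded e homotopy_fibre_simps]
    have o: "on_ob F x1 \<in> obs H" "on_ob F y1 \<in> obs H" "on_ob F z1 \<in> obs H" using b f(1) by auto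
    have m: "on_arr F s \<in> hom H (on_ob F x1) (on_ob F y1)" "on_arr F t \<in> hom H (on_ob F y1) (on_ob F z1)"
      using b f(3) by auto
    have "cmp H z2 (on_arr F (cmp G t s)) = x2"
      using f(4)[of x1 y1 z1 s t] groupoid_assoc[OF H o v m, of z2] b by simp
    then show "cmp (?X) t s \<in> hom (?X) x z"
      unfolding e homotopy_fibre_simps using groupoid_cmp[OF G, of x1 y1 z1 s t] b by simp
  next
    fix x y s
    assume a: "x \<in> obs (?X)" "y \<in> obs (?X)"
      "s \<in> hom (?X) x y"
    obtain x1 x2 y1 y2 where e: "x = (x1, x2)" "y = (y1, y2)" by (cases x; cases y)
    note b = a[unfolded e homotopy_fibre_simps]
    have bb: "x1 \<in> obs G" "y1 \<in> obs G" "s \<in> hom G x1 y1" using b by auto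
    show "cmp (?X) s (idn (?X) x) = s"
      "cmp (?X) (idn (?X) y) s = s"
      unfolding e homotopy_fibre_simps using groupoid_idr[OF G bb] groupoid_idl[OF G bb] by auto
    note i = ginv[OF G bb]
    have o: "on_ob F x1 \<in> obs H" "on_ob F y1 \<in> obs H" using b f(1) by auto
    have m: "on_arr F (ginv G x1 y1 s) \<in> hom H (on_ob F y1) (on_ob F x1)" "on_arr F s \<in> hom H (on_ob F x1) (on_ob F y1)"
      using f(3) bb i by auto
    have "cmp H x2 (on_arr F (ginv G x1 y1 s)) = cmp H y2 (cmp H (on_arr F s) (on_arr F (ginv G x1 y1 s)))"
      using groupoid_assoc[OF H o(2,1,2) v m, of y2] b by simp
    also have "\<dots> = cmp H y2 (on_arr F (idn G y1))" using f(4)[of y1 x1 y1 "ginv G x1 y1 s" s] bb i by simp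
    also have "\<dots> = y2" using f(2) groupoid_idr[OF H o(2) v] b by simp
    finally have "ginv G x1 y1 s \<in> hom (?X) y x"
      unfolding e homotopy_fibre_simps using i by simp
    moreover have "cmp (?X) (ginv G x1 y1 s) s = idn (?X) x \<and>
      cmp (?X) s (ginv G x1 y1 s) = idn (?X) y"
      unfolding e homotopy_fibre_simps using i(2,3) by simp
    ultimately show "\<exists>g\<in>hom (?X) y x.
      cmp (?X) g s = idn (?X) x \<and>
      cmp (?X) s g = idn (?X) y"
      by (intro bexI[of _ "ginv G x1 y1 s"])
  next
    fix w x y z s t r
    assume a: "w \<in> obs (?X)" "x \<in> obs (?X)" "y \<in> obs (?X)" "z \<in> obs (?X)"
      "s \<in> hom (?X) w x" "t \<in> hom (?X) x y" "r \<in> hom (?X) y z"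
    obtain w1 w2 x1 x2 y1 y2 z1 z2 where e: "w = (w1, w2)" "x = (x1, x2)" "y = (y1, y2)" "z = (z1, z2)"
      by (cases w; cases x; cases y; cases z)
    note b = a[unfolded e homotopy_fibre_simps]
    show "cmp (?X) r (cmp (?X) t s) =
       cmp (?X) (cmp (?X) r t) s"
      unfolding homotopy_fibre_simps using groupoid_assoc[OF G, of w1 x1 y1 z1 s t r] b by simp
  qed
qed

lemma card_hom_eq_card_aut':
  assumes "is_groupoid G" "x \<in> obs G" "y \<in> obs G" "hom G x y \<noteq> {}"
  shows "card (hom G x y) = card (aut G y)"
proof -
  obtain u where "u \<in> hom G x y" using assms(4) by blast
  from groupoid_bij_pre[OF assms(1,2,3,3) this] show ?thesis by (simp add: aut_def bij_betw_same_card)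
qed

text \<open>The classes in \<open>K\<close> are the orbits of the automorphisms of \<open>x0\<close>
  on the arrows from \<open>F x0\<close> to \<open>v\<close>, and automorphism groups in the fibre
  are the stabilisers. A representative of a class has an underlying object merely isomorphic to
  \<open>x0\<close>, so the count runs through arrows from \<open>x0\<close> to that object instead
  of automorphisms of \<open>x0\<close>.\<close>

lemma homotopy_fibre_mass:
  fixes F :: "('o, 'a, 'p, 'b) funct"
  assumes G: "is_groupoid G" and H: "is_groupoid H" and F: "is_functor G H F" and v: "v \<in> obs H"
    and x0: "x0 \<in> obs G" and finG: "finite (aut G x0)" and finH: "finite (hom H (on_ob F x0) v)"
  defines "K \<equiv> {c \<in> pi0 (homotopy_fibre G H F v). iso_class G (fst (rep c)) = iso_class G x0}"
  shows "finite K"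
    "(\<Sum>c\<in>K. 1 / of_nat (card (aut (homotopy_fibre G H F v) (rep c)))) =
      (of_nat (card (hom H (on_ob F x0) v)) / of_nat (card (aut G x0)) :: rat)"
    "c \<in> K \<Longrightarrow> card (aut (homotopy_fibre G H F v) (rep c)) > 0"
proof -
  let ?X = "homotopy_fibre G H F v"
  let ?h = "hom H (on_ob F x0) v"
  have X: "is_groupoid ?X" by (rule homotopy_fibre_groupoid[OF G H F v])
  note f = is_functorD[OF F]
  define cl where "cl \<phi> = iso_class ?X (x0, \<phi>)" for \<phi>
  have ob: "(x0, \<phi>) \<in> obs ?X" if "\<phi> \<in> ?h" for \<phi> using that x0 by (simp add: homotopy_fibre_simps)
  have clK: "cl \<phi> \<in> K" if "\<phi> \<in> ?h" for \<phi>
  proof -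
    have c: "cl \<phi> \<in> pi0 ?X" unfolding cl_def by (rule iso_class_in_pi0[OF ob[OF that]])
    obtain x \<psi> where r: "rep (cl \<phi>) = (x, \<psi>)" by (cases "rep (cl \<phi>)")
    note rr = rep_pi0[OF X c]
    have "hom ?X (x0, \<phi>) (x, \<psi>) \<noteq> {}"
      using iso_class_eq_iff[OF X ob[OF that] rr(1)] rr(2) r by (simp add: cl_def)
    then obtain u where "u \<in> hom ?X (x0, \<phi>) (x, \<psi>)" by blast
    then have "hom G x0 x \<noteq> {}" unfolding homotopy_fibre_simps by blast
    moreover have "x \<in> obs G" using rr(1) r by (simp add: homotopy_fibre_simps)
    ultimately have "iso_class G x0 = iso_class G x" using iso_class_eq_iff[OF G x0] by blast
    then show ?thesis using c r by (simp add: K_def)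
  qed
  have cnt: "K \<subseteq> cl ` ?h" "c \<in> K \<Longrightarrow> card {\<phi> \<in> ?h. cl \<phi> = c} * card (aut ?X (rep c)) = card (aut G x0)" for c
  proof -
    have *: "\<exists>\<phi>\<in>?h. cl \<phi> = c" "card {\<phi> \<in> ?h. cl \<phi> = c} * card (aut ?X (rep c)) = card (aut G x0)" if cK: "c \<in> K" for c
    proof -
      have c: "c \<in> pi0 ?X" "iso_class G (fst (rep c)) = iso_class G x0" using cK by (auto simp: K_def)
      note rr = rep_pi0[OF X c(1)]
      obtain x \<psi> where r: "rep c = (x, \<psi>)" by (cases "rep c")
      have x: "x \<in> obs G" "\<psi> \<in> hom H (on_ob F x) v" using rr(1) r by (simp_all add: homotopy_fibre_simps)
      have ne: "hom G x0 x \<noteq> {}" using iso_class_eq_iff[OF G x0 x(1)] c(2) r by simp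
      have fin: "finite (hom G x0 x)" by (rule finite_hom[OF G x0 x(1) finG])
      \<comment> \<open>The orbit map: an arrow \<open>u\<close> from \<open>x0\<close> to
        \<open>x\<close> pulls \<open>\<psi>\<close> back to the arrow \<open>\<phi>\<close> for
        which \<open>u\<close> is a morphism of the fibre. The fibre of \<open>p\<close> over
        \<open>\<phi>\<close> is thus a hom-set of \<open>?X\<close>.\<close>
      define p where "p u = cmp H \<psi> (on_arr F u)" for u
      have p: "p u \<in> ?h" if "u \<in> hom G x0 x" for u
        unfolding p_def by (rule groupoid_cmp[OF H f(1)[OF x0] f(1)[OF x(1)] v f(3)[OF x0 x(1) that] x(2)])
      have hp: "u \<in> hom ?X (x0, \<phi>) (rep c) \<longleftrightarrow> u \<in> hom G x0 x \<and> p u = \<phi>" for u \<phi>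
        by (simp add: r homotopy_fibre_simps p_def)
      have clc: "cl \<phi> = c \<longleftrightarrow> hom ?X (x0, \<phi>) (rep c) \<noteq> {}" if "\<phi> \<in> ?h" for \<phi>
        using iso_class_eq_iff[OF X ob[OF that] rr(1)] rr(2) by (simp add: cl_def)
      have pcl: "cl (p u) = c" if "u \<in> hom G x0 x" for u using clc[OF p[OF that]] hp that by blast
      show "\<exists>\<phi>\<in>?h. cl \<phi> = c" using ne p pcl by blast
      have "(\<Sum>\<phi>\<in>{\<phi> \<in> ?h. cl \<phi> = c}. \<Sum>u\<in>{u \<in> hom G x0 x. p u = \<phi>}. 1) = (\<Sum>u\<in>hom G x0 x. (1::nat))"
        by (rule sum.group[OF fin]) (use finH p pcl in auto)
      then have "card (hom G x0 x) = (\<Sum>\<phi>\<in>{\<phi> \<in> ?h. cl \<phi> = c}. card {u \<in> hom G x0 x. p u = \<phi>})" by simp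
      also have "\<dots> = (\<Sum>\<phi>\<in>{\<phi> \<in> ?h. cl \<phi> = c}. card (aut ?X (rep c)))"
      proof (rule sum.cong[OF refl])
        fix \<phi> assume a: "\<phi> \<in> {\<phi> \<in> ?h. cl \<phi> = c}"
        have "{u \<in> hom G x0 x. p u = \<phi>} = hom ?X (x0, \<phi>) (rep c)" using hp by blast
        then show "card {u \<in> hom G x0 x. p u = \<phi>} = card (aut ?X (rep c))"
          using card_hom_eq_card_aut'[OF X ob rr(1), of \<phi>] clc[of \<phi>] a by simp
      qed
      finally show "card {\<phi> \<in> ?h. cl \<phi> = c} * card (aut ?X (rep c)) = card (aut G x0)"
        using card_hom_eq_card_aut[OF G x0 x(1) ne] by simp
    qed
    show "K \<subseteq> cl ` ?h" using *(1) by blast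
    show "c \<in> K \<Longrightarrow> card {\<phi> \<in> ?h. cl \<phi> = c} * card (aut ?X (rep c)) = card (aut G x0)" by (rule *(2))
  qed
  show K: "finite K" using cnt(1) finH finite_surj by blast
  have pos: "card (aut G x0) > 0" by (rule card_aut_pos[OF G x0 finG])
  show cp: "card (aut ?X (rep c)) > 0" if "c \<in> K" for c using cnt(2)[OF that] pos by (metis gr0I mult_0_right)
  have "(\<Sum>c\<in>K. 1 / of_nat (card (aut ?X (rep c)))) = (\<Sum>c\<in>K. (of_nat (card {\<phi> \<in> ?h. cl \<phi> = c}) :: rat) / of_nat (card (aut G x0)))"
  proof (rule sum.cong[OF refl])
    fix c assume "c \<in> K"
    have "(of_nat (card {\<phi> \<in> ?h. cl \<phi> = c}) :: rat) * of_nat (card (aut ?X (rep c))) = of_nat (card (aut G x0))"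
      using cnt(2)[OF \<open>c \<in> K\<close>] by (metis of_nat_mult)
    then show "1 / of_nat (card (aut ?X (rep c))) = (of_nat (card {\<phi> \<in> ?h. cl \<phi> = c}) :: rat) / of_nat (card (aut G x0))"
      using cp[OF \<open>c \<in> K\<close>] pos by (simp add: field_simps)
  qed
  also have "\<dots> = of_nat (\<Sum>c\<in>K. card {\<phi> \<in> ?h. cl \<phi> = c}) / of_nat (card (aut G x0))"
    by (simp add: sum_divide_distrib)
  also have "(\<Sum>c\<in>K. card {\<phi> \<in> ?h. cl \<phi> = c}) = card ?h"
  proof -
    have "(\<Sum>c\<in>K. \<Sum>\<phi>\<in>{\<phi> \<in> ?h. cl \<phi> = c}. 1) = (\<Sum>\<phi>\<in>?h. (1::nat))"
      by (rule sum.group[OF finH K]) (use clK in auto)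
    then show ?thesis by simp
  qed
  finally show "(\<Sum>c\<in>K. 1 / of_nat (card (aut ?X (rep c)))) = (of_nat (card ?h) / of_nat (card (aut G x0)) :: rat)" .
qed

section \<open>Coefficients of linear series and of their products\<close>

lemma coeff_formal_sum: "coeff (formal_sum F K) m = (\<Sum>k | k \<in> K \<and> coeff (F k) m \<noteq> 0. coeff (F k) m)"
  by (simp add: formal_sum_def)

lemma coeff_scale [simp]: "coeff (series_scale r f) m = r * coeff f m"
  by (simp add: series_scale_def)

lemma coeff_tensor [simp]: "coeff (series_tensor f g) (a, b) = coeff f a * coeff g b"
  by (simp add: series_tensor_def)

lemma coeff_series_of_poly [simp]: "coeff (series_of_poly p) m = Poly_Mapping.lookup p m"
  by (simp add: series_of_poly_def)

lemma coeff_delta [simp]: "coeff (delta c) m = (if m = {#c#} then 1 else 0)"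
  by (auto simp: delta_def lookup_single when_def)

definition linear_series :: "'t multiset series \<Rightarrow> ('t \<Rightarrow> rat) \<Rightarrow> bool" where
  "linear_series f w \<longleftrightarrow> (\<forall>c. coeff f {#c#} = w c) \<and> (\<forall>m. size m \<noteq> 1 \<longrightarrow> coeff f m = 0)"

text \<open>Several indices may share the same variable \<open>t k\<close>, and their weights add
  up. This happens for the rooted Green functions, where different objects of the fibre can have the
  same underlying tree.\<close>

lemma linear_series_formal_sum:
  "linear_series (formal_sum (\<lambda>k. series_scale (w k) (delta (t k))) K) (\<lambda>c. \<Sum>k | k \<in> K \<and> t k = c \<and> w k \<noteq> 0. w k)"
  unfolding linear_series_def coeff_formal_sum
  by (auto intro!: sum.cong sum.neutral)

definition maps_onto :: "'l set \<Rightarrow> 't multiset \<Rightarrow> ('l \<Rightarrow> 't) set" where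
  "maps_onto L a = {F \<in> extensional L. image_mset F (mset_set L) = a}"

lemma maps_onto_range: "finite L \<Longrightarrow> F \<in> maps_onto L a \<Longrightarrow> l \<in> L \<Longrightarrow> F l \<in># a"
  by (auto simp: maps_onto_def)

lemma finite_maps_onto:
  assumes "finite L"
  shows "finite (maps_onto L a)"
proof (rule finite_subset)
  show "maps_onto L a \<subseteq> L \<rightarrow>\<^sub>E set_mset a"
  proof
    fix F assume F: "F \<in> maps_onto L a"
    then have "F \<in> extensional L" by (simp add: maps_onto_def)
    then show "F \<in> L \<rightarrow>\<^sub>E set_mset a" using maps_onto_range[OF assms F] by (simp add: PiE_iff)
  qed
  show "finite (L \<rightarrow>\<^sub>E set_mset a)" by (rule finite_PiE[OF assms]) simp
qed

text \<open>Expanding a product of linear series means picking one variable \<open>F l\<close> from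
  each factor; a choice contributes to the monomial formed by its values. The factors stay indexed
  by \<open>L\<close>, so equal monomials from different choices are summed.\<close>

lemma coeff_prod_linear:
  fixes f :: "'l \<Rightarrow> 't multiset series"
  assumes "finite L" "\<And>l. l \<in> L \<Longrightarrow> linear_series (f l) (w l)"
  shows "coeff (\<Prod>l\<in>L. f l) a = (\<Sum>F\<in>maps_onto L a. \<Prod>l\<in>L. w l (F l))"
  using assms
proof (induction L arbitrary: a rule: finite_induct)
  case empty
  have "maps_onto {} a = (if a = {#} then {\<lambda>_. undefined} else {} :: ('l \<Rightarrow> 't) set)"
    by (auto simp: maps_onto_def)
  then show ?case by (simp add: one_series_def)
next
  case (insert l L)
  have fl: "coeff (f l) {#c#} = w l c" "size m \<noteq> 1 \<Longrightarrow> coeff (f l) m = 0" for c m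
    using insert.prems[of l] by (auto simp: linear_series_def)
  have "coeff (\<Prod>l\<in>insert l L. f l) a = (\<Sum>(x, y) | x + y = a. coeff (f l) x * coeff (\<Prod>l\<in>L. f l) y)"
    using insert.hyps by (simp add: times_series_def)
  \<comment> \<open>The factor at \<open>l\<close> is linear, so only splittings with a single
    variable on the left contribute.\<close>
  also have "\<dots> = (\<Sum>(x, y)\<in>(\<lambda>c. ({#c#}, a - {#c#})) ` set_mset a. coeff (f l) x * coeff (\<Prod>l\<in>L. f l) y)"
  proof (rule sum.mono_neutral_right[OF finite_splits])
    show "(\<lambda>c. ({#c#}, a - {#c#})) ` set_mset a \<subseteq> {(x, y). x + y = a}" by auto
    show "\<forall>i\<in>{(x, y). x + y = a} - (\<lambda>c. ({#c#}, a - {#c#})) ` set_mset a.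
       (case i of (x, y) \<Rightarrow> coeff (f l) x * coeff (\<Prod>l\<in>L. f l) y) = 0"
    proof safe
      fix x y assume xy: "a = x + y" "(x, y) \<notin> (\<lambda>c. ({#c#}, x + y - {#c#})) ` set_mset (x + y)"
      have "size x \<noteq> 1"
      proof
        assume "size x = 1"
        then obtain c where "x = {#c#}" using size_1_singleton_mset by blast
        then have "(x, y) = (\<lambda>c. ({#c#}, x + y - {#c#})) c" "c \<in># x + y" by auto
        then show False using xy(2) by blast
      qed
      then show "coeff (f l) x * coeff (\<Prod>l\<in>L. f l) y = 0" using fl(2) by simp
    qed
  qed
  also have "\<dots> = (\<Sum>c\<in>set_mset a. w l c * coeff (\<Prod>l\<in>L. f l) (a - {#c#}))"
    by (subst sum.reindex) (auto simp: inj_on_def fl(1))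
  also have "\<dots> = (\<Sum>c\<in>set_mset a. \<Sum>F\<in>maps_onto L (a - {#c#}). w l c * (\<Prod>l\<in>L. w l (F l)))"
    using insert.IH insert.prems by (simp add: sum_distrib_left)
  also have "\<dots> = (\<Sum>(c, F)\<in>(SIGMA c:set_mset a. maps_onto L (a - {#c#})). w l c * (\<Prod>l\<in>L. w l (F l)))"
    by (subst sum.Sigma) (use finite_maps_onto[OF insert.hyps(1)] in auto)
  also have "\<dots> = (\<Sum>F\<in>maps_onto (insert l L) a. \<Prod>l\<in>insert l L. w l (F l))"
  \<comment> \<open>A choice on the larger set is its value at \<open>l\<close> together with the
    remaining choice, reset to \<open>undefined\<close> at \<open>l\<close> to stay
    extensional.\<close>
  proof (rule sum.reindex_bij_witness[where i = "\<lambda>F. (F l, F(l := undefined))" and j = "\<lambda>(c, F). F(l := c)"]; clarsimp)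
    fix c F assume c: "c \<in># a" and F: "F \<in> maps_onto L (a - {#c#})"
    then show "F(l := undefined) = F" using insert.hyps by (auto simp: maps_onto_def extensional_def)
    have "image_mset (F(l := c)) (mset_set L) = image_mset F (mset_set L)"
      using insert.hyps by (intro image_mset_cong) auto
    then show "F(l := c) \<in> maps_onto (insert l L) a"
      using c F insert.hyps by (auto simp: maps_onto_def extensional_def)
    have "(\<Prod>la\<in>L. w la ((F(l := c)) la)) = (\<Prod>l\<in>L. w l (F l))" using insert.hyps by (intro prod.cong) auto
    then show "(\<Prod>la\<in>insert l L. w la (if la = l then c else F la)) = w l c * (\<Prod>l\<in>L. w l (F l))"
      using insert.hyps by (simp add: fun_upd_def)
  next
    fix F assume F: "F \<in> maps_onto (insert l L) a"
    have "image_mset (F(l := undefined)) (mset_set L) = image_mset F (mset_set L)"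
      using insert.hyps by (intro image_mset_cong) auto
    then show "F l \<in># a \<and> F(l := undefined) \<in> maps_onto L (a - {#F l#})"
      using F insert.hyps by (auto simp: maps_onto_def extensional_def)
  qed
  finally show ?case .
qed

section \<open>Green functions\<close>

lemma families_simps:
  "(X, N) \<in> obs (families I) \<longleftrightarrow> finite X \<and> N \<in> X \<rightarrow> obs I"
  "h \<in> hom (families I) (X, N) (X', N') \<longleftrightarrow> fam_dm h = X \<and> bij_betw (fam_map h) X X' \<and>
        fam_map h \<in> extensional X \<and> fam_nat h \<in> (\<Pi>\<^sub>E x\<in>X. hom I (N x) (N' (fam_map h x)))"
  by (auto simp: families_def)

text \<open>Translates the leaf condition in \<open>green_leaves\<close> into equality of
  multi-indices. Conversely to the evident direction, equal multiplicities give a bijection within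
  each colour class; these are glued, and an arrow is chosen at every point.\<close>

lemma family_hom_iff:
  assumes I: "is_groupoid I" and X: "(X, N) \<in> obs (families I)" and X': "(X', N') \<in> obs (families I)"
  shows "hom (families I) (X, N) (X', N') \<noteq> {} \<longleftrightarrow> family_class I (X, N) = family_class I (X', N')"
proof
  have N: "\<And>x. x \<in> X \<Longrightarrow> N x \<in> obs I" "\<And>x. x \<in> X' \<Longrightarrow> N' x \<in> obs I" using X X' by (auto simp: families_simps)
  let ?A = "\<lambda>c. {x \<in> X. iso_class I (N x) = c}" and ?A' = "\<lambda>c. {x \<in> X'. iso_class I (N' x) = c}"
  {
    assume "hom (families I) (X, N) (X', N') \<noteq> {}"
    then obtain h where h: "h \<in> hom (families I) (X, N) (X', N')" by blast
    have b: "bij_betw (fam_map h) X X'" and n: "\<And>x. x \<in> X \<Longrightarrow> fam_nat h x \<in> hom I (N x) (N' (fam_map h x))"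
      using h by (auto simp: families_simps)
    have m: "fam_map h x \<in> X'" if "x \<in> X" for x using b that by (rule bij_betw_apply)
    have "iso_class I (N x) = iso_class I (N' (fam_map h x))" if "x \<in> X" for x
      using iso_class_eq_iff[OF I N(1)[OF that] N(2)[OF m[OF that]]] n[OF that] by blast
    then have "?A' c = fam_map h ` ?A c" for c using b unfolding bij_betw_def by auto
    moreover have "inj_on (fam_map h) (?A c)" for c using b unfolding bij_betw_def by (auto intro: inj_on_subset)
    ultimately show "family_class I (X, N) = family_class I (X', N')"
      by (simp add: family_class_def card_image)
  }
  {
    assume e: "family_class I (X, N) = family_class I (X', N')"
    have fin: "finite X" "finite X'" using X X' by (auto simp: families_simps)
    have "\<exists>f. bij_betw f (?A c) (?A' c)" for c
      using fun_cong[OF e, of c] fin by (intro finite_same_card_bij) (auto simp: family_class_def)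
    then obtain b where b: "\<And>c. bij_betw (b c) (?A c) (?A' c)" by metis
    have bA: "b c x \<in> ?A' c" if "x \<in> ?A c" for c x using bij_betw_apply[OF b that] .
    define f where "f = restrict (\<lambda>x. b (iso_class I (N x)) x) X"
    have "bij_betw f (\<Union>c\<in>UNIV. ?A c) (\<Union>c\<in>UNIV. ?A' c)"
    proof (rule bij_betw_glue[where f = b])
      fix c d x y assume x: "x \<in> ?A c" and y: "y \<in> ?A d"
      show "b c x = b d y \<longleftrightarrow> x = y"
      proof (cases "c = d")
        case True
        then show ?thesis using b[of c] x y by (metis (no_types, lifting) bij_betw_def inj_on_eq_iff)
      next
        case False
        then show ?thesis using x y bA[OF x] bA[OF y] by auto
      qed
    qed (use b in \<open>auto simp: f_def\<close>)
    moreover have "(\<Union>c\<in>UNIV. ?A c) = X" "(\<Union>c\<in>UNIV. ?A' c) = X'" by auto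
    ultimately have bij: "bij_betw f X X'" by simp
    have cls: "hom I (N x) (N' (f x)) \<noteq> {}" if x: "x \<in> X" for x
    proof -
      have "f x \<in> ?A' (iso_class I (N x))" using bA[of x "iso_class I (N x)"] x by (simp add: f_def)
      then show ?thesis using iso_class_eq_iff[OF I N(1)[OF x] N(2)] by auto
    qed
    define g where "g = restrict (\<lambda>x. SOME u. u \<in> hom I (N x) (N' (f x))) X"
    have "g \<in> (\<Pi>\<^sub>E x\<in>X. hom I (N x) (N' (f x)))"
      using cls by (auto simp: g_def some_in_eq)
    then have "\<lparr>fam_dm = X, fam_map = f, fam_nat = g\<rparr> \<in> hom (families I) (X, N) (X', N')"
      using bij by (simp add: families_simps f_def)
    then show "hom (families I) (X, N) (X', N') \<noteq> {}" by blast
  }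
qed

lemma bij_betw_preimage: "bij_betw g X A \<Longrightarrow> bij_betw g {x \<in> X. Q (g x)} {a \<in> A. Q a}"
  by (auto simp: bij_betw_def inj_on_def)

text \<open>Guarantees that the family chosen in \<open>green_leaves\<close> has the prescribed
  class. The finitely many colour classes, repeated according to \<open>n\<close>, are enumerated by
  natural numbers.\<close>

lemma family_of_class:
  assumes I: "is_groupoid I" and fin: "finite (pi0 I)" and n: "n \<in> multi_indices I"
  shows "\<exists>N. N \<in> obs (families I) \<and> family_class I N = n"
proof -
  let ?A = "SIGMA c:pi0 I. {..<n c}"
  have fA: "finite ?A" using fin by auto
  obtain e where e: "bij_betw e ?A {0..<card ?A}" using ex_bij_betw_finite_nat[OF fA] by blast
  define g where "g = inv_into ?A e"
  have g: "bij_betw g {0..<card ?A} ?A" unfolding g_def by (rule bij_betw_inv_into[OF e])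
  define N where "N i = rep (fst (g i))" for i
  have gi: "fst (g i) \<in> pi0 I" if "i \<in> {0..<card ?A}" for i
    using bij_betw_apply[OF g that] by auto
  have "({0..<card ?A}, N) \<in> obs (families I)"
    using rep_pi0(1)[OF I gi] by (auto simp: families_simps N_def)
  moreover have "family_class I ({0..<card ?A}, N) = n"
  proof
    fix c
    have "{i \<in> {0..<card ?A}. iso_class I (N i) = c} = {i \<in> {0..<card ?A}. fst (g i) = c}"
      using rep_pi0(2)[OF I gi] by (auto simp: N_def)
    moreover have "bij_betw g {i \<in> {0..<card ?A}. fst (g i) = c} {p \<in> ?A. fst p = c}"
      by (rule bij_betw_preimage[OF g])
    ultimately have "family_class I ({0..<card ?A}, N) c = card {p \<in> ?A. fst p = c}"
      by (simp add: family_class_def bij_betw_same_card)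
    also have "{p \<in> ?A. fst p = c} = (if c \<in> pi0 I then Pair c ` {..<n c} else {})" by auto
    also have "card \<dots> = n c" using n by (auto simp: card_image inj_on_def multi_indices_def)
    finally show "family_class I ({0..<card ?A}, N) c = n c" .
  qed
  ultimately show ?thesis by blast
qed

context polynomial_diagram begin

lemma root_functor: "is_functor (ptrees P) (gI P) (root_functor P)"
proof -
  have ri: "mapA f (root S) = root T" if "is_ptree P S" "f \<in> ptree_isos P S T" for S T f
  proof -
    interpret tree_isomorphism S T "mapA f" "mapM f" "mapN f"
      using isoD(4)[OF ptreeD(1)[OF that(1)] that(2)] ptreeD(1)[OF that(1)] by unfold_locales
    show ?thesis using root by simp
  qed
  show ?thesis
    unfolding is_functor_def
  proof (intro conjI ballI)
    fix x assume "x \<in> obs (ptrees P)"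
    then have x: "is_ptree P x" by simp
    then show "on_ob (root_functor P) x \<in> obs (gI P)"
      "on_arr (root_functor P) (idn (ptrees P) x) = idn (gI P) (on_ob (root_functor P) x)"
      using ptreeD(2)[OF x root_edge[OF x]] root_edge[OF x] by (simp_all add: root_functor_def)
  next
    fix x y f assume "x \<in> obs (ptrees P)" "y \<in> obs (ptrees P)" "f \<in> hom (ptrees P) x y"
    then have x: "is_ptree P x" and f: "f \<in> ptree_isos P x y" by auto
    show "on_arr (root_functor P) f \<in> hom (gI P) (on_ob (root_functor P) x) (on_ob (root_functor P) y)"
      using isoD(1)[OF ptreeD(1)[OF x] f] isoD(5)[OF ptreeD(1)[OF x] f root_edge[OF x]] ri[OF x f] by (simp add: root_functor_def)
  next
    fix x y z f g assume "x \<in> obs (ptrees P)" "y \<in> obs (ptrees P)" "z \<in> obs (ptrees P)"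
      "f \<in> hom (ptrees P) x y" "g \<in> hom (ptrees P) y z"
    then have x: "is_ptree P x" "is_ptree P y" and f: "f \<in> ptree_isos P x y" "g \<in> ptree_isos P y z" by auto
    show "on_arr (root_functor P) (cmp (ptrees P) g f) = cmp (gI P) (on_arr (root_functor P) g) (on_arr (root_functor P) f)"
      using isoD(1)[OF ptreeD(1)[OF x(1)] f(1)] isoD(1)[OF ptreeD(1)[OF x(2)] f(2)] ri[OF x(1) f(1)] root_edge[OF x(1)]
      by (simp add: root_functor_def)
  qed
qed

end

section \<open>Green functions of P as linear series\<close>

locale faa_di_bruno = finite_polynomial_diagram P for P :: "('i, 'ia, 'e, 'ea, 'b, 'ba) poly_diagram" +
  assumes finite_colours: "finite (pi0 (gI P))"
begin

lemma rep_ptree: "c \<in> pi0 (ptrees P) \<Longrightarrow> is_ptree P (rep c)" "c \<in> pi0 (ptrees P) \<Longrightarrow> ptree_class P (rep c) = c"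
  using rep_pi0[OF ptrees_groupoid] by auto

lemma class_pi0: "is_ptree P T \<Longrightarrow> ptree_class P T \<in> pi0 (ptrees P)"
  by (intro iso_class_in_pi0) simp

lemma inverse_aut_card_nonzero: "c \<in> pi0 (ptrees P) \<Longrightarrow> 1 / aut_card c \<noteq> 0"
  using aut_card_pos[of c] by simp

lemma green_linear: "linear_series (green P) (\<lambda>c. if c \<in> pi0 (ptrees P) then 1 / aut_card c else 0)"
proof -
  have "(\<Sum>k | k \<in> pi0 (ptrees P) \<and> k = c \<and> 1 / aut_card k \<noteq> 0. 1 / aut_card k) =
     (if c \<in> pi0 (ptrees P) then 1 / aut_card c else 0)" for c
  proof -
    have "{k. k \<in> pi0 (ptrees P) \<and> k = c \<and> 1 / aut_card k \<noteq> 0} = {k. k = c \<and> c \<in> pi0 (ptrees P)}"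
      using inverse_aut_card_nonzero by blast
    then show ?thesis by (simp only:) simp
  qed
  then show ?thesis
    using linear_series_formal_sum[of "\<lambda>k. 1 / aut_card k" "\<lambda>k. k" "pi0 (ptrees P)"] by (simp add: green_def)
qed

text \<open>The mass of the part of the homotopy fibre over \<open>v\<close> whose underlying tree
  has class \<open>c\<close>; it becomes the coefficient of that variable in G_v.\<close>

definition root_weight where
  "root_weight v c = (if c \<in> pi0 (ptrees P)
     then of_nat (card (hom (gI P) (colA (rep c) (root (rep c))) v)) / aut_card c else 0)"

lemma green_rooted_linear:
  assumes v: "v \<in> obs (gI P)"
  shows "linear_series (green_rooted P v) (root_weight v)"
proof -
  let ?X = "ptrees_rooted P v"
  let ?w = "\<lambda>k. 1 / (of_nat (card (aut ?X (rep k))) :: rat)"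
  have X: "is_groupoid ?X"
    unfolding ptrees_rooted_def by (rule homotopy_fibre_groupoid[OF ptrees_groupoid gpd(1) root_functor v])
  have "(\<Sum>k | k \<in> pi0 ?X \<and> ptree_class P (fst (rep k)) = c \<and> ?w k \<noteq> 0. ?w k) = root_weight v c" for c
  proof (cases "c \<in> pi0 (ptrees P)")
    case True
    note r = rep_ptree[OF True]
    have ob: "on_ob (root_functor P) (rep c) = colA (rep c) (root (rep c))" by (simp add: root_functor_def)
    have fH: "finite (hom (gI P) (on_ob (root_functor P) (rep c)) v)"
      unfolding ob by (rule finite_hom_colour[OF ptreeD(2)[OF r(1) root_edge[OF r(1)]] v])
    have fG: "finite (aut (ptrees P) (rep c))" and oG: "rep c \<in> obs (ptrees P)" using finite_aut r by auto
    note mass = homotopy_fibre_mass[OF ptrees_groupoid gpd(1) root_functor v oG fG fH,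
        folded ptrees_rooted_def, unfolded r(2) ob]
    \<comment> \<open>Automorphism groups in the fibre are finite and nonempty, so no weight
      vanishes and the support condition disappears.\<close>
    have "{k. k \<in> pi0 ?X \<and> ptree_class P (fst (rep k)) = c \<and> ?w k \<noteq> 0} = {k \<in> pi0 ?X. ptree_class P (fst (rep k)) = c}"
      using mass(3) by fastforce
    then show ?thesis using mass(2) True by (simp add: root_weight_def)
  next
    case False
    have "ptree_class P (fst (rep k)) \<in> pi0 (ptrees P)" if "k \<in> pi0 ?X" for k
    proof -
      have "rep k \<in> obs ?X" by (rule rep_pi0(1)[OF X that])
      then have "fst (rep k) \<in> obs (ptrees P)"
        unfolding ptrees_rooted_def by (cases "rep k") (simp add: homotopy_fibre_simps)
      then show ?thesis by (rule iso_class_in_pi0)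
    qed
    then have "{k. k \<in> pi0 ?X \<and> ptree_class P (fst (rep k)) = c \<and> ?w k \<noteq> 0} = {}" using False by auto
    then show ?thesis using False unfolding root_weight_def by (simp only: sum.empty if_False)
  qed
  then show ?thesis
    using linear_series_formal_sum[of ?w "\<lambda>k. ptree_class P (fst (rep k))" "pi0 ?X"] by (simp add: green_rooted_def)
qed

definition leaf_class where
  "leaf_class s = family_class (gI P) (leaves (rep s), colA (rep s))"

lemma leaf_family: "is_ptree P T \<Longrightarrow> (leaves T, colA T) \<in> obs (families (gI P))"
  using finite_leaves ptreeD(2) by (auto simp: families_simps leaves_def)

lemma leaf_class_multi_index: "s \<in> pi0 (ptrees P) \<Longrightarrow> leaf_class s \<in> multi_indices (gI P)"
  unfolding multi_indices_def mem_Collect_eq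
proof (intro allI impI)
  fix c assume s: "s \<in> pi0 (ptrees P)" and c: "c \<notin> pi0 (gI P)"
  have "iso_class (gI P) (colA (rep s) l) \<in> pi0 (gI P)" if "l \<in> leaves (rep s)" for l
    using iso_class_in_pi0[OF ptreeD(2)[OF rep_ptree(1)[OF s]]] that by (simp add: leaves_def)
  then have "{l \<in> leaves (rep s). iso_class (gI P) (colA (rep s) l) = c} = {}" using c by blast
  then show "leaf_class s c = 0" unfolding leaf_class_def family_class_def by (simp only: fst_conv snd_conv card.empty)
qed

text \<open>Translation by an arrow between the two colours. It permits replacing the
  representatives of colour classes in \<open>green_power\<close> by the actual colours of
  leaves.\<close>

lemma root_weight_cong:
  assumes "v \<in> obs (gI P)" "w \<in> obs (gI P)" "iso_class (gI P) v = iso_class (gI P) w"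
  shows "root_weight v c = root_weight w c"
proof (cases "c \<in> pi0 (ptrees P)")
  case True
  note r = rep_ptree(1)[OF True]
  obtain u where u: "u \<in> hom (gI P) v w" using iso_class_eq_iff[OF gpd(1) assms(1,2)] assms(3) by blast
  show ?thesis
    using bij_betw_same_card[OF groupoid_bij_post[OF gpd(1) ptreeD(2)[OF r root_edge[OF r]] assms(1,2) u]]
    by (simp add: root_weight_def)
qed (simp add: root_weight_def)

text \<open>The exponent of a colour class is the number of leaves of \<open>rep s\<close> in that
  class, so the product over colours regroups into one factor per leaf, to which
  \<open>coeff_prod_linear\<close> applies.\<close>

lemma coeff_green_power:
  assumes s: "s \<in> pi0 (ptrees P)"
  shows "coeff (green_power P (leaf_class s)) a = (\<Sum>F\<in>labellings (rep s) a. \<Prod>l\<in>leaves (rep s).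
        of_nat (card (hom (gI P) (colA (rep (F l)) (root (rep (F l)))) (colA (rep s) l))) / aut_card (F l))"
proof -
  let ?S = "rep s" and ?L = "leaves (rep s)"
  let ?cl = "\<lambda>l. iso_class (gI P) (colA ?S l)"
  note S = rep_ptree(1)[OF s]
  have fL: "finite ?L" by (rule finite_leaves[OF S])
  have ob: "colA ?S l \<in> obs (gI P)" if "l \<in> ?L" for l using ptreeD(2)[OF S] that by (simp add: leaves_def)
  have cl: "?cl l \<in> pi0 (gI P)" if "l \<in> ?L" for l by (rule iso_class_in_pi0[OF ob[OF that]])
  have "green_power P (leaf_class s) = (\<Prod>v\<in>pi0 (gI P). \<Prod>l\<in>{l \<in> ?L. ?cl l = v}. green_rooted P (rep (?cl l)))"
    unfolding green_power_def
  proof (rule prod.cong[OF refl])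
    fix v
    have "(\<Prod>l\<in>{l \<in> ?L. ?cl l = v}. green_rooted P (rep (?cl l))) = (\<Prod>l\<in>{l \<in> ?L. ?cl l = v}. green_rooted P (rep v))"
      by (rule prod.cong) auto
    then show "green_rooted P (rep v) ^ leaf_class s v = (\<Prod>l\<in>{l \<in> ?L. ?cl l = v}. green_rooted P (rep (?cl l)))"
      by (simp add: leaf_class_def family_class_def)
  qed
  also have "\<dots> = (\<Prod>l\<in>?L. green_rooted P (rep (?cl l)))"
    by (rule prod.group[OF fL finite_colours]) (use cl in auto)
  finally have "coeff (green_power P (leaf_class s)) a = (\<Sum>F\<in>maps_onto ?L a. \<Prod>l\<in>?L. root_weight (rep (?cl l)) (F l))"
    using coeff_prod_linear[OF fL green_rooted_linear[OF rep_pi0(1)[OF gpd(1) cl]]] by simp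
  also have "\<dots> = (\<Sum>F\<in>maps_onto ?L a. \<Prod>l\<in>?L. root_weight (colA ?S l) (F l))"
    by (intro sum.cong prod.cong refl root_weight_cong) (use rep_pi0[OF gpd(1) cl] ob in auto)
  also have "\<dots> = (\<Sum>F\<in>labellings ?S a. \<Prod>l\<in>?L. root_weight (colA ?S l) (F l))"
  \<comment> \<open>A choice that is no labelling takes some value which is no class of P-trees, and
    there the weight is zero.\<close>
  proof (rule sum.mono_neutral_right[OF finite_maps_onto[OF fL]])
    show "labellings ?S a \<subseteq> maps_onto ?L a"
      by (auto simp: labellings_def maps_onto_def PiE_iff)
    show "\<forall>F\<in>maps_onto ?L a - labellings ?S a. (\<Prod>l\<in>?L. root_weight (colA ?S l) (F l)) = 0"
    proof
      fix F assume F: "F \<in> maps_onto ?L a - labellings ?S a"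
      then obtain l where l: "l \<in> ?L" "F l \<notin> pi0 (ptrees P)"
        using maps_onto_range[OF fL, of F a] by (auto simp: labellings_def maps_onto_def PiE_iff)
      then have "root_weight (colA ?S l) (F l) = 0" by (simp add: root_weight_def)
      then show "(\<Prod>l\<in>?L. root_weight (colA ?S l) (F l)) = 0" using fL l(1) by (intro prod_zero) auto
    qed
  qed
  also have "\<dots> = (\<Sum>F\<in>labellings ?S a. \<Prod>l\<in>?L.
        of_nat (card (hom (gI P) (colA (rep (F l)) (root (rep (F l)))) (colA ?S l))) / aut_card (F l))"
    by (intro sum.cong prod.cong refl) (auto simp: labellings_def root_weight_def PiE_iff)
  finally show ?thesis .
qed

text \<open>By \<open>family_hom_iff\<close> the trees selected by the chosen family are those with
  leaf multi-index \<open>n\<close>, whichever family of this class was chosen.\<close>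

lemma green_leaves_linear:
  assumes n: "n \<in> multi_indices (gI P)"
  shows "linear_series (green_leaves P n) (\<lambda>s. if s \<in> pi0 (ptrees P) \<and> leaf_class s = n then 1 / aut_card s else 0)"
proof -
  define N where "N = (SOME N. N \<in> obs (families (gI P)) \<and> family_class (gI P) N = n)"
  have N: "N \<in> obs (families (gI P))" "family_class (gI P) N = n"
    using someI_ex[OF family_of_class[OF gpd(1) finite_colours n]] by (simp_all add: N_def)
  let ?K = "{c \<in> pi0 (ptrees P). hom (families (gI P)) (on_ob (leaf_functor P) (rep c)) N \<noteq> {}}"
  have K: "c \<in> ?K \<longleftrightarrow> c \<in> pi0 (ptrees P) \<and> leaf_class c = n" for c
    using family_hom_iff[OF gpd(1) leaf_family[OF rep_ptree(1)], of c "fst N" "snd N"] N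
    by (auto simp: leaf_functor_def leaf_class_def)
  have "(\<Sum>k | k \<in> ?K \<and> k = s \<and> 1 / aut_card k \<noteq> 0. 1 / aut_card k) =
     (if s \<in> pi0 (ptrees P) \<and> leaf_class s = n then 1 / aut_card s else 0)" for s
  proof -
    have "{k. k \<in> ?K \<and> k = s \<and> 1 / aut_card k \<noteq> 0} = {k. k = s \<and> s \<in> pi0 (ptrees P) \<and> leaf_class s = n}"
      unfolding K using inverse_aut_card_nonzero by blast
    also have "(\<Sum>k\<in>\<dots>. 1 / aut_card k) =
        (if s \<in> pi0 (ptrees P) \<and> leaf_class s = n then 1 / aut_card s else 0)"
      by (cases "s \<in> pi0 (ptrees P) \<and> leaf_class s = n") (auto intro!: sum.neutral)
    finally show ?thesis .
  qed
  then show ?thesis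
    using linear_series_formal_sum[of "\<lambda>k. 1 / aut_card k" "\<lambda>k. k" ?K] by (simp add: green_leaves_def N_def Let_def)
qed

section \<open>Coefficients of the comultiplication and the comparison\<close>

lemma lookup_comult_tree:
  assumes "is_ptree P T"
  shows "Poly_Mapping.lookup (comult_tree P T) (a, {#s#}) = of_nat (cut_count T a s)"
    "size b \<noteq> 1 \<Longrightarrow> Poly_Mapping.lookup (comult_tree P T) (a, b) = 0"
proof -
  have l: "Poly_Mapping.lookup (comult_tree P T) (a, b) =
      (\<Sum>S\<in>cuts T. if forest_monomial P (crown T S) = a \<and> {#ptree_class P S#} = b then 1 else 0)" for b
    unfolding comult_tree_def lookup_sum by (intro sum.cong refl) (simp add: lookup_single when_def)
  show "Poly_Mapping.lookup (comult_tree P T) (a, {#s#}) = of_nat (cut_count T a s)"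
    unfolding l cut_count_def using finite_cuts[OF ptreeD(1)[OF assms]]
    by (simp add: sum.If_cases Int_def)
  show "size b \<noteq> 1 \<Longrightarrow> Poly_Mapping.lookup (comult_tree P T) (a, b) = 0"
    unfolding l by (intro sum.neutral) auto
qed

lemma coeff_comult_monomial:
  "coeff (comult_monomial P Q) m = Poly_Mapping.lookup (\<Prod>c\<in>#Q. comult_tree P (rep c)) m"
proof -
  have "Poly_Mapping.single 0 (1::rat) = (1 :: (_ \<Rightarrow>\<^sub>0 rat))" by simp
  then show ?thesis by (simp add: comult_monomial_def comult_def)
qed

lemma cut_count_pi0: "is_ptree P T \<Longrightarrow> cut_count T a s \<noteq> 0 \<Longrightarrow> s \<in> pi0 (ptrees P)"
  using class_pi0[OF cut_ptree] by (auto simp: cut_count_def card_eq_0_iff)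

text \<open>Each tree in \<open>Q\<close> contributes exactly one tree to the right factor, which
  fixes the degree of \<open>Q\<close>, and a part of \<open>a\<close> to the left factor. These two
  facts bound the monomials \<open>Q\<close> that reach a given pair.\<close>

lemma keys_prod_comult:
  assumes "set_mset Q \<subseteq> pi0 (ptrees P)" "(a, b) \<in> Poly_Mapping.keys (\<Prod>c\<in>#Q. comult_tree P (rep c))"
  shows "size b = size Q \<and> (\<forall>c\<in>#Q. \<exists>a' s. a' \<subseteq># a \<and> s \<in># b \<and> cut_count (rep c) a' s \<noteq> 0)"
  using assms
proof (induction Q arbitrary: a b)
  case empty
  then have "(a, b) = 0" by (auto split: if_splits)
  then show ?case by (simp add: zero_prod_def)
next
  case (add c Q)
  from add.prems(2) have "(a, b) \<in> Poly_Mapping.keys (comult_tree P (rep c) * (\<Prod>c\<in>#Q. comult_tree P (rep c)))" by simp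
  then obtain a1 b1 a2 b2 where 1: "(a1, b1) \<in> Poly_Mapping.keys (comult_tree P (rep c))"
    and 2: "(a2, b2) \<in> Poly_Mapping.keys (\<Prod>c\<in>#Q. comult_tree P (rep c))" and ab: "a = a1 + a2" "b = b1 + b2"
    using keys_mult[of "comult_tree P (rep c)" "\<Prod>c\<in>#Q. comult_tree P (rep c)"] by fastforce
  have c: "is_ptree P (rep c)" using add.prems(1) rep_ptree(1) by simp
  have ne: "Poly_Mapping.lookup (comult_tree P (rep c)) (a1, b1) \<noteq> 0" using 1 by (simp add: in_keys_iff)
  then have "size b1 = 1" using lookup_comult_tree(2)[OF c] by blast
  then obtain s where s: "b1 = {#s#}" using size_1_singleton_mset by blast
  then have "cut_count (rep c) a1 s \<noteq> 0" using ne lookup_comult_tree(1)[OF c] by auto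
  then have 3: "a1 \<subseteq># a \<and> s \<in># b \<and> cut_count (rep c) a1 s \<noteq> 0" using ab s by simp
  have IH: "size b2 = size Q" "\<forall>c\<in>#Q. \<exists>a' s. a' \<subseteq># a2 \<and> s \<in># b2 \<and> cut_count (rep c) a' s \<noteq> 0"
    using add.IH[OF _ 2] add.prems(1) by auto
  have 4: "\<exists>a' s. a' \<subseteq># a \<and> s \<in># b \<and> cut_count (rep d) a' s \<noteq> 0" if d: "d \<in># Q" for d
  proof -
    obtain a' t where t: "a' \<subseteq># a2" "t \<in># b2" "cut_count (rep d) a' t \<noteq> 0" using IH(2) d by blast
    have "a2 \<subseteq># a" "t \<in># b" using ab t by auto
    then show ?thesis using t subset_mset.order_trans by blast
  qed
  have "size b = size (add_mset c Q)" using ab s IH(1) by simp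
  moreover have "\<exists>a' s. a' \<subseteq># a \<and> s \<in># b \<and> cut_count (rep d) a' s \<noteq> 0" if "d \<in># add_mset c Q" for d
    using that 3 4 by (cases "d = c") auto
  ultimately show ?case by blast
qed

text \<open>The pair \<open>(a, b)\<close> offers finitely many partial crowns below
  \<open>a\<close> and bottoms in \<open>b\<close>; each combination occurs as a cut in finitely
  many classes of trees, by \<open>finite_cut_classes\<close>. So \<open>Q\<close> is a multiset of
  known size over a finite set \<open>Z\<close>.\<close>

lemma comult_summable: "formally_summable (comult_monomial P) (monomials (pi0 (ptrees P)))"
  unfolding formally_summable_def split_paired_All
proof (intro allI)
  fix a b :: "('i, 'ia, 'e, 'b, 'ba) ptree set multiset"
  have "{a'. a' \<subseteq># a} \<subseteq> fst ` {(x, y). x + y = a}"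
    by (auto simp: image_iff subset_mset.le_iff_add)
  then have fa: "finite {a'. a' \<subseteq># a}" using finite_splits finite_surj by blast
  define Z where "Z = (\<Union>a'\<in>{a'. a' \<subseteq># a}. \<Union>s\<in>set_mset b \<inter> pi0 (ptrees P). {c \<in> pi0 (ptrees P). cut_count (rep c) a' s \<noteq> 0})"
  have "finite Z" unfolding Z_def using fa finite_cut_classes(1) by blast
  then have "finite (multisets_of_size Z (size b))" by auto
  moreover have "{Q \<in> monomials (pi0 (ptrees P)). coeff (comult_monomial P Q) (a, b) \<noteq> 0} \<subseteq> multisets_of_size Z (size b)"
  proof
    fix Q assume "Q \<in> {Q \<in> monomials (pi0 (ptrees P)). coeff (comult_monomial P Q) (a, b) \<noteq> 0}"
    then have Q: "set_mset Q \<subseteq> pi0 (ptrees P)" "(a, b) \<in> Poly_Mapping.keys (\<Prod>c\<in>#Q. comult_tree P (rep c))"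
      by (auto simp: monomials_def coeff_comult_monomial in_keys_iff)
    note k = keys_prod_comult[OF Q]
    have "c \<in> Z" if "c \<in># Q" for c
    proof -
      obtain a' s where "a' \<subseteq># a" "s \<in># b" "cut_count (rep c) a' s \<noteq> 0" using k \<open>c \<in># Q\<close> by blast
      moreover have "c \<in> pi0 (ptrees P)" using Q(1) \<open>c \<in># Q\<close> by blast
      ultimately show ?thesis using cut_count_pi0[OF rep_ptree(1)] unfolding Z_def by blast
    qed
    then show "Q \<in> multisets_of_size Z (size b)" using k by (auto simp: multisets_of_size_def)
  qed
  ultimately show "finite {Q \<in> monomials (pi0 (ptrees P)). coeff (comult_monomial P Q) (a, b) \<noteq> 0}"
    by (rule rev_finite_subset)
qed

text \<open>The Green function is linear, so only monomials with a single tree contribute to its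
  comultiplication.\<close>

lemma coeff_comult_green:
  "coeff (comult_series P (green P)) (a, b) =
    (\<Sum>c | c \<in> pi0 (ptrees P) \<and> Poly_Mapping.lookup (comult_tree P (rep c)) (a, b) \<noteq> 0.
       Poly_Mapping.lookup (comult_tree P (rep c)) (a, b) / aut_card c)"
proof -
  let ?l = "\<lambda>c. Poly_Mapping.lookup (comult_tree P (rep c)) (a, b)"
  let ?t = "\<lambda>Q. coeff (green P) Q * coeff (comult_monomial P Q) (a, b)"
  let ?C = "{c \<in> pi0 (ptrees P). ?l c \<noteq> 0}"
  have g: "coeff (green P) {#c#} = (if c \<in> pi0 (ptrees P) then 1 / aut_card c else 0)"
     "size m \<noteq> 1 \<Longrightarrow> coeff (green P) m = 0" for c m
    using green_linear unfolding linear_series_def by blast+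
  have t: "?t {#c#} = ?l c / aut_card c" if "c \<in> pi0 (ptrees P)" for c
    using that by (simp add: g coeff_comult_monomial)
  have "{Q. Q \<in> monomials (pi0 (ptrees P)) \<and> ?t Q \<noteq> 0} = (\<lambda>c. {#c#}) ` ?C"
  proof (intro equalityI subsetI)
    fix Q assume "Q \<in> {Q. Q \<in> monomials (pi0 (ptrees P)) \<and> ?t Q \<noteq> 0}"
    then have Q: "Q \<in> monomials (pi0 (ptrees P))" "?t Q \<noteq> 0" by auto
    then have "size Q = 1" using g(2) by fastforce
    then obtain c where c: "Q = {#c#}" using size_1_singleton_mset by blast
    then have "c \<in> pi0 (ptrees P)" using Q(1) by (simp add: monomials_def)
    then show "Q \<in> (\<lambda>c. {#c#}) ` ?C" using t Q(2) c by auto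
  next
    fix Q assume "Q \<in> (\<lambda>c. {#c#}) ` ?C"
    then obtain c where c: "c \<in> pi0 (ptrees P)" "?l c \<noteq> 0" "Q = {#c#}" by blast
    then have "?t Q \<noteq> 0" using t[OF c(1)] aut_card_pos[OF c(1)] by simp
    then show "Q \<in> {Q. Q \<in> monomials (pi0 (ptrees P)) \<and> ?t Q \<noteq> 0}" using c by (simp add: monomials_def)
  qed
  then have "coeff (comult_series P (green P)) (a, b) = (\<Sum>Q\<in>(\<lambda>c. {#c#}) ` ?C. ?t Q)"
    by (simp add: comult_series_def coeff_formal_sum)
  also have "\<dots> = (\<Sum>c\<in>?C. ?l c / aut_card c)"
    by (subst sum.reindex) (auto simp: inj_on_def t intro!: sum.cong)
  finally show ?thesis .
qed

lemma coeff_tensor_green: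
  assumes n: "n \<in> multi_indices (gI P)"
  shows "coeff (series_tensor (green_power P n) (green_leaves P n)) (a, {#s#}) =
     (if s \<in> pi0 (ptrees P) \<and> leaf_class s = n then coeff (green_power P (leaf_class s)) a / aut_card s else 0)"
    "size b \<noteq> 1 \<Longrightarrow> coeff (series_tensor (green_power P n) (green_leaves P n)) (a, b) = 0"
  using green_leaves_linear[OF n] by (auto simp: linear_series_def)

text \<open>The right tensor factor is linear and its trees have leaf multi-index \<open>n\<close>.
  Hence \<open>b\<close> is a single tree and determines \<open>n\<close>, and each coefficient of
  the sum receives at most one contribution.\<close>

lemma tensor_support:
  "{n \<in> multi_indices (gI P). coeff (series_tensor (green_power P n) (green_leaves P n)) (a, b) \<noteq> 0}
    \<subseteq> leaf_class ` {s. b = {#s#} \<and> s \<in> pi0 (ptrees P)}"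
proof
  fix n assume "n \<in> {n \<in> multi_indices (gI P). coeff (series_tensor (green_power P n) (green_leaves P n)) (a, b) \<noteq> 0}"
  then have n: "n \<in> multi_indices (gI P)" "coeff (series_tensor (green_power P n) (green_leaves P n)) (a, b) \<noteq> 0" by auto
  then have "size b = 1" using coeff_tensor_green(2) by blast
  then obtain s where "b = {#s#}" using size_1_singleton_mset by blast
  then show "n \<in> leaf_class ` {s. b = {#s#} \<and> s \<in> pi0 (ptrees P)}"
    using n coeff_tensor_green(1)[OF n(1), of a s] by (auto split: if_splits)
qed

lemma tensor_summable:
  "formally_summable (\<lambda>n. series_tensor (green_power P n) (green_leaves P n)) (multi_indices (gI P))"
  unfolding formally_summable_def split_paired_All
proof (intro allI)
  fix a b :: "('i, 'ia, 'e, 'b, 'ba) ptree set multiset"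
  have "finite {s. b = {#s#} \<and> s \<in> pi0 (ptrees P)}"
    by (rule finite_subset[of _ "set_mset b"]) auto
  then show "finite {n \<in> multi_indices (gI P). coeff (series_tensor (green_power P n) (green_leaves P n)) (a, b) \<noteq> 0}"
    by (rule finite_surj[OF _ tensor_support])
qed

text \<open>If \<open>b\<close> is a single class \<open>s\<close>, both sides reduce to the same
  sum over labellings of the leaves of \<open>rep s\<close>, divided by |Aut(rep s)|. For any other
  \<open>b\<close> both coefficients vanish, since the bottom of a cut is one P-tree.\<close>

lemma faa_di_bruno:
  "comult_series P (green P) =
      formal_sum (\<lambda>n. series_tensor (green_power P n) (green_leaves P n)) (multi_indices (gI P))"
proof (rule series_eqI)
  fix m :: "('i, 'ia, 'e, 'b, 'ba) ptree set multiset \<times> ('i, 'ia, 'e, 'b, 'ba) ptree set multiset"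
  obtain a b where m: "m = (a, b)" by (cases m)
  let ?R = "formal_sum (\<lambda>n. series_tensor (green_power P n) (green_leaves P n)) (multi_indices (gI P))"
  show "coeff (comult_series P (green P)) m = coeff ?R m"
  proof (cases "\<exists>s\<in>pi0 (ptrees P). b = {#s#}")
    case True
    then obtain s where s: "s \<in> pi0 (ptrees P)" "b = {#s#}" by blast
    let ?t = "\<lambda>n. coeff (series_tensor (green_power P n) (green_leaves P n)) (a, b)"
    have "coeff ?R m = (\<Sum>n | n \<in> multi_indices (gI P) \<and> ?t n \<noteq> 0. ?t n)"
      by (simp add: coeff_formal_sum m)
    \<comment> \<open>The leaves of the bottom tree single out one multi-index.\<close>
    also have "\<dots> = (\<Sum>n\<in>{leaf_class s}. ?t n)"
    proof (rule sum.mono_neutral_left)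
      have "leaf_class ` {s'. b = {#s'#} \<and> s' \<in> pi0 (ptrees P)} = {leaf_class s}" using s by auto
      with tensor_support[of a b] show "{n. n \<in> multi_indices (gI P) \<and> ?t n \<noteq> 0} \<subseteq> {leaf_class s}"
        by (simp only:)
      show "\<forall>n\<in>{leaf_class s} - {n. n \<in> multi_indices (gI P) \<and> ?t n \<noteq> 0}. ?t n = 0"
        using leaf_class_multi_index[OF s(1)] by blast
    qed simp
    also have "\<dots> = coeff (green_power P (leaf_class s)) a / aut_card s"
      using coeff_tensor_green(1)[OF leaf_class_multi_index[OF s(1)], of a s] s by simp
    also have "\<dots> = (\<Sum>c | c \<in> pi0 (ptrees P) \<and> cut_count (rep c) a s \<noteq> 0. of_nat (cut_count (rep c) a s) / aut_card c)"
      unfolding finite_cut_classes(2)[OF s(1)] coeff_green_power[OF s(1)] by simp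
    also have "\<dots> = coeff (comult_series P (green P)) m"
      unfolding m coeff_comult_green s(2)
      by (rule sum.cong) (auto simp: lookup_comult_tree(1)[OF rep_ptree(1)])
    finally show ?thesis by simp
  next
    case False
    have "{n \<in> multi_indices (gI P). coeff (series_tensor (green_power P n) (green_leaves P n)) (a, b) \<noteq> 0} = {}"
      using tensor_support[of a b] False by blast
    then have "coeff ?R m = 0" unfolding m coeff_formal_sum by (simp only: sum.empty)
    moreover have "Poly_Mapping.lookup (comult_tree P (rep c)) (a, b) = 0" if c: "c \<in> pi0 (ptrees P)" for c
    proof (cases "size b = 1")
      case True
      then obtain s where s: "b = {#s#}" using size_1_singleton_mset by blast
      then show ?thesis
        using lookup_comult_tree(1)[OF rep_ptree(1)[OF c]] cut_count_pi0[OF rep_ptree(1)[OF c], of a s] False by auto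
    qed (use lookup_comult_tree(2)[OF rep_ptree(1)[OF c]] in blast)
    then have "coeff (comult_series P (green P)) m = 0"
      unfolding m coeff_comult_green by (intro sum.neutral) simp
    ultimately show ?thesis by simp
  qed
qed

end

theorem theorem7p3:
  fixes P :: "('i, 'ia, 'e, 'ea, 'b, 'ba) poly_diagram"
  assumes "is_poly_diagram P"
    and "finite (pi0 (gI P))"
    and "\<forall>T\<in>obs (ptrees P). finite (aut (ptrees P) T)"
  shows "formally_summable (comult_monomial P) (monomials (pi0 (ptrees P))) \<and>
    formally_summable (\<lambda>n. series_tensor (green_power P n) (green_leaves P n)) (multi_indices (gI P)) \<and>
    comult_series P (green P) =
      formal_sum (\<lambda>n. series_tensor (green_power P n) (green_leaves P n)) (multi_indices (gI P))"
proof -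
  interpret faa_di_bruno P using assms by unfold_locales
  show ?thesis using comult_summable tensor_summable faa_di_bruno by blast
qed

end
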